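(* Let $\varphi$ be a Finsler norm in $\mathbb{R}^{d}$. Given any bounded open set $U\subseteq\mathbb{R}^{d}$, if there are $\Lambda\in\mathbb{R}$ and $u\in C(\overline U)$ such that, in the viscosity sense, $$\min\{\varphi^{*}(Du)-\Lambda u,\,-G_{\varphi}^{*}(Du,D^{2}u)\}\le0\ \text{ in }U,\qquad \min\{\varphi^{*}(Du)-\Lambda u,\,-G_{*}^{\varphi}(Du,D^{2}u)\}\ge0\ \text{ in }U,$$ and $u=0$ on $\partial U$, then $\Lambda=\Lambda_{\infty}^{\varphi}(U)$, where $$\Lambda_{\infty}^{\varphi}(U)=\min\left\{\|\varphi^{*}(Dv)\|_{L^{\infty}(U)}: v\in W^{1,\infty}_{0}(U),\ \|v\|_{L^{\infty}(U)}=1\right\};$$ moreover $u\in W^{1,\infty}_{0}(U)$, and $\|u\|_{L^{\infty}(U)}^{-1}u$ attains the minimum defining $\Lambda_{\infty}^{\varphi}(U)$.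
   Context: A Finsler norm in $\mathbb{R}^d$ is a convex function $\varphi:\mathbb{R}^d\to[0,+\infty)$ with $\varphi(\lambda x)=\lambda\varphi(x)$ for all $\lambda>0$ and $\varphi(x)>0$ for $x\ne0$ (no symmetry is assumed). Its dual norm is $\varphi^{*}(p)=\max\{\langle p,q\rangle : \varphi(q)\le1\}$, and $\partial\varphi^{*}$ is the subdifferential of $\varphi^{*}$ (so $\partial\varphi^*(0)=\{\varphi\le 1\}$). For $p\in\mathbb{R}^d$ and a symmetric $d\times d$ matrix $X$, $$G_{\varphi}^{*}(p,X)=\max\{\langle Xq,q\rangle: q\in\partial\varphi^{*}(p)\},\qquad G_{*}^{\varphi}(p,X)=\min\{\langle Xq,q\rangle: q\in\partial\varphi^{*}(p)\}.$$ For an arbitrary function $F(x,r,p,X)$, $F(x,u,Du,D^2u)\le0$ in $U$ in the viscosity sense means: whenever $x_0\in U$, $\eta$ is smooth near $x_0$ and $u-\eta$ has a local maximum at $x_0$, then $F(x_0,u(x_0),D\eta(x_0),D^2\eta(x_0))\le0$; the inequality $\ge0$ is defined with local minima of $u-\eta$ and the reversed inequality. $W^{1,\infty}_0(U)$ denotes the functions in $W^{1,\infty}(U)$ vanishing on $\partial U$.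
   Formalization: Assumes U nonempty and u not identically 0 on any connected component of U; for non-even φ the minimum defining Λ_∞ is taken over v ≥ 0 only, and the claim with all competitors v is stated for even φ (it fails otherwise). *)

theory Defs
  imports "HOL-Analysis.Analysis" "HOL-Probability.Essential_Supremum"
begin

section \<open>Finsler norms and their duals\<close>

definition finsler_norm :: "(real^'n \<Rightarrow> real) \<Rightarrow> bool" where
  "finsler_norm \<phi> \<longleftrightarrow>
     convex_on UNIV \<phi> \<and>
     (\<forall>x. 0 \<le> \<phi> x) \<and>
     (\<forall>c x. 0 < c \<longrightarrow> \<phi> (c *\<^sub>R x) = c * \<phi> x) \<and>
     (\<forall>x. x \<noteq> 0 \<longrightarrow> 0 < \<phi> x)"

text \<open>For a Finsler norm the set of \<open>q\<close> with \<open>\<phi> q \<le> 1\<close> is compact and nonempty, and so is every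
  subdifferential of the dual norm. The suprema and infima below are therefore maxima and minima.\<close>

definition dual_norm :: "(real^'n \<Rightarrow> real) \<Rightarrow> real^'n \<Rightarrow> real" where
  "dual_norm \<phi> p = (SUP q\<in>{q. \<phi> q \<le> 1}. p \<bullet> q)"

definition subdifferential :: "(real^'n \<Rightarrow> real) \<Rightarrow> real^'n \<Rightarrow> (real^'n) set" where
  "subdifferential f p = {q. \<forall>y. f p + q \<bullet> (y - p) \<le> f y}"

definition G_upper :: "(real^'n \<Rightarrow> real) \<Rightarrow> real^'n \<Rightarrow> real^'n^'n \<Rightarrow> real" where
  "G_upper \<phi> p X = (SUP q\<in>subdifferential (dual_norm \<phi>) p. (X *v q) \<bullet> q)"

definition G_lower :: "(real^'n \<Rightarrow> real) \<Rightarrow> real^'n \<Rightarrow> real^'n^'n \<Rightarrow> real" where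
  "G_lower \<phi> p X = (INF q\<in>subdifferential (dual_norm \<phi>) p. (X *v q) \<bullet> q)"


section \<open>Smooth functions and viscosity inequalities\<close>

definition partial_deriv :: "'n \<Rightarrow> (real^'n \<Rightarrow> real) \<Rightarrow> real^'n \<Rightarrow> real" where
  "partial_deriv i f x = frechet_derivative f (at x) (axis i 1)"

definition grad :: "(real^'n \<Rightarrow> real) \<Rightarrow> real^'n \<Rightarrow> real^'n" where
  "grad f x = (\<chi> i. partial_deriv i f x)"

definition hessian :: "(real^'n \<Rightarrow> real) \<Rightarrow> real^'n \<Rightarrow> real^'n^'n" where
  "hessian f x = (\<chi> i j. partial_deriv i (partial_deriv j f) x)"

text \<open>\<open>Ck_on k f S\<close> is only meant for open \<open>S\<close>.\<close>

fun Ck_on :: "nat \<Rightarrow> (real^'n \<Rightarrow> real) \<Rightarrow> (real^'n) set \<Rightarrow> bool" where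
  "Ck_on 0 f S \<longleftrightarrow> continuous_on S f"
| "Ck_on (Suc k) f S \<longleftrightarrow> f differentiable_on S \<and> (\<forall>i. Ck_on k (partial_deriv i f) S)"

definition smooth_on :: "(real^'n \<Rightarrow> real) \<Rightarrow> (real^'n) set \<Rightarrow> bool" where
  "smooth_on f S \<longleftrightarrow> (\<forall>k. Ck_on k f S)"

definition viscosity_le ::
  "(real^'n \<Rightarrow> real \<Rightarrow> real^'n \<Rightarrow> real^'n^'n \<Rightarrow> real) \<Rightarrow> (real^'n \<Rightarrow> real) \<Rightarrow> (real^'n) set \<Rightarrow> bool"
  where
  "viscosity_le F u U \<longleftrightarrow>
     (\<forall>x0\<in>U. \<forall>\<eta> N. open N \<and> x0 \<in> N \<and> smooth_on \<eta> N \<and>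
        (\<forall>\<^sub>F x in at x0 within U. u x - \<eta> x \<le> u x0 - \<eta> x0) \<longrightarrow>
        F x0 (u x0) (grad \<eta> x0) (hessian \<eta> x0) \<le> 0)"

definition viscosity_ge ::
  "(real^'n \<Rightarrow> real \<Rightarrow> real^'n \<Rightarrow> real^'n^'n \<Rightarrow> real) \<Rightarrow> (real^'n \<Rightarrow> real) \<Rightarrow> (real^'n) set \<Rightarrow> bool"
  where
  "viscosity_ge F u U \<longleftrightarrow>
     (\<forall>x0\<in>U. \<forall>\<eta> N. open N \<and> x0 \<in> N \<and> smooth_on \<eta> N \<and>
        (\<forall>\<^sub>F x in at x0 within U. u x - \<eta> x \<ge> u x0 - \<eta> x0) \<longrightarrow>
        F x0 (u x0) (grad \<eta> x0) (hessian \<eta> x0) \<ge> 0)"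


section \<open>The Sobolev space and the variational eigenvalue\<close>

definition Linf :: "(real^'n) set \<Rightarrow> (real^'n \<Rightarrow> 'b::euclidean_space) set" where
  "Linf U = {f. f \<in> borel_measurable (lebesgue_on U) \<and>
                esssup (lebesgue_on U) (\<lambda>x. ereal (norm (f x))) < \<infinity>}"

text \<open>Only meaningful on \<^const>\<open>Linf\<close>, since \<^const>\<open>real_of_ereal\<close> sends infinity to 0.\<close>

definition Linf_norm :: "(real^'n) set \<Rightarrow> (real^'n \<Rightarrow> 'b::euclidean_space) \<Rightarrow> real" where
  "Linf_norm U f = real_of_ereal (esssup (lebesgue_on U) (\<lambda>x. ereal (norm (f x))))"

definition test_function :: "(real^'n) set \<Rightarrow> (real^'n \<Rightarrow> real) \<Rightarrow> bool" where
  "test_function U \<psi> \<longleftrightarrow>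
     smooth_on \<psi> UNIV \<and> compact (closure {x. \<psi> x \<noteq> 0}) \<and> closure {x. \<psi> x \<noteq> 0} \<subseteq> U"

definition is_weak_gradient ::
  "(real^'n) set \<Rightarrow> (real^'n \<Rightarrow> real) \<Rightarrow> (real^'n \<Rightarrow> real^'n) \<Rightarrow> bool" where
  "is_weak_gradient U v g \<longleftrightarrow>
     (\<forall>K. compact K \<and> K \<subseteq> U \<longrightarrow> set_integrable lebesgue K v \<and> set_integrable lebesgue K g) \<and>
     (\<forall>\<psi> i. test_function U \<psi> \<longrightarrow>
        (LINT x|lebesgue_on U. v x * partial_deriv i \<psi> x) =
        - (LINT x|lebesgue_on U. g x $ i * \<psi> x))"

text \<open>Weak gradients are unique up to null sets; \<open>weak_gradient\<close> picks a representative.\<close>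

definition weak_gradient :: "(real^'n) set \<Rightarrow> (real^'n \<Rightarrow> real) \<Rightarrow> real^'n \<Rightarrow> real^'n" where
  "weak_gradient U v = (SOME g. is_weak_gradient U v g)"

definition W1inf :: "(real^'n) set \<Rightarrow> (real^'n \<Rightarrow> real) set" where
  "W1inf U = {v. v \<in> Linf U \<and> (\<exists>g. is_weak_gradient U v g \<and> g \<in> Linf U)}"

text \<open>Elements of \<open>W1inf\<close> have a locally Lipschitz representative. In \<open>W1inf0\<close> that representative
  is used, extended continuously to the closure with boundary values 0; values of \<open>v\<close> outside
  the closure of \<open>U\<close> are irrelevant.\<close>

definition W1inf0 :: "(real^'n) set \<Rightarrow> (real^'n \<Rightarrow> real) set" where
  "W1inf0 U = {v. v \<in> W1inf U \<and> continuous_on (closure U) v \<and> (\<forall>x\<in>frontier U. v x = 0)}"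

definition admissible :: "(real^'n) set \<Rightarrow> (real^'n \<Rightarrow> real) set" where
  "admissible U = {v. v \<in> W1inf0 U \<and> Linf_norm U v = 1}"

definition finsler_energy :: "(real^'n \<Rightarrow> real) \<Rightarrow> (real^'n) set \<Rightarrow> (real^'n \<Rightarrow> real) \<Rightarrow> real" where
  "finsler_energy \<phi> U v = Linf_norm U (\<lambda>x. dual_norm \<phi> (weak_gradient U v x))"

definition Lambda_inf :: "(real^'n \<Rightarrow> real) \<Rightarrow> (real^'n) set \<Rightarrow> real" where
  "Lambda_inf \<phi> U = (INF v\<in>admissible U. finsler_energy \<phi> U v)"

text \<open>Solutions of the eigenvalue problem are nonnegative. For an even \<open>\<phi>\<close> every competitor \<open>v\<close> may be
  replaced by its absolute value, but without symmetry a competitor of the other sign can have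
  smaller energy: if the set of \<open>x\<close> with \<open>\<phi> x \<le> 1\<close> is a triangle centred at its centroid and \<open>U\<close> is its interior,
  then \<open>\<phi> - 1\<close> has energy 1, while every nonnegative competitor has energy at least 2. The
  variational eigenvalue for nonnegative competitors is the one matching solutions for all \<open>\<phi>\<close>;
  it agrees with \<^const>\<open>Lambda_inf\<close> when \<open>\<phi>\<close> is even.\<close>

definition admissible_nonneg :: "(real^'n) set \<Rightarrow> (real^'n \<Rightarrow> real) set" where
  "admissible_nonneg U = {v \<in> admissible U. \<forall>x\<in>U. 0 \<le> v x}"

definition Lambda_inf_nonneg :: "(real^'n \<Rightarrow> real) \<Rightarrow> (real^'n) set \<Rightarrow> real" where
  "Lambda_inf_nonneg \<phi> U = (INF v\<in>admissible_nonneg U. finsler_energy \<phi> U v)"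

end

theory Submission
  imports Defs
begin

text \<open>The Legendre transform of a log-partition function smooths the cone \<open>K \<phi>\<close> to a function \<open>W\<close>
  whose Hessian is arbitrarily small in the directions \<open>q \<in> \<partial>\<phi>\<^sup>*(DW)\<close>. This requires neither smoothness
  nor strict convexity of \<open>\<phi>\<close>, and allows both viscosity inequalities to be tested against cones.
  The subsolution property then gives \<open>u x - u y \<le> \<Lambda> (max u) \<phi> (x - y)\<close>, so the energy
  of \<open>u\<close> is at most \<open>\<Lambda> (max u)\<close>. The supersolution property gives a Harnack inequality, hence \<open>u > 0\<close>,
  and, by comparing \<open>u\<close> once more with a smoothed cone, \<open>\<Lambda> s \<le> 1\<close> for the radius \<open>s\<close> of every backward ball
  \<open>{y. \<phi> (x - y) < s}\<close> inside \<open>U\<close>. A competitor \<open>v\<close> of energy \<open>E\<close> satisfies \<open>v x \<le> E \<phi> (x - y)\<close> for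
  \<open>x \<in> U\<close>, \<open>y \<notin> U\<close>, so the backward ball of radius \<open>v x / E\<close> lies in \<open>U\<close> and \<open>\<Lambda> (max v) \<le> E\<close>.\<close>

subsection \<open>Duality of Finsler norms\<close>

text \<open>A cone \<open>K * \<phi>\<close> cannot itself serve as a test function:
  \<open>\<phi>\<close> may have edges, and where \<open>dual_norm \<phi>\<close> is not
  differentiable its subdifferential is a whole face of the unit ball, so the Hessian of a
  regularised cone has to be small in all directions of that face at once. Inverting a covariance
  gives this: a long segment of near-maximisers in direction \<open>q\<close> forces a large
  variance, hence a small Hessian of the conjugate. Only one half of the second-order expansion is
  ever needed, an upper bound by a quadratic polynomial, so the smoothed cone is never
  differentiated and quadratic polynomials are the only test functions. Since \<open>\<phi>\<close>
  need not be even, negating \<open>u\<close> alone would replace \<open>\<phi>\<close> by its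
  reflection; supersolutions are therefore studied through
  \<open>\<xi> \<mapsto> - u (z - \<xi>)\<close>, which keeps gradients and turns backward balls
  into sublevel sets of \<open>\<phi>\<close>. The same asymmetry explains the nonnegative
  competitors: negative values are controlled only by distances to the complement measured in the
  opposite direction, about which backward balls say nothing.\<close>

locale finsler =
  fixes \<phi> :: "real^'n \<Rightarrow> real"
  assumes finsler: "finsler_norm \<phi>"
begin

lemma phi_convex: "convex_on UNIV \<phi>"
  and phi_nonneg [simp]: "0 \<le> \<phi> x"
  and phi_pos: "x \<noteq> 0 \<Longrightarrow> 0 < \<phi> x"
  using finsler by (auto simp: finsler_norm_def)

lemma phi_zero [simp]: "\<phi> 0 = 0"
proof -
  have "\<phi> (2 *\<^sub>R 0) = 2 * \<phi> 0"
    using finsler unfolding finsler_norm_def by (metis zero_less_numeral)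
  then show ?thesis by simp
qed

lemma phi_scale: "0 \<le> c \<Longrightarrow> \<phi> (c *\<^sub>R x) = c * \<phi> x"
  using finsler by (cases "c = 0") (auto simp: finsler_norm_def)

lemma phi_triangle: "\<phi> (x + y) \<le> \<phi> x + \<phi> y"
proof -
  have "\<phi> ((1/2) *\<^sub>R (2 *\<^sub>R x) + (1/2) *\<^sub>R (2 *\<^sub>R y)) \<le> (1/2) * \<phi> (2 *\<^sub>R x) + (1/2) * \<phi> (2 *\<^sub>R y)"
    using phi_convex[unfolded convex_on_def, THEN conjunct2, rule_format, of "2 *\<^sub>R x" "2 *\<^sub>R y" "1/2" "1/2"] by auto
  then show ?thesis by (simp add: phi_scale)
qed

lemma phi_continuous_on: "continuous_on A \<phi>"
  using convex_on_continuous[OF open_UNIV phi_convex] continuous_on_subset by blast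

lemma phi_continuous_on_comp [continuous_intros]:
  "continuous_on A f \<Longrightarrow> continuous_on A (\<lambda>x. \<phi> (f x))"
  by (rule continuous_on_compose2[OF phi_continuous_on[of UNIV]]) auto

lemma phi_bounds:
  obtains c d where "0 < c" "0 < d" "\<And>x. c * norm x \<le> \<phi> x" "\<And>x. \<phi> x \<le> d * norm x"
proof -
  obtain i :: 'n where True by simp
  have ne: "axis i 1 \<in> sphere (0::real^'n) 1" by simp
  have cpt: "compact (sphere (0::real^'n) 1)" by simp
  obtain a where a: "a \<in> sphere (0::real^'n) 1" "\<And>x. x \<in> sphere 0 1 \<Longrightarrow> \<phi> a \<le> \<phi> x"
    using continuous_attains_inf[OF cpt _ phi_continuous_on] ne by blast
  obtain b where b: "b \<in> sphere (0::real^'n) 1" "\<And>x. x \<in> sphere 0 1 \<Longrightarrow> \<phi> x \<le> \<phi> b"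
    using continuous_attains_sup[OF cpt _ phi_continuous_on] ne by blast
  have *: "\<phi> x = norm x * \<phi> (x /\<^sub>R norm x)" if "x \<noteq> 0" for x
    using phi_scale[of "norm x" "x /\<^sub>R norm x"] that by simp
  have s: "x /\<^sub>R norm x \<in> sphere 0 1" if "x \<noteq> 0" for x :: "real^'n"
    using that by simp
  show ?thesis
  proof
    show "0 < \<phi> a" "0 < \<phi> b"
      using a b by (auto intro!: phi_pos)
    show "\<phi> a * norm x \<le> \<phi> x" for x
      using a(2)[OF s[of x]] *[of x] mult_left_mono[of "\<phi> a" "\<phi> (x /\<^sub>R norm x)" "norm x"]
      by (cases "x = 0") (auto simp: mult.commute)
    show "\<phi> x \<le> \<phi> b * norm x" for x
      using b(2)[OF s[of x]] *[of x] mult_left_mono[of "\<phi> (x /\<^sub>R norm x)" "\<phi> b" "norm x"]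
      by (cases "x = 0") (auto simp: mult.commute)
  qed
qed

lemma phi_ball_compact: "compact {x. \<phi> x \<le> r}"
proof -
  obtain c where c: "0 < c" "\<And>x. c * norm x \<le> \<phi> x" using phi_bounds by metis
  have "closed {x. \<phi> x \<le> r}"
    by (intro closed_Collect_le phi_continuous_on continuous_intros)
  moreover have "bounded {x. \<phi> x \<le> r}"
    unfolding bounded_iff
  proof (intro exI ballI)
    fix x assume "x \<in> {x. \<phi> x \<le> r}"
    then have "c * norm x \<le> r" using c(2)[of x] by simp
    then show "norm x \<le> r / c" using c(1) by (simp add: field_simps)
  qed
  ultimately show ?thesis by (simp add: compact_eq_bounded_closed)
qed

lemma phi_ball_convex: "convex {x. \<phi> x \<le> r}"
proof (rule convexI)
  fix x y :: "real^'n" and u v :: real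
  assume *: "x \<in> {x. \<phi> x \<le> r}" "y \<in> {x. \<phi> x \<le> r}" "0 \<le> u" "0 \<le> v" "u + v = 1"
  have "\<phi> (u *\<^sub>R x + v *\<^sub>R y) \<le> u * \<phi> x + v * \<phi> y"
    using phi_triangle[of "u *\<^sub>R x" "v *\<^sub>R y"] * by (simp add: phi_scale)
  also have "\<dots> \<le> u * r + v * r" using * by (intro add_mono mult_left_mono) auto
  finally show "u *\<^sub>R x + v *\<^sub>R y \<in> {x. \<phi> x \<le> r}" using * by (simp flip: distrib_right)
qed

lemma bdd_above_dual: "bdd_above ((\<lambda>q. p \<bullet> q) ` {q. \<phi> q \<le> 1})"
  by (intro bounded_imp_bdd_above compact_imp_bounded compact_continuous_image
      continuous_intros phi_ball_compact)

lemma dual_attained: obtains q where "\<phi> q \<le> 1" "p \<bullet> q = dual_norm \<phi> p"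
proof -
  have "{q. \<phi> q \<le> 1} \<noteq> {}" by (auto intro: exI[of _ 0])
  then obtain q where q: "\<phi> q \<le> 1" "\<And>y. \<phi> y \<le> 1 \<Longrightarrow> p \<bullet> y \<le> p \<bullet> q"
    using continuous_attains_sup[OF phi_ball_compact[of 1] _ continuous_on_inner[OF continuous_on_const continuous_on_id], of p]
    by auto
  have "(SUP q\<in>{q. \<phi> q \<le> 1}. p \<bullet> q) = p \<bullet> q"
    using q by (intro cSup_eq_maximum) auto
  then show ?thesis using that q by (simp add: dual_norm_def)
qed

lemma inner_le_dual: "p \<bullet> x \<le> dual_norm \<phi> p * \<phi> x"
proof (cases "x = 0")
  case False
  then have *: "0 < \<phi> x" by (rule phi_pos)
  have "p \<bullet> (x /\<^sub>R \<phi> x) \<le> dual_norm \<phi> p"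
    unfolding dual_norm_def using *
    by (intro cSUP_upper bdd_above_dual) (auto simp: phi_scale)
  then show ?thesis using * by (simp add: field_simps)
qed simp

lemma dual_least: "(\<And>q. \<phi> q \<le> 1 \<Longrightarrow> p \<bullet> q \<le> c) \<Longrightarrow> dual_norm \<phi> p \<le> c"
  by (metis dual_attained)

lemma dual_leI: assumes "\<And>q. p \<bullet> q \<le> c * \<phi> q" "0 \<le> c" shows "dual_norm \<phi> p \<le> c"
proof (rule dual_least)
  fix q assume "\<phi> q \<le> 1"
  then have "c * \<phi> q \<le> c * 1" using assms(2) by (intro mult_left_mono) auto
  then show "p \<bullet> q \<le> c" using assms(1)[of q] by simp
qed

lemma dual_nonneg [simp]: "0 \<le> dual_norm \<phi> p"
  using inner_le_dual[of p 0] cSUP_upper[OF _ bdd_above_dual[of p], of 0]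
  by (simp add: dual_norm_def)

lemma dual_zero [simp]: "dual_norm \<phi> 0 = 0"
  by (metis dual_attained inner_zero_left)

lemma dual_pos: assumes "p \<noteq> 0" shows "0 < dual_norm \<phi> p"
proof -
  have "0 < p \<bullet> p" using assms by simp
  also have "\<dots> \<le> dual_norm \<phi> p * \<phi> p" by (rule inner_le_dual)
  finally show ?thesis by (metis dual_nonneg less_eq_real_def mult_zero_left)
qed

lemma dual_scale: assumes "0 \<le> c" shows "dual_norm \<phi> (c *\<^sub>R p) = c * dual_norm \<phi> p"
proof (rule antisym)
  show "dual_norm \<phi> (c *\<^sub>R p) \<le> c * dual_norm \<phi> p"
    using inner_le_dual assms
    by (intro dual_leI) (auto simp: mult.assoc intro!: mult_left_mono)
  obtain q where q: "\<phi> q \<le> 1" "p \<bullet> q = dual_norm \<phi> p" by (rule dual_attained)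
  have "c * dual_norm \<phi> p = (c *\<^sub>R p) \<bullet> q" using q by simp
  also have "\<dots> \<le> dual_norm \<phi> (c *\<^sub>R p) * \<phi> q" by (rule inner_le_dual)
  also have "\<dots> \<le> dual_norm \<phi> (c *\<^sub>R p) * 1" using q by (intro mult_left_mono) auto
  finally show "c * dual_norm \<phi> p \<le> dual_norm \<phi> (c *\<^sub>R p)" by simp
qed

lemma dual_triangle: "dual_norm \<phi> (p + p') \<le> dual_norm \<phi> p + dual_norm \<phi> p'"
  using inner_le_dual[of p] inner_le_dual[of p']
  by (intro dual_leI) (auto simp: inner_add_left distrib_right intro: add_mono)

lemma dual_convex: "convex_on UNIV (dual_norm \<phi>)"
proof (rule convex_onI)
  fix t :: real and x y assume "0 < t" "t < 1"
  then show "dual_norm \<phi> ((1 - t) *\<^sub>R x + t *\<^sub>R y) \<le> (1 - t) * dual_norm \<phi> x + t * dual_norm \<phi> y"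
    using dual_triangle[of "(1 - t) *\<^sub>R x" "t *\<^sub>R y"] by (simp add: dual_scale)
qed simp

lemma dual_continuous_on: "continuous_on A (dual_norm \<phi>)"
  using convex_on_continuous[OF open_UNIV dual_convex] continuous_on_subset by blast

lemma dual_upper: obtains c where "0 < c" "\<And>p. dual_norm \<phi> p \<le> c * norm p"
proof -
  obtain c where c: "0 < c" "\<And>x. c * norm x \<le> \<phi> x" using phi_bounds by metis
  show ?thesis
  proof
    show "0 < 1 / c" using c by simp
    fix p
    show "dual_norm \<phi> p \<le> 1 / c * norm p"
    proof (rule dual_leI)
      fix q
      have "p \<bullet> q \<le> norm p * norm q" by (rule norm_cauchy_schwarz)
      also have "\<dots> \<le> norm p * (\<phi> q / c)"
        using c by (intro mult_left_mono) (auto simp: field_simps)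
      finally show "p \<bullet> q \<le> 1 / c * norm p * \<phi> q" by (simp add: field_simps)
    qed (use c in simp)
  qed
qed

lemma dual_lower: obtains c where "0 < c" "\<And>p. norm p \<le> c * dual_norm \<phi> p"
proof -
  obtain d where d: "0 < d" "\<And>x. \<phi> x \<le> d * norm x" using phi_bounds by metis
  have "norm p \<le> d * dual_norm \<phi> p" for p
  proof (cases "p = 0")
    case False
    have "norm p * norm p = p \<bullet> p" by (simp add: dot_square_norm power2_eq_square)
    also have "\<dots> \<le> dual_norm \<phi> p * \<phi> p" by (rule inner_le_dual)
    also have "\<dots> \<le> dual_norm \<phi> p * (d * norm p)" by (intro mult_left_mono d) auto
    finally show ?thesis using False by (simp add: field_simps)
  qed simp
  then show ?thesis using that d by blast
qed

text \<open>Bipolar theorem: a hyperplane separating \<open>q\<close> from the compact convex unit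
  ball supplies a covector, \<open>- a\<close>, that violates the hypothesis.\<close>

lemma bipolar: assumes "\<And>p. p \<bullet> q \<le> dual_norm \<phi> p" shows "\<phi> q \<le> 1"
proof (rule ccontr)
  assume "\<not> \<phi> q \<le> 1"
  then obtain a b where ab: "a \<bullet> q < b" "\<And>x. \<phi> x \<le> 1 \<Longrightarrow> b < a \<bullet> x"
    using separating_hyperplane_closed_point[of "{x. \<phi> x \<le> 1}" q]
      phi_ball_convex phi_ball_compact compact_imp_closed by (metis mem_Collect_eq)
  have "dual_norm \<phi> (- a) \<le> - b" using ab by (intro dual_least) force
  then show False using ab(1) assms[of "- a"] by simp
qed

text \<open>Testing the subgradient inequality at \<open>0\<close> and at
  \<open>2 *\<^sub>R p\<close> forces equality in it by homogeneity; what remains is a bound by the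
  dual norm in every direction, to which \<open>bipolar\<close> applies.\<close>

lemma subdifferential_dual_iff:
  "q \<in> subdifferential (dual_norm \<phi>) p \<longleftrightarrow> \<phi> q \<le> 1 \<and> p \<bullet> q = dual_norm \<phi> p"
proof
  assume q: "q \<in> subdifferential (dual_norm \<phi>) p"
  then have *: "dual_norm \<phi> p + q \<bullet> (y - p) \<le> dual_norm \<phi> y" for y
    by (simp add: subdifferential_def)
  have eq: "p \<bullet> q = dual_norm \<phi> p"
    using *[of 0] *[of "2 *\<^sub>R p"] by (simp add: dual_scale algebra_simps inner_commute)
  then have "p \<bullet> q \<le> dual_norm \<phi> p" for p
    using *[of p] by (simp add: inner_commute algebra_simps)
  then show "\<phi> q \<le> 1 \<and> p \<bullet> q = dual_norm \<phi> p" using eq bipolar by blast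
next
  assume q: "\<phi> q \<le> 1 \<and> p \<bullet> q = dual_norm \<phi> p"
  have "q \<bullet> y \<le> dual_norm \<phi> y" for y
    using inner_le_dual[of y q] mult_left_mono[of "\<phi> q" 1 "dual_norm \<phi> y"] q
    by (simp add: inner_commute)
  then show "q \<in> subdifferential (dual_norm \<phi>) p"
    using q by (simp add: subdifferential_def inner_diff_right inner_commute)
qed

lemma subdifferential_dual_nonempty: "subdifferential (dual_norm \<phi>) p \<noteq> {}"
  by (metis dual_attained subdifferential_dual_iff empty_iff)

lemma subdifferential_dual_scale:
  assumes "0 < c"
  shows "subdifferential (dual_norm \<phi>) (c *\<^sub>R p) = subdifferential (dual_norm \<phi>) p"
  using assms by (auto simp: subdifferential_dual_iff dual_scale)

lemma phi_supporting: obtains p where "dual_norm \<phi> p \<le> 1" "p \<bullet> x = \<phi> x"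
proof -
  have "\<exists>p. dual_norm \<phi> p \<le> 1 \<and> \<phi> x \<le> p \<bullet> x"
  proof (cases "x = 0")
    case False
    then have x: "0 < \<phi> x" by (rule phi_pos)
    define K where "K = {p. dual_norm \<phi> p \<le> 1}"
    have "closed K" unfolding K_def
      by (intro closed_Collect_le dual_continuous_on continuous_intros)
    moreover obtain c where c: "0 < c" "\<And>p. norm p \<le> c * dual_norm \<phi> p"
      using dual_lower by blast
    have "bounded K" unfolding bounded_iff K_def
      using c mult_left_mono[of _ 1 c] by (intro exI[of _ c]) (fastforce intro: order_trans)
    ultimately have "compact K" by (simp add: compact_eq_bounded_closed)
    moreover have "K \<noteq> {}" by (auto simp: K_def intro: exI[of _ 0])
    ultimately obtain p where p: "p \<in> K" "\<And>p'. p' \<in> K \<Longrightarrow> p' \<bullet> x \<le> p \<bullet> x"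
      using continuous_attains_sup[OF _ _ continuous_on_inner[OF continuous_on_id continuous_on_const], of K x] by auto
    \<comment> \<open>The slack \<open>e\<close> permits the division: \<open>p \<bullet> x\<close>
      is so far only known to be nonnegative.\<close>
    have "\<phi> x \<le> p \<bullet> x + e" if "0 < e" for e
    proof -
      have pos: "0 \<le> p \<bullet> x" using p(2)[of 0] by (simp add: K_def)
      have "\<phi> (x /\<^sub>R (p \<bullet> x + e)) \<le> 1"
      proof (rule bipolar)
        fix p'
        show "p' \<bullet> (x /\<^sub>R (p \<bullet> x + e)) \<le> dual_norm \<phi> p'"
        proof (cases "p' = 0")
          case False
          then have d: "0 < dual_norm \<phi> p'" by (rule dual_pos)
          then have "(p' /\<^sub>R dual_norm \<phi> p') \<bullet> x \<le> p \<bullet> x"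
            by (intro p) (simp add: K_def dual_scale)
          then have "p' \<bullet> x \<le> dual_norm \<phi> p' * (p \<bullet> x)"
            using d by (simp add: field_simps)
          also have "\<dots> \<le> dual_norm \<phi> p' * (p \<bullet> x + e)"
            using that by (intro mult_left_mono) auto
          finally show ?thesis using pos that by (simp add: field_simps)
        qed simp
      qed
      then show ?thesis using pos that by (simp add: phi_scale field_simps)
    qed
    then have "\<phi> x \<le> p \<bullet> x" by (rule field_le_epsilon)
    then show ?thesis using p by (auto simp: K_def)
  qed (auto intro: exI[of _ 0])
  then obtain p where p: "dual_norm \<phi> p \<le> 1" "\<phi> x \<le> p \<bullet> x" by blast
  moreover have "p \<bullet> x \<le> \<phi> x"
    using inner_le_dual[of p x] mult_right_mono[OF p(1), of "\<phi> x"] by simp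
  ultimately show ?thesis using that by (meson antisym)
qed

end

subsection \<open>Gibbs measures of convex potentials\<close>

lemma exp_upper_quadratic:
  fixes s :: real assumes "\<bar>s\<bar> \<le> 1" shows "exp s \<le> 1 + s + s\<^sup>2"
proof (cases "0 \<le> s")
  case True
  then show ?thesis using assms exp_bound[of s] by simp
next
  case False
  have "exp s * (1 - s) \<le> exp s * exp (- s)"
    using exp_ge_add_one_self[of "- s"] by (intro mult_left_mono) auto
  also have "\<dots> = 1" by (simp flip: exp_add)
  also have "\<dots> \<le> (1 + s + s\<^sup>2) * (1 - s)"
  proof -
    have "s * s\<^sup>2 \<le> 0" using False by (intro mult_nonpos_nonneg) auto
    then show ?thesis by (simp add: algebra_simps power2_eq_square)
  qed
  finally show ?thesis using False by (simp add: mult_le_cancel_right)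
qed

text \<open>For negative \<open>s\<close> the Taylor coefficient 1/2 is too large because the cubic
  term is negative; 1/3 leaves enough room on this interval.\<close>

lemma exp_lower_quadratic:
  fixes s :: real assumes "\<bar>s\<bar> \<le> 1/2" shows "1 + s + s\<^sup>2 / 3 \<le> exp s"
proof (cases "0 \<le> s")
  case True
  then show ?thesis using exp_lower_Taylor_quadratic[of s] zero_le_power2[of s] by linarith
next
  case False
  \<comment> \<open>This rests on (1 - r + r^2/2) (1 + r + r^2/2) = 1 + r^4/4, which is at least
    1.\<close>
  have up: "exp (- r) \<le> 1 - r + r\<^sup>2 / 2" if "0 \<le> r" for r :: real
  proof -
    have "0 \<le> r^4 / 4" by simp
    then have "1 \<le> (1 - r + r\<^sup>2 / 2) * (1 + r + r\<^sup>2 / 2)"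
      by (simp add: algebra_simps power2_eq_square power4_eq_xxxx)
    also have "\<dots> \<le> (1 - r + r\<^sup>2 / 2) * exp r"
    proof (intro mult_left_mono)
      show "1 + r + r\<^sup>2 / 2 \<le> exp r" using exp_lower_Taylor_quadratic[OF that] .
      have "0 \<le> (1 - r)\<^sup>2 + 1" by simp
      then show "0 \<le> 1 - r + r\<^sup>2 / 2" by (simp add: power2_eq_square algebra_simps)
    qed
    finally have "exp (- r) * 1 \<le> exp (- r) * ((1 - r + r\<^sup>2 / 2) * exp r)"
      by (intro mult_left_mono) auto
    moreover have "exp (- r) * (a * exp r) = a" for a :: real
      by (simp add: exp_minus)
    ultimately show ?thesis by simp
  qed
  define f where "f r = exp (- r) - (1 - r + r\<^sup>2 / 3)" for r :: real
  have "f 0 \<le> f (- s)"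
  proof (rule DERIV_nonneg_imp_nondecreasing[of 0 "- s" f])
    show "0 \<le> - s" using False by simp
    fix r assume r: "0 \<le> r" "r \<le> - s"
    have "(f has_real_derivative (1 - 2 * r / 3 - exp (- r))) (at r)"
      unfolding f_def by (auto intro!: derivative_eq_intros)
    moreover have "0 \<le> 1 - 2 * r / 3 - exp (- r)"
    proof -
      have "r * r \<le> (1/2) * r" using r assms by (intro mult_right_mono) auto
      moreover have "exp (- r) \<le> 1 - r + r * r / 2"
        using up[OF r(1)] by (simp only: power2_eq_square)
      ultimately show ?thesis using r(1) by linarith
    qed
    ultimately show "\<exists>y. (f has_real_derivative y) (at r) \<and> 0 \<le> y" by blast
  qed
  then show ?thesis by (simp add: f_def)
qed

section \<open>Affine changes of variables\<close>

lemma lborel_integral_affine: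
  fixes f :: "'a::euclidean_space \<Rightarrow> 'b::{banach,second_countable_topology}"
  assumes "c \<noteq> 0" and [measurable]: "f \<in> borel_measurable borel"
  shows "(LINT x|lborel. f x) = \<bar>c\<bar> ^ DIM('a) *\<^sub>R (LINT x|lborel. f (t + c *\<^sub>R x))"
  by (subst lborel_affine[OF assms(1), of t], subst integral_density)
    (auto simp: integral_distr)

lemma lborel_integrable_affine:
  fixes f :: "'a::euclidean_space \<Rightarrow> 'b::{banach,second_countable_topology}"
  assumes "c \<noteq> 0" "integrable lborel f"
  shows "integrable lborel (\<lambda>x. f (t + c *\<^sub>R x))"
proof -
  have [measurable]: "f \<in> borel_measurable borel" using assms by auto
  have "integrable (density (distr lborel borel (\<lambda>x. t + c *\<^sub>R x)) (\<lambda>_. ennreal (\<bar>c\<bar>^DIM('a)))) f"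
    using assms lborel_affine[OF assms(1), of t] by (metis ennreal_power abs_ge_zero)
  then have "integrable (distr lborel borel (\<lambda>x. t + c *\<^sub>R x)) (\<lambda>x. \<bar>c\<bar>^DIM('a) *\<^sub>R f x)"
    by (subst (asm) integrable_density) auto
  then have "integrable lborel (\<lambda>x. \<bar>c\<bar>^DIM('a) *\<^sub>R f (t + c *\<^sub>R x))"
    by (subst (asm) integrable_distr_eq) auto
  then have "integrable lborel (\<lambda>x. inverse (\<bar>c\<bar>^DIM('a)) *\<^sub>R (\<bar>c\<bar>^DIM('a) *\<^sub>R f (t + c *\<^sub>R x)))"
    by (rule integrable_scaleR_right)
  moreover have "\<bar>c\<bar>^DIM('a) \<noteq> 0" using assms(1) by simp
  ultimately show ?thesis by (simp add: scaleR_scaleR)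
qed

lemma set_integrable_continuous_compact:
  fixes f :: "'a::euclidean_space \<Rightarrow> 'b::{banach,second_countable_topology}"
  shows "compact C \<Longrightarrow> continuous_on C f \<Longrightarrow> set_integrable lborel C f"
  unfolding set_integrable_def by (rule borel_integrable_compact)

text \<open>The substitution y -> (z + y)/2 has Jacobian \<open>2 ^ DIM('a)\<close> on the integral
  side, convexity keeps the image inside \<open>C\<close>, and nonnegativity of \<open>F\<close>
  allows enlarging the image to \<open>C\<close>.\<close>

lemma homothety_integral_le:
  fixes F :: "'a::euclidean_space \<Rightarrow> real"
  assumes C: "compact C" "convex C" and F: "continuous_on C F" "\<And>y. y \<in> C \<Longrightarrow> 0 \<le> F y"
    and z: "z \<in> C"
  shows "(LINT y:C|lborel. F ((1/2) *\<^sub>R z + (1/2) *\<^sub>R y)) \<le> 2 ^ DIM('a) * (LINT y:C|lborel. F y)"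
proof -
  define G where "G y = indicator C y *\<^sub>R F y" for y
  have G: "integrable lborel G"
    using set_integrable_continuous_compact[OF C(1) F(1)] by (simp add: set_integrable_def G_def[abs_def])
  have mid: "(1/2) *\<^sub>R z + (1/2) *\<^sub>R y \<in> C" if "y \<in> C" for y
    using C(2) z that by (auto simp: convex_def)
  have "(LINT y:C|lborel. F ((1/2) *\<^sub>R z + (1/2) *\<^sub>R y)) \<le> (LINT y|lborel. G ((1/2) *\<^sub>R z + (1/2) *\<^sub>R y))"
    unfolding set_lebesgue_integral_def
  proof (rule integral_mono)
    have "set_integrable lborel C (\<lambda>y. F ((1/2) *\<^sub>R z + (1/2) *\<^sub>R y))"
      by (intro set_integrable_continuous_compact C continuous_on_compose2[OF F(1)] continuous_intros)
        (use mid in auto)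
    then show "integrable lborel (\<lambda>y. indicator C y *\<^sub>R F ((1/2) *\<^sub>R z + (1/2) *\<^sub>R y))"
      by (simp add: set_integrable_def)
    show "integrable lborel (\<lambda>y. G ((1/2) *\<^sub>R z + (1/2) *\<^sub>R y))"
      using G by (rule lborel_integrable_affine[rotated]) simp
    show "indicator C y *\<^sub>R F ((1/2) *\<^sub>R z + (1/2) *\<^sub>R y) \<le> G ((1/2) *\<^sub>R z + (1/2) *\<^sub>R y)" for y
      using mid[of y] F(2) by (auto simp: G_def indicator_def)
  qed
  also have "\<dots> = 2 ^ DIM('a) * (LINT y|lborel. G y)"
    using G by (subst lborel_integral_affine[of "1/2" G "(1/2) *\<^sub>R z"]) (auto simp: power_divide)
  finally show ?thesis by (simp add: G_def set_lebesgue_integral_def)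
qed

section \<open>Log-partition functions and their convexity\<close>

locale gibbs =
  fixes C :: "'a::euclidean_space set" and V :: "'a \<Rightarrow> real" and \<epsilon> :: real
  assumes C: "compact C" "convex C" "interior C \<noteq> {}"
    and V: "continuous_on C V" "convex_on C V" and eps: "0 < \<epsilon>"
begin

text \<open>\<open>H\<close> is a smooth convex approximation of the conjugate of \<open>V\<close> on \<open>C\<close>; the Hessian of its Legendre transform
  \<open>W\<close> is the inverse of the covariance of the Gibbs measure \<open>w p / Z p\<close>, up to the factor \<open>\<epsilon>\<close>.\<close>

definition "w p y = exp ((y \<bullet> p - V y) / \<epsilon>)"
definition "Z p = (LINT y:C|lborel. w p y)"
definition "H p = \<epsilon> * ln (Z p)"
definition "W x = (SUP p. p \<bullet> x - H p)"

lemma w_pos: "0 < w p y" by (simp add: w_def)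

lemma w_cont: "continuous_on C (w p)"
  unfolding w_def using eps by (intro continuous_intros V) auto

lemma w_int: "continuous_on C f \<Longrightarrow> set_integrable lborel C (\<lambda>y. w p y *\<^sub>R f y)"
  for f :: "'a \<Rightarrow> 'b::euclidean_space"
  by (intro set_integrable_continuous_compact C continuous_intros w_cont)

lemma w_int': "continuous_on C f \<Longrightarrow> set_integrable lborel C (\<lambda>y. w p y * f y)"
  for f :: "'a \<Rightarrow> real"
  by (intro set_integrable_continuous_compact C continuous_intros w_cont)

lemma w_int0: "set_integrable lborel C (w p)"
  by (intro set_integrable_continuous_compact C continuous_intros w_cont)

lemma Z_ge:
  assumes "cball z r \<subseteq> C" "\<And>y. y \<in> cball z r \<Longrightarrow> \<alpha> \<le> y \<bullet> p - V y"
  shows "exp (\<alpha> / \<epsilon>) * measure lborel (cball z r) \<le> Z p"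
proof -
  have "exp (\<alpha> / \<epsilon>) * measure lborel (cball z r) = (LINT y:cball z r|lborel. exp (\<alpha> / \<epsilon>))"
    by (subst set_integral_const) (use emeasure_bounded_finite[OF bounded_cball] in \<open>auto simp: less_top\<close>)
  also have "\<dots> \<le> Z p"
    unfolding Z_def set_lebesgue_integral_def
  proof (rule integral_mono)
    show "integrable lborel (\<lambda>x. indicat_real (cball z r) x *\<^sub>R exp (\<alpha> / \<epsilon>))"
      by (intro borel_integrable_compact) auto
    show "integrable lborel (\<lambda>x. indicat_real C x *\<^sub>R w p x)"
      using w_int0 by (simp add: set_integrable_def)
    show "indicat_real (cball z r) x *\<^sub>R exp (\<alpha> / \<epsilon>) \<le> indicat_real C x *\<^sub>R w p x" for x
      using assms eps by (auto simp: indicator_def w_def divide_right_mono)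
  qed
  finally show ?thesis .
qed

lemma Z_pos: "0 < Z p"
proof -
  obtain z r where z: "0 < r" "cball z r \<subseteq> C"
    using C(3) by (auto simp: mem_interior_cball)
  have "C \<noteq> {}" using C(3) interior_subset by blast
  moreover have "continuous_on C (\<lambda>y. y \<bullet> p - V y)" by (intro continuous_intros V)
  ultimately obtain y0 where "\<And>y. y \<in> C \<Longrightarrow> y0 \<bullet> p - V y0 \<le> y \<bullet> p - V y"
    using continuous_attains_inf[OF C(1)] by blast
  then have "exp ((y0 \<bullet> p - V y0) / \<epsilon>) * measure lborel (cball z r) \<le> Z p"
    using z by (intro Z_ge) auto
  moreover have "0 < measure lborel (cball z r)" using z by (simp add: content_cball_pos)
  ultimately show ?thesis by (smt (verit) exp_gt_zero mult_pos_pos)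
qed

lemma Z_le:
  assumes "\<And>y. y \<in> C \<Longrightarrow> y \<bullet> p - V y \<le> \<beta>"
  shows "Z p \<le> exp (\<beta> / \<epsilon>) * measure lborel C"
proof -
  have fin: "emeasure lborel C < \<infinity>" using C emeasure_compact_finite by auto
  have [measurable]: "C \<in> sets borel" using C by (simp add: compact_imp_closed)
  have "Z p \<le> (LINT y:C|lborel. exp (\<beta> / \<epsilon>))"
    unfolding Z_def
    by (rule set_integral_mono[OF w_int0])
      (use assms eps C in \<open>auto simp: w_def divide_right_mono intro!: set_integrable_continuous_compact\<close>)
  also have "\<dots> = exp (\<beta> / \<epsilon>) * measure lborel C"
    using fin by (subst set_integral_const) auto
  finally show ?thesis .
qed

text \<open>Lower Laplace estimate. Once the ball is fixed, the volume term vanishes with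
  \<open>\<epsilon>\<close>; the ball may sit anywhere in \<open>C\<close>, which allows it to be
  placed according to the direction of \<open>p\<close>.\<close>

lemma H_ge:
  assumes "cball z r \<subseteq> C" "0 < r" "\<And>y. y \<in> cball z r \<Longrightarrow> \<alpha> \<le> y \<bullet> p - V y"
  shows "\<alpha> + \<epsilon> * ln (measure lborel (cball z r)) \<le> H p"
proof -
  have m: "0 < measure lborel (cball z r)" using assms by (simp add: content_cball_pos)
  have "\<alpha> / \<epsilon> + ln (measure lborel (cball z r)) = ln (exp (\<alpha> / \<epsilon>) * measure lborel (cball z r))"
    using m by (simp add: ln_mult_pos)
  also have "\<dots> \<le> ln (Z p)"
    using Z_ge[OF assms(1,3)] m Z_pos by (intro ln_mono) auto
  finally have "\<epsilon> * (\<alpha> / \<epsilon> + ln (measure lborel (cball z r))) \<le> \<epsilon> * ln (Z p)"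
    using eps by (intro mult_left_mono) auto
  then show ?thesis using eps by (simp add: H_def distrib_left)
qed

lemma measure_C_pos: "0 < measure lborel C"
proof -
  obtain \<beta> where "\<And>y. y \<in> C \<Longrightarrow> y \<bullet> 0 - V y \<le> \<beta>"
  proof -
    have "C \<noteq> {}" using C(3) interior_subset by blast
    then show ?thesis
      using continuous_attains_inf[OF C(1) _ V(1)] that by (metis inner_zero_right diff_0 neg_le_iff_le)
  qed
  from Z_le[OF this] Z_pos[of 0] show ?thesis
    by (smt (verit) exp_gt_zero zero_less_mult_iff mult_le_0_iff)
qed

lemma H_le:
  assumes "\<And>y. y \<in> C \<Longrightarrow> y \<bullet> p - V y \<le> \<beta>"
  shows "H p \<le> \<beta> + \<epsilon> * ln (measure lborel C)"
proof -
  have "ln (Z p) \<le> ln (exp (\<beta> / \<epsilon>) * measure lborel C)"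
    using Z_le[OF assms] Z_pos by (intro ln_mono) auto
  also have "\<dots> = \<beta> / \<epsilon> + ln (measure lborel C)"
    using measure_C_pos by (simp add: ln_mult_pos)
  finally have "\<epsilon> * ln (Z p) \<le> \<epsilon> * (\<beta> / \<epsilon> + ln (measure lborel C))"
    using eps by (intro mult_left_mono) auto
  then show ?thesis using eps by (simp add: H_def distrib_left)
qed

lemma w_add: "w (p + h) y = exp (x \<bullet> h / \<epsilon>) * (w p y * exp ((y - x) \<bullet> h / \<epsilon>))"
  by (simp add: w_def inner_add_right inner_diff_left algebra_simps flip: exp_add add_divide_distrib diff_divide_distrib)

lemma exp_cont: "continuous_on C (\<lambda>y. exp ((y - x) \<bullet> h / \<epsilon>))"
  using eps by (intro continuous_intros) auto

text \<open>Shifting \<open>p\<close> tilts the Gibbs density. Splitting off an arbitrary centre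
  \<open>x\<close> leaves a centred exponential moment, so Taylor estimates of \<open>H\<close>
  reduce to pointwise bounds on \<open>exp\<close>.\<close>

lemma Z_add: "Z (p + h) = exp (x \<bullet> h / \<epsilon>) * (LINT y:C|lborel. w p y * exp ((y - x) \<bullet> h / \<epsilon>))"
proof -
  have "w (p + h) = (\<lambda>y. exp (x \<bullet> h / \<epsilon>) * (w p y * exp ((y - x) \<bullet> h / \<epsilon>)))"
    by (rule ext) (rule w_add)
  then show ?thesis unfolding Z_def by (simp only: set_integral_mult_right)
qed

lemma w_inner:
  fixes f :: "'a \<Rightarrow> 'a"
  assumes "continuous_on C f"
  shows "(LINT y:C|lborel. w p y *\<^sub>R f y) \<bullet> h = (LINT y:C|lborel. w p y * (f y \<bullet> h))"
proof -
  have "(LINT y:C|lborel. (w p y *\<^sub>R f y) \<bullet> h) = (LINT y:C|lborel. w p y *\<^sub>R f y) \<bullet> h"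
    using integral_inner_left[OF w_int[OF assms, of p, unfolded set_integrable_def], of h]
    by (simp only: set_lebesgue_integral_def inner_scaleR_left real_scaleR_def)
  then show ?thesis by (simp only: inner_scaleR_left)
qed

text \<open>The subgradient is the Gibbs mean: with this centre the linear term of exp t \<ge> 1 + t
  integrates to zero.\<close>

lemma H_subgradient: "\<exists>m. \<forall>h. H p + m \<bullet> h \<le> H (p + h)"
proof (intro exI allI)
  fix h
  define m where "m = (1 / Z p) *\<^sub>R (LINT y:C|lborel. w p y *\<^sub>R y)"
  have mh: "(LINT y:C|lborel. w p y * ((y - m) \<bullet> h)) = 0"
  proof -
    have "(LINT y:C|lborel. w p y * ((y - m) \<bullet> h)) =
        (LINT y:C|lborel. w p y * (y \<bullet> h) - w p y * (m \<bullet> h))"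
      by (simp only: inner_diff_left right_diff_distrib)
    also have "\<dots> = (LINT y:C|lborel. w p y * (y \<bullet> h)) - (LINT y:C|lborel. w p y * (m \<bullet> h))"
      by (intro set_integral_diff w_int' continuous_intros)
    also have "(LINT y:C|lborel. w p y * (y \<bullet> h)) = (LINT y:C|lborel. w p y *\<^sub>R y) \<bullet> h"
      by (rule w_inner[symmetric]) (rule continuous_on_id)
    also have "(LINT y:C|lborel. w p y * (m \<bullet> h)) = Z p * (m \<bullet> h)"
      unfolding Z_def by (rule set_integral_mult_left)
    finally show ?thesis using Z_pos[of p] by (simp add: m_def)
  qed
  have "Z p = (LINT y:C|lborel. w p y * (1 + (y - m) \<bullet> h / \<epsilon>))"
  proof -
    have "(LINT y:C|lborel. w p y * (1 + (y - m) \<bullet> h / \<epsilon>)) =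
      (LINT y:C|lborel. w p y + (1 / \<epsilon>) * (w p y * ((y - m) \<bullet> h)))"
      by (simp add: distrib_left mult.commute)
    also have "\<dots> = Z p + (1 / \<epsilon>) * (LINT y:C|lborel. w p y * ((y - m) \<bullet> h))"
      unfolding Z_def
      by (subst set_integral_add(2)) (auto intro!: w_int0 w_int' continuous_intros)
    finally show ?thesis using mh by simp
  qed
  also have "\<dots> \<le> (LINT y:C|lborel. w p y * exp ((y - m) \<bullet> h / \<epsilon>))"
  proof (rule set_integral_mono)
    fix y show "w p y * (1 + (y - m) \<bullet> h / \<epsilon>) \<le> w p y * exp ((y - m) \<bullet> h / \<epsilon>)"
      using w_pos[of p y] by (intro mult_left_mono) auto
  qed (use eps in \<open>auto intro!: w_int' exp_cont continuous_intros\<close>)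
  finally have "exp (m \<bullet> h / \<epsilon>) * Z p \<le> Z (p + h)"
    by (subst Z_add[of p h m]) auto
  then have "ln (exp (m \<bullet> h / \<epsilon>) * Z p) \<le> ln (Z (p + h))"
    using Z_pos by (intro ln_mono) auto
  then have "m \<bullet> h / \<epsilon> + ln (Z p) \<le> ln (Z (p + h))"
    using Z_pos by (simp add: ln_mult_pos)
  then have "\<epsilon> * (m \<bullet> h / \<epsilon> + ln (Z p)) \<le> \<epsilon> * ln (Z (p + h))"
    using eps by (intro mult_left_mono) auto
  then show "H p + m \<bullet> h \<le> H (p + h)" using eps by (simp add: H_def distrib_left add.commute)
qed

text \<open>Difference quotients of a convex function increase along a ray. This later turns a gain
  at a fixed radius around \<open>p0\<close> into linear growth at infinity.\<close>

lemma H_ray: assumes "1 \<le> l" shows "H (p + l *\<^sub>R h) - H p \<ge> l * (H (p + h) - H p)"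
proof -
  obtain m where m: "\<And>k. H (p + h) + m \<bullet> k \<le> H (p + h + k)" using H_subgradient by blast
  have 1: "H (p + h) - m \<bullet> h \<le> H p" using m[of "- h"] by simp
  have "H (p + h) + m \<bullet> ((l - 1) *\<^sub>R h) \<le> H (p + l *\<^sub>R h)"
    using m[of "(l - 1) *\<^sub>R h"] by (simp add: algebra_simps)
  moreover have "(l - 1) * (H (p + h) - H p) \<le> (l - 1) * (m \<bullet> h)"
    using 1 assms by (intro mult_left_mono) auto
  ultimately show ?thesis by (simp add: algebra_simps)
qed

lemma H_continuous: "continuous_on UNIV H"
proof (rule convex_on_continuous[OF open_UNIV])
  show "convex_on UNIV H"
  proof (rule convex_onI)
    fix t :: real and x y :: 'a assume t: "0 < t" "t < 1"
    define z where "z = (1 - t) *\<^sub>R x + t *\<^sub>R y"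
    obtain m where m: "\<And>k. H z + m \<bullet> k \<le> H (z + k)" using H_subgradient by blast
    have "(1 - t) * (H z + m \<bullet> (x - z)) + t * (H z + m \<bullet> (y - z)) \<le> (1 - t) * H x + t * H y"
      using m[of "x - z"] m[of "y - z"] t by (intro add_mono mult_left_mono) auto
    moreover have "(1 - t) * (m \<bullet> (x - z)) + t * (m \<bullet> (y - z)) = m \<bullet> ((1 - t) *\<^sub>R (x - z) + t *\<^sub>R (y - z))"
      by (simp add: inner_add_right)
    moreover have "(1 - t) *\<^sub>R (x - z) + t *\<^sub>R (y - z) = 0"
      by (simp add: z_def algebra_simps)
    moreover have "(1 - t) * (H z + a) + t * (H z + b) = H z + ((1 - t) * a + t * b)" for a b
      by (simp add: algebra_simps)
    ultimately show "H z \<le> (1 - t) * H x + t * H y" by simp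
  qed simp
qed

end

section \<open>Second-order behaviour of the Legendre transform\<close>

locale gibbs_max = gibbs +
  fixes x0 p0 :: 'a
  assumes maximal: "p \<bullet> x0 - H p \<le> p0 \<bullet> x0 - H p0"
begin

lemma H_above: "x0 \<bullet> h \<le> H (p0 + h) - H p0"
  using maximal[of "p0 + h"] unfolding inner_add_left inner_commute[of x0 h] by simp

lemma Z_above: "Z p0 \<le> (LINT y:C|lborel. w p0 y * exp ((y - x0) \<bullet> h / \<epsilon>))"
proof -
  define I where "I = (LINT y:C|lborel. w p0 y * exp ((y - x0) \<bullet> h / \<epsilon>))"
  have Z: "Z (p0 + h) = exp (x0 \<bullet> h / \<epsilon>) * I" unfolding I_def by (rule Z_add)
  then have I: "0 < I" using Z_pos[of "p0 + h"] by (simp add: zero_less_mult_iff)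
  have "x0 \<bullet> h \<le> x0 \<bullet> h + \<epsilon> * ln I - \<epsilon> * ln (Z p0)"
    using H_above[of h] I eps by (simp add: H_def Z ln_mult_pos distrib_left)
  then have "ln (Z p0) \<le> ln I" using eps by simp
  then show ?thesis using I Z_pos[of p0] by (simp add: I_def)
qed

lemma C_bounded: obtains b where "0 < b" "\<And>y. y \<in> C \<Longrightarrow> norm (y - x0) \<le> b"
proof -
  have "bounded ((\<lambda>y. y - x0) ` C)"
    by (intro compact_imp_bounded compact_continuous_image continuous_intros C)
  then show ?thesis using that unfolding bounded_pos by auto
qed

text \<open>The first-order condition DH(p0) = x0, without differentiating under the integral. If
  the centred mean \<open>m\<close> were nonzero, moving \<open>p0\<close> by
  \<open>- t *\<^sub>R m\<close> would lower the integral in \<open>Z_above\<close> by an amount of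
  order \<open>t\<close>, with an error of order \<open>t\<^sup>2\<close> only.\<close>

lemma mean: "(LINT y:C|lborel. w p0 y *\<^sub>R (y - x0)) = 0"
proof -
  define m where "m = (LINT y:C|lborel. w p0 y *\<^sub>R (y - x0))"
  obtain b where b: "0 < b" "\<And>y. y \<in> C \<Longrightarrow> norm (y - x0) \<le> b" using C_bounded by blast
  have mm: "(LINT y:C|lborel. w p0 y * ((y - x0) \<bullet> m)) = m \<bullet> m"
    unfolding m_def by (rule w_inner[symmetric]) (intro continuous_intros)
  have "t * (m \<bullet> m) / \<epsilon> \<le> (t * (b * norm m / \<epsilon>))\<^sup>2 * Z p0"
    if t: "0 < t" "t * (b * norm m / \<epsilon>) \<le> 1" for t
  proof -
    define X where "X y = (y - x0) \<bullet> ((- t) *\<^sub>R m) / \<epsilon>" for y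
    have X: "\<bar>X y\<bar> \<le> t * (b * norm m / \<epsilon>)" if "y \<in> C" for y
    proof -
      have "\<bar>(y - x0) \<bullet> m\<bar> \<le> norm (y - x0) * norm m" by (rule Cauchy_Schwarz_ineq2)
      also have "\<dots> \<le> b * norm m" using b that by (intro mult_right_mono) auto
      finally show ?thesis using t eps by (simp add: X_def abs_mult divide_right_mono mult_left_mono)
    qed
    have "Z p0 \<le> (LINT y:C|lborel. w p0 y * exp (X y))" unfolding X_def by (rule Z_above)
    also have "\<dots> \<le> (LINT y:C|lborel. (1 + (t * (b * norm m / \<epsilon>))\<^sup>2) * w p0 y + (- t / \<epsilon>) * (w p0 y * ((y - x0) \<bullet> m)))"
    proof (rule set_integral_mono)
      show "set_integrable lborel C (\<lambda>y. w p0 y * exp (X y))"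
        unfolding X_def by (intro w_int' exp_cont)
      show "set_integrable lborel C (\<lambda>y. (1 + (t * (b * norm m / \<epsilon>))\<^sup>2) * w p0 y + (- t / \<epsilon>) * (w p0 y * ((y - x0) \<bullet> m)))"
        by (intro set_integral_add set_integrable_mult_right w_int0 w_int' continuous_intros)
      fix y assume y: "y \<in> C"
      have "\<bar>X y\<bar> \<le> 1" using X[OF y] t by linarith
      then have "exp (X y) \<le> 1 + X y + (X y)\<^sup>2" by (rule exp_upper_quadratic)
      also have "(X y)\<^sup>2 \<le> (t * (b * norm m / \<epsilon>))\<^sup>2"
        using X[OF y] by (metis abs_ge_zero power_mono power2_abs)
      finally have "w p0 y * exp (X y) \<le> w p0 y * (1 + X y + (t * (b * norm m / \<epsilon>))\<^sup>2)"
        using w_pos[of p0 y] by (intro mult_left_mono) auto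
      also have "\<dots> = (1 + (t * (b * norm m / \<epsilon>))\<^sup>2) * w p0 y + (- t / \<epsilon>) * (w p0 y * ((y - x0) \<bullet> m))"
        by (simp add: X_def algebra_simps diff_divide_distrib)
      finally show "w p0 y * exp (X y) \<le> (1 + (t * (b * norm m / \<epsilon>))\<^sup>2) * w p0 y + (- t / \<epsilon>) * (w p0 y * ((y - x0) \<bullet> m))" .
    qed
    also have "\<dots> = (1 + (t * (b * norm m / \<epsilon>))\<^sup>2) * Z p0 + (- t / \<epsilon>) * (m \<bullet> m)"
      unfolding mm[symmetric] Z_def
      by (subst set_integral_add(2))
         (simp_all only: set_integral_mult_right, (intro set_integrable_mult_right w_int0 w_int' continuous_intros)+)
    finally show ?thesis by (simp add: algebra_simps)
  qed
  note * = this
  have "m = 0"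
  proof (rule ccontr)
    assume "m \<noteq> 0"
    define k where "k = b * norm m / \<epsilon>"
    define l where "l = m \<bullet> m / \<epsilon>"
    have kl: "0 < k" "0 < l" "0 < Z p0" using \<open>m \<noteq> 0\<close> b eps Z_pos by (auto simp: k_def l_def)
    \<comment> \<open>The first bound keeps exponents in the range of
      \<open>exp_upper_quadratic\<close>; the second makes the quadratic error at most half of the
      linear loss.\<close>
    define t where "t = min (1 / k) (l / (2 * k\<^sup>2 * Z p0))"
    have t: "0 < t" "t * k \<le> 1" "t * (2 * k\<^sup>2 * Z p0) \<le> l"
    proof -
      show "0 < t" using kl by (simp add: t_def)
      have "t \<le> 1 / k" "t \<le> l / (2 * k\<^sup>2 * Z p0)" by (auto simp: t_def)
      then show "t * k \<le> 1" "t * (2 * k\<^sup>2 * Z p0) \<le> l"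
        using kl by (auto simp: pos_le_divide_eq)
    qed
    have "t * l \<le> (t * k)\<^sup>2 * Z p0" using *[OF t(1)] t(2) by (simp add: k_def l_def)
    also have "\<dots> = t * (t * (k\<^sup>2 * Z p0))" by (simp add: power2_eq_square)
    finally have "l \<le> t * (k\<^sup>2 * Z p0)" using t(1) by simp
    then show False using t(3) kl by simp
  qed
  then show ?thesis by (simp add: m_def)
qed

text \<open>\<open>Q\<close> is the second derivative of \<open>H\<close> at \<open>p0\<close>, that is, the variance divided by \<open>\<epsilon>\<close>.\<close>

definition "Q h = (LINT y:C|lborel. w p0 y * ((y - x0) \<bullet> h)\<^sup>2) / (\<epsilon> * Z p0)"

lemma Q_nonneg: "0 \<le> Q h"
proof -
  have "0 \<le> (LINT y:C|lborel. w p0 y * ((y - x0) \<bullet> h)\<^sup>2)"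
    unfolding set_lebesgue_integral_def
    by (rule Bochner_Integration.integral_nonneg) (use less_imp_le[OF w_pos] in \<open>auto simp: indicator_def\<close>)
  then show ?thesis using eps Z_pos[of p0] by (simp add: Q_def)
qed

text \<open>The exact second-order coefficient is \<open>Q h / 2\<close>; half of it survives the
  higher-order errors when \<open>h\<close> is so small that all exponents are at most 1/2 in
  absolute value.\<close>

lemma H_quadratic_lower:
  obtains r where "0 < r" "\<And>h. norm h \<le> r \<Longrightarrow> H p0 + x0 \<bullet> h + Q h / 4 \<le> H (p0 + h)"
proof -
  obtain b where b: "0 < b" "\<And>y. y \<in> C \<Longrightarrow> norm (y - x0) \<le> b" using C_bounded by blast
  show ?thesis
  proof
    show "0 < \<epsilon> / (2 * b)" using b eps by simp
    fix h :: 'a assume h: "norm h \<le> \<epsilon> / (2 * b)"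
    define X where "X y = (y - x0) \<bullet> h / \<epsilon>" for y
    have X: "\<bar>X y\<bar> \<le> 1/2" if "y \<in> C" for y
    proof -
      have "\<bar>(y - x0) \<bullet> h\<bar> \<le> norm (y - x0) * norm h" by (rule Cauchy_Schwarz_ineq2)
      also have "\<dots> \<le> b * (\<epsilon> / (2 * b))" using b that h by (intro mult_mono) auto
      finally show ?thesis using b eps by (simp add: X_def)
    qed
    have Xc: "continuous_on C X" unfolding X_def using eps by (intro continuous_intros) auto
    have mX: "(LINT y:C|lborel. w p0 y * X y) = 0"
    proof -
      have "(LINT y:C|lborel. w p0 y * X y) = (LINT y:C|lborel. (1 / \<epsilon>) * (w p0 y * ((y - x0) \<bullet> h)))"
        by (simp add: X_def)
      also have "\<dots> = (1 / \<epsilon>) * (LINT y:C|lborel. w p0 y * ((y - x0) \<bullet> h))"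
        by (rule set_integral_mult_right)
      also have "(LINT y:C|lborel. w p0 y * ((y - x0) \<bullet> h)) = (LINT y:C|lborel. w p0 y *\<^sub>R (y - x0)) \<bullet> h"
        by (rule w_inner[symmetric]) (intro continuous_intros)
      finally show ?thesis by (simp add: mean)
    qed
    define S where "S = (LINT y:C|lborel. w p0 y * (X y)\<^sup>2) / Z p0"
    have QS: "Q h = \<epsilon> * S"
    proof -
      have "(LINT y:C|lborel. w p0 y * (X y)\<^sup>2) = (LINT y:C|lborel. (1 / \<epsilon>\<^sup>2) * (w p0 y * ((y - x0) \<bullet> h)\<^sup>2))"
        by (simp add: X_def power_divide)
      also have "\<dots> = (1 / \<epsilon>\<^sup>2) * (LINT y:C|lborel. w p0 y * ((y - x0) \<bullet> h)\<^sup>2)"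
        by (rule set_integral_mult_right)
      finally show ?thesis using eps by (simp add: Q_def S_def power2_eq_square)
    qed
    have S: "0 \<le> S" "S \<le> 1/4"
    proof -
      show "0 \<le> S" using QS Q_nonneg[of h] eps by (simp add: zero_le_mult_iff)
      have "(LINT y:C|lborel. w p0 y * (X y)\<^sup>2) \<le> (LINT y:C|lborel. w p0 y * (1/4))"
      proof (rule set_integral_mono)
        fix y assume "y \<in> C"
        then have "(X y)\<^sup>2 \<le> (1/2)\<^sup>2" using X by (metis abs_ge_zero power_mono power2_abs)
        then show "w p0 y * (X y)\<^sup>2 \<le> w p0 y * (1/4)"
          using w_pos[of p0 y] by (intro mult_left_mono) (auto simp: power2_eq_square)
      qed (intro w_int' continuous_intros Xc)+
      also have "\<dots> = Z p0 * (1/4)" unfolding Z_def by (rule set_integral_mult_left)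
      finally show "S \<le> 1/4" using Z_pos[of p0] by (simp add: S_def field_simps)
    qed
    have "Z p0 * (1 + S / 3) = (LINT y:C|lborel. w p0 y + (w p0 y * X y + (1/3) * (w p0 y * (X y)\<^sup>2)))"
      using Z_pos[of p0] mX
      by (subst set_integral_add(2), (intro set_integral_add w_int0 w_int' set_integrable_mult_right continuous_intros Xc)+)+
         (simp add: S_def Z_def[symmetric] field_simps)
    also have "\<dots> \<le> (LINT y:C|lborel. w p0 y * exp (X y))"
    proof (rule set_integral_mono)
      fix y assume "y \<in> C"
      then have "1 + X y + (X y)\<^sup>2 / 3 \<le> exp (X y)" using X exp_lower_quadratic by blast
      then have "w p0 y * (1 + X y + (X y)\<^sup>2 / 3) \<le> w p0 y * exp (X y)"
        using w_pos[of p0 y] by (intro mult_left_mono) auto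
      then show "w p0 y + (w p0 y * X y + (1/3) * (w p0 y * (X y)\<^sup>2)) \<le> w p0 y * exp (X y)"
        by (simp add: algebra_simps)
    qed (intro set_integral_add w_int0 w_int' set_integrable_mult_right continuous_intros Xc)+
    finally have *: "Z p0 * (1 + S / 3) \<le> (LINT y:C|lborel. w p0 y * exp (X y))" .
    have Z: "Z (p0 + h) = exp (x0 \<bullet> h / \<epsilon>) * (LINT y:C|lborel. w p0 y * exp (X y))"
      unfolding X_def by (rule Z_add)
    have "exp (x0 \<bullet> h / \<epsilon>) * (Z p0 * (1 + S / 3)) \<le> Z (p0 + h)"
      unfolding Z using * by (intro mult_left_mono) auto
    then have "ln (exp (x0 \<bullet> h / \<epsilon>) * (Z p0 * (1 + S / 3))) \<le> ln (Z (p0 + h))"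
      using S Z_pos[of p0] Z_pos[of "p0 + h"] by (intro ln_mono) auto
    moreover have "ln (exp (x0 \<bullet> h / \<epsilon>) * (Z p0 * (1 + S / 3))) = x0 \<bullet> h / \<epsilon> + ln (Z p0) + ln (1 + S / 3)"
      using S Z_pos[of p0] by (simp add: ln_mult_pos)
    moreover have "S / 4 \<le> ln (1 + S / 3)"
    proof -
      \<comment> \<open>Since \<open>S \<le> 1/4\<close>, the loss \<open>(S / 3)\<^sup>2\<close> in
        the logarithm is less than the difference between \<open>S / 3\<close> and
        \<open>S / 4\<close>.\<close>
      have "S * S \<le> S * (1/4)" using S by (intro mult_left_mono) auto
      then have "S / 4 \<le> S / 3 - (S / 3)\<^sup>2" using S(1) by (simp add: power2_eq_square)
      also have "\<dots> \<le> ln (1 + S / 3)" using S by (intro ln_one_plus_pos_lower_bound) auto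
      finally show ?thesis .
    qed
    ultimately have "x0 \<bullet> h / \<epsilon> + ln (Z p0) + S / 4 \<le> ln (Z (p0 + h))" by linarith
    then have "\<epsilon> * (x0 \<bullet> h / \<epsilon> + ln (Z p0) + S / 4) \<le> \<epsilon> * ln (Z (p0 + h))"
      using eps by (intro mult_left_mono) auto
    then show "H p0 + x0 \<bullet> h + Q h / 4 \<le> H (p0 + h)"
      using eps by (simp add: H_def QS distrib_left)
  qed
qed

text \<open>A tolerance of \<open>\<epsilon>\<close> in the exponent means that the density is
  within the fixed factor \<open>exp 1\<close> of its maximum, whatever \<open>\<epsilon>\<close>
  is.\<close>

definition "near_max z \<longleftrightarrow> z \<in> C \<and> (\<forall>y\<in>C. y \<bullet> p0 - V y \<le> z \<bullet> p0 - V z + \<epsilon>)"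

text \<open>The Jacobian of a homothety of ratio 1/2 times the density loss \<open>exp 1\<close>,
  combined with the inequality (2 u - v)^2 \<le> 8 u^2 + 2 v^2.\<close>

definition "K\<^sub>0 = 2 ^ DIM('a) * 8 * exp 1 + (2::real)"

text \<open>The homothety of ratio 1/2 centred at \<open>z\<close> maps \<open>C\<close> into itself and, by convexity of \<open>V\<close>, decreases
  the density by a factor of at most \<open>exp 1\<close>; the variance cannot be small if \<open>z\<close> is far from the mean \<open>x0\<close>.\<close>

lemma near_max_variance:
  assumes "near_max z"
  shows "((z - x0) \<bullet> h)\<^sup>2 \<le> K\<^sub>0 * \<epsilon> * Q h"
proof -
  define X where "X y = (y - x0) \<bullet> h" for y
  define T where "T y = (1/2) *\<^sub>R z + (1/2) *\<^sub>R y" for y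
  have z: "z \<in> C" "\<And>y. y \<in> C \<Longrightarrow> y \<bullet> p0 - V y \<le> z \<bullet> p0 - V z + \<epsilon>"
    using assms by (auto simp: near_max_def)
  have T: "T y \<in> C" if "y \<in> C" for y using C(2) z that by (auto simp: convex_def T_def)
  have Xc: "continuous_on C X" unfolding X_def by (intro continuous_intros)
  have Tc: "continuous_on C T" unfolding T_def by (intro continuous_intros)
  have XTc: "continuous_on C (\<lambda>y. X (T y))"
    using T by (intro continuous_on_compose2[OF Xc Tc]) auto
  have wTc: "continuous_on C (\<lambda>y. w p0 (T y))"
    using T by (intro continuous_on_compose2[OF w_cont Tc]) auto
  have wT: "w p0 y \<le> exp 1 * w p0 (T y)" if y: "y \<in> C" for y
  proof -
    have "V (T y) \<le> (1/2) * V z + (1/2) * V y"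
      unfolding T_def using V(2)[unfolded convex_on_def, THEN conjunct2, rule_format, of z y "1/2" "1/2"] z(1) y by auto
    moreover have "T y \<bullet> p0 = (1/2) * (z \<bullet> p0) + (1/2) * (y \<bullet> p0)"
      by (simp add: T_def inner_add_left)
    ultimately have "y \<bullet> p0 - V y \<le> T y \<bullet> p0 - V (T y) + \<epsilon>"
      using z(2)[OF y] eps by linarith
    then have "(y \<bullet> p0 - V y) / \<epsilon> \<le> (T y \<bullet> p0 - V (T y) + \<epsilon>) / \<epsilon>"
      using eps by (intro divide_right_mono) auto
    then show ?thesis using eps by (simp add: w_def add_divide_distrib flip: exp_add)
  qed
  have sq: "(2 * u - v)\<^sup>2 \<le> 8 * u\<^sup>2 + 2 * v\<^sup>2" for u v :: real
    using zero_le_power2[of "2 * u + v"] by (simp add: power2_eq_square algebra_simps)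
  define I where "I = (LINT y:C|lborel. w p0 y * (X y)\<^sup>2)"
  have "(LINT y:C|lborel. w p0 y * (X (T y))\<^sup>2) \<le> (LINT y:C|lborel. exp 1 * (w p0 (T y) * (X (T y))\<^sup>2))"
  proof (rule set_integral_mono)
    fix y assume "y \<in> C"
    from mult_right_mono[OF wT[OF this], of "(X (T y))\<^sup>2"]
    show "w p0 y * (X (T y))\<^sup>2 \<le> exp 1 * (w p0 (T y) * (X (T y))\<^sup>2)" by simp
  qed (intro set_integrable_continuous_compact C(1) set_integrable_mult_right continuous_intros XTc wTc w_cont)+
  also have "\<dots> = exp 1 * (LINT y:C|lborel. w p0 (T y) * (X (T y))\<^sup>2)" by (rule set_integral_mult_right)
  also have "\<dots> \<le> exp 1 * (2 ^ DIM('a) * I)"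
    unfolding I_def T_def
    by (intro mult_left_mono homothety_integral_le[where F="\<lambda>y. w p0 y * (X y)\<^sup>2"] C(1,2) z(1) continuous_intros w_cont Xc)
       (use less_imp_le[OF w_pos] in auto)
  finally have IT: "(LINT y:C|lborel. w p0 y * (X (T y))\<^sup>2) \<le> exp 1 * (2 ^ DIM('a) * I)" .
  have "(X z)\<^sup>2 * Z p0 = (LINT y:C|lborel. w p0 y * (X z)\<^sup>2)"
    unfolding Z_def by (simp add: mult.commute)
  also have "\<dots> \<le> (LINT y:C|lborel. 8 * (w p0 y * (X (T y))\<^sup>2) + 2 * (w p0 y * (X y)\<^sup>2))"
  proof (rule set_integral_mono)
    fix y :: 'a
    have "X (T y) = (X z + X y) / 2"
      by (simp add: X_def T_def inner_add_left inner_diff_left field_simps)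
    then have "X z = 2 * X (T y) - X y" by simp
    then have "(X z)\<^sup>2 \<le> 8 * (X (T y))\<^sup>2 + 2 * (X y)\<^sup>2"
      using sq[of "X (T y)" "X y"] by simp
    from mult_left_mono[OF this less_imp_le[OF w_pos[of p0 y]]]
    show "w p0 y * (X z)\<^sup>2 \<le> 8 * (w p0 y * (X (T y))\<^sup>2) + 2 * (w p0 y * (X y)\<^sup>2)"
      by (simp add: algebra_simps)
  qed (intro set_integral_add set_integrable_mult_right w_int' continuous_intros Xc XTc)+
  also have "\<dots> = 8 * (LINT y:C|lborel. w p0 y * (X (T y))\<^sup>2) + 2 * I"
    unfolding I_def
    by (subst set_integral_add(2), (intro set_integrable_mult_right w_int' continuous_intros Xc XTc)+)
       (simp only: set_integral_mult_right)
  also have "\<dots> \<le> 8 * (exp 1 * (2 ^ DIM('a) * I)) + 2 * I" using IT by simp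
  also have "\<dots> = K\<^sub>0 * I" by (simp add: K\<^sub>0_def algebra_simps)
  finally have "(X z)\<^sup>2 * Z p0 \<le> K\<^sub>0 * I" .
  then have "(X z)\<^sup>2 \<le> K\<^sub>0 * I / Z p0" using Z_pos[of p0] by (simp add: pos_le_divide_eq)
  then show ?thesis using eps unfolding Q_def X_def I_def by simp
qed

text \<open>Passing to differences eliminates the mean \<open>x0\<close>: the spread of the
  near-maximisers alone bounds the variance from below.\<close>

lemma near_max_pair:
  assumes "near_max z" "near_max z'"
  shows "((z' - z) \<bullet> h)\<^sup>2 \<le> 4 * K\<^sub>0 * \<epsilon> * Q h"
proof -
  define a b where "a = (z - x0) \<bullet> h" and "b = (z' - x0) \<bullet> h"
  have "(z' - z) \<bullet> h = b - a" by (simp add: a_def b_def inner_diff_left)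
  moreover have "(b - a)\<^sup>2 \<le> 2 * a\<^sup>2 + 2 * b\<^sup>2"
    using zero_le_power2[of "a + b"] by (simp add: power2_eq_square algebra_simps)
  ultimately show ?thesis
    using near_max_variance[OF assms(1), of h] near_max_variance[OF assms(2), of h]
    by (simp add: a_def b_def)
qed

lemma W_max: "W x0 = p0 \<bullet> x0 - H p0"
  unfolding W_def using maximal by (intro cSup_eq_maximum) auto

text \<open>The covariance operator of the Gibbs measure divided by \<open>\<epsilon>\<close>, that
  is, the Hessian of \<open>H\<close> at \<open>p0\<close> as a linear map; \<open>Q\<close> is its
  quadratic form.\<close>

definition "L h = (1 / (\<epsilon> * Z p0)) *\<^sub>R (LINT y:C|lborel. w p0 y *\<^sub>R (((y - x0) \<bullet> h) *\<^sub>R (y - x0)))"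

lemma L_inner: "L h \<bullet> k = (LINT y:C|lborel. w p0 y * (((y - x0) \<bullet> h) * ((y - x0) \<bullet> k))) / (\<epsilon> * Z p0)"
proof -
  have "(LINT y:C|lborel. w p0 y *\<^sub>R (((y - x0) \<bullet> h) *\<^sub>R (y - x0))) \<bullet> k =
      (LINT y:C|lborel. w p0 y * ((((y - x0) \<bullet> h) *\<^sub>R (y - x0)) \<bullet> k))"
    by (intro w_inner continuous_intros)
  then show ?thesis by (simp add: L_def)
qed

lemma L_sym: "L h \<bullet> k = L k \<bullet> h"
  unfolding L_inner by (simp add: mult.commute)

lemma L_Q: "L h \<bullet> h = Q h"
  unfolding L_inner Q_def by (simp add: power2_eq_square)

text \<open>Symmetry moves the argument into the other slot of the inner product, where linearity is
  immediate.\<close>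

lemma L_linear: "linear L"
proof (rule linearI)
  show "L (h + k) = L h + L k" for h k
    by (rule vector_eq_rdot[THEN iffD1])
      (simp add: L_sym[of "h + k"] L_sym[of h] L_sym[of k] inner_add_left inner_add_right)
  show "L (c *\<^sub>R h) = c *\<^sub>R L h" for c h
    by (rule vector_eq_rdot[THEN iffD1]) (simp add: L_sym[of "c *\<^sub>R h"] L_sym[of h])
qed

lemma Q_diff: "Q (h - k) = Q h - 2 * (L k \<bullet> h) + Q k"
  using L_linear L_sym[of h k]
  by (simp add: L_Q[symmetric] linear_diff inner_diff_left inner_diff_right)

text \<open>Conjugation reverses inequalities: the quadratic lower bound of \<open>H\<close> at
  \<open>p0\<close> becomes a quadratic upper bound of \<open>W\<close> at \<open>x0\<close>, with
  the inverse form. A ball of near-maximisers makes \<open>L\<close> invertible. The last clause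
  transfers a lower bound of the variance in direction \<open>q\<close> alone to the inverse,
  independently of all other directions.\<close>

lemma upper_jet:
  assumes r: "0 < r" "\<And>y. y \<in> cball z r \<Longrightarrow> near_max y"
  obtains A where "linear A"
    "\<forall>\<^sub>F x in nhds x0. W x \<le> W x0 + p0 \<bullet> (x - x0) + (1/2) * (A (x - x0) \<bullet> (x - x0))"
    "\<And>q c. (\<And>h. (q \<bullet> h)\<^sup>2 \<le> c * Q h) \<Longrightarrow> A q \<bullet> q \<le> 2 * c"
proof -
  have K: "0 < K\<^sub>0" by (simp add: K\<^sub>0_def add_pos_pos)
  \<comment> \<open>Coercivity constant of \<open>Q\<close>, from \<open>near_max_pair\<close>
    applied to opposite points of the ball, at distance \<open>2 * r\<close>.\<close>
  define \<kappa> where "\<kappa> = r\<^sup>2 / (K\<^sub>0 * \<epsilon>)"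
  have \<kappa>: "0 < \<kappa>" using K eps r by (simp add: \<kappa>_def)
  have Qlow: "\<kappa> * (norm h)\<^sup>2 \<le> Q h" for h
  proof (cases "h = 0")
    case False
    define e where "e = r *\<^sub>R (h /\<^sub>R norm h)"
    have "norm e = r" using False r by (simp add: e_def)
    then have "near_max (z - e)" "near_max (z + e)"
      using r by (auto intro!: r(2) simp: dist_norm)
    from near_max_pair[OF this, of h]
    have "(2 * (e \<bullet> h))\<^sup>2 \<le> 4 * K\<^sub>0 * \<epsilon> * Q h" by (simp add: algebra_simps inner_add_left)
    moreover have "e \<bullet> h = r * norm h"
      using False by (simp add: e_def dot_square_norm power2_eq_square)
    ultimately have "4 * (r\<^sup>2 * (norm h)\<^sup>2) \<le> 4 * (K\<^sub>0 * \<epsilon> * Q h)" by (simp add: power_mult_distrib mult.assoc)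
    then show ?thesis using K eps by (simp add: \<kappa>_def field_simps)
  qed (simp add: Q_nonneg)
  have inj: "inj L"
  proof (subst linear_injective_0[OF L_linear], intro allI impI)
    fix h assume "L h = 0"
    then have "\<kappa> * (norm h)\<^sup>2 \<le> 0" using Qlow[of h] L_Q[of h] by simp
    then show "h = 0" using \<kappa> by (simp add: mult_le_0_iff)
  qed
  then obtain M where M: "linear M" "\<And>x. L (M x) = x"
    using linear_injective_isomorphism[OF L_linear] by metis
  \<comment> \<open>With \<open>M\<close> the inverse of \<open>L\<close>, this bounds the conjugate
    of \<open>Q / 4\<close>; the square is completed at \<open>a = 2 *\<^sub>R M u\<close>.\<close>
  have sup: "u \<bullet> h - Q h / 4 \<le> M u \<bullet> u" for u h
  proof -
    define a where "a = 2 *\<^sub>R M u"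
    have La: "L a = 2 *\<^sub>R u" using M L_linear by (simp add: a_def linear_cmul)
    have "0 \<le> Q (h - a)" by (rule Q_nonneg)
    also have "\<dots> = Q h - 2 * (L a \<bullet> h) + L a \<bullet> a" by (simp add: Q_diff L_Q)
    finally have "0 \<le> Q h - 2 * ((2 *\<^sub>R u) \<bullet> h) + (2 *\<^sub>R u) \<bullet> a" unfolding La .
    then show ?thesis by (simp add: a_def inner_commute)
  qed
  obtain s where s: "0 < s" "\<And>h. norm h \<le> s \<Longrightarrow> H p0 + x0 \<bullet> h + Q h / 4 \<le> H (p0 + h)"
    using H_quadratic_lower by blast
  have far: "H p0 + x0 \<bullet> h + norm h * (\<kappa> * s / 4) \<le> H (p0 + h)" if h: "s \<le> norm h" for h
  proof -
    define l where "l = norm h / s"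
    have l: "1 \<le> l" using h s by (simp add: l_def)
    define k where "k = h /\<^sub>R l"
    have k: "h = l *\<^sub>R k" "norm k = s" using l h s by (auto simp: k_def l_def)
    have "\<kappa> * s\<^sup>2 / 4 \<le> Q k / 4" using Qlow[of k] k by simp
    then have "x0 \<bullet> k + \<kappa> * s\<^sup>2 / 4 \<le> H (p0 + k) - H p0" using s(2)[of k] k by simp
    then have "l * (x0 \<bullet> k + \<kappa> * s\<^sup>2 / 4) \<le> l * (H (p0 + k) - H p0)"
      using l by (intro mult_left_mono) auto
    also have "\<dots> \<le> H (p0 + l *\<^sub>R k) - H p0" by (rule H_ray[OF l])
    also have "l * (x0 \<bullet> k + \<kappa> * s\<^sup>2 / 4) = x0 \<bullet> h + (l * s) * (\<kappa> * s / 4)"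
      using k by (simp add: distrib_left power2_eq_square)
    also have "l * s = norm h" using s by (simp add: l_def)
    finally show ?thesis using k by simp
  qed
  show ?thesis
  proof
    show "linear (\<lambda>x. 2 *\<^sub>R M x)" using M(1) linear_compose_scale_right by blast
    have "\<forall>\<^sub>F x in nhds x0. dist x x0 < \<kappa> * s / 4"
      unfolding eventually_nhds_metric using \<kappa> s by (intro exI[of _ "\<kappa> * s / 4"] conjI) auto
    then show "\<forall>\<^sub>F x in nhds x0. W x \<le> W x0 + p0 \<bullet> (x - x0) + (1/2) * ((2 *\<^sub>R M (x - x0)) \<bullet> (x - x0))"
    proof eventually_elim
      fix x assume x: "dist x x0 < \<kappa> * s / 4"
      define u where "u = x - x0"
      show "W x \<le> W x0 + p0 \<bullet> (x - x0) + (1/2) * ((2 *\<^sub>R M (x - x0)) \<bullet> (x - x0))"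
        unfolding W_def[of x]
      proof (rule cSUP_least)
        fix p
        define h where "h = p - p0"
        have "u \<bullet> h + x0 \<bullet> h - (H (p0 + h) - H p0) \<le> M u \<bullet> u"
        proof (cases "norm h \<le> s")
          case True
          then show ?thesis using s(2)[of h] sup[of u h] by linarith
        next
          case False
          have "u \<bullet> h \<le> norm u * norm h" by (rule norm_cauchy_schwarz)
          also have "\<dots> \<le> (\<kappa> * s / 4) * norm h"
            using x by (intro mult_right_mono) (auto simp: u_def dist_norm)
          finally have "u \<bullet> h + x0 \<bullet> h - (H (p0 + h) - H p0) \<le> 0"
            using far[of h] False by (simp add: mult.commute)
          also have "0 \<le> M u \<bullet> u" using sup[of u 0] by (simp add: Q_def)
          finally show ?thesis .
        qed
        moreover have "p = p0 + h" "x = x0 + u" by (simp_all add: h_def u_def)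
        ultimately show "p \<bullet> x - H p \<le> W x0 + p0 \<bullet> (x - x0) + (1/2) * ((2 *\<^sub>R M (x - x0)) \<bullet> (x - x0))"
          by (simp add: W_max inner_add_left inner_add_right inner_commute)
      qed simp
    qed
    fix q c assume q: "\<And>h. (q \<bullet> h)\<^sup>2 \<le> c * Q h"
    \<comment> \<open>The hypothesis on \<open>q\<close> is tested with \<open>h = M q\<close>,
      where \<open>Q h\<close> and \<open>q \<bullet> h\<close> coincide.\<close>
    have "Q (M q) = M q \<bullet> q" using L_Q[of "M q"] by (simp add: M inner_commute)
    then have *: "(M q \<bullet> q)\<^sup>2 \<le> c * (M q \<bullet> q)" "0 \<le> M q \<bullet> q"
      using q[of "M q"] Q_nonneg[of "M q"] by (auto simp: inner_commute)
    have "M q \<bullet> q \<le> c \<or> M q \<bullet> q = 0"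
      using * by (auto simp: power2_eq_square mult_le_cancel_right)
    \<comment> \<open>Where the common value vanishes it cannot be cancelled. Coercivity then leaves
      only \<open>q = 0\<close>, and any basis direction shows that \<open>c\<close> is
      nonnegative.\<close>
    moreover have "0 \<le> c" if "M q \<bullet> q = 0"
    proof (cases "q = 0")
      case True
      obtain i :: 'a where "i \<in> Basis" using nonempty_Basis by blast
      then have "i \<noteq> 0" by auto
      then have "0 < \<kappa> * (norm i)\<^sup>2" using \<kappa> by simp
      then have "0 < Q i" using Qlow[of i] by linarith
      then show ?thesis using q[of i] True by (simp add: zero_le_mult_iff)
    next
      case False
      then have "M q \<noteq> 0" using M by (metis L_linear linear_0)
      then have "0 < \<kappa> * (norm (M q))\<^sup>2" using \<kappa> by simp
      then show ?thesis using Qlow[of "M q"] \<open>Q (M q) = M q \<bullet> q\<close> that by linarith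
    qed
    ultimately show "(2 *\<^sub>R M q) \<bullet> q \<le> 2 * c" by auto
  qed
qed

end

section \<open>Smoothed Finsler cones\<close>

context finsler
begin

lemma phi_square_convex: "convex_on UNIV (\<lambda>x. (\<phi> x)\<^sup>2)"
proof (rule convex_onI)
  fix t :: real and x y assume t: "0 < t" "t < 1"
  have "\<phi> ((1 - t) *\<^sub>R x + t *\<^sub>R y) \<le> (1 - t) * \<phi> x + t * \<phi> y"
    using phi_triangle[of "(1 - t) *\<^sub>R x" "t *\<^sub>R y"] t by (simp add: phi_scale)
  then have "(\<phi> ((1 - t) *\<^sub>R x + t *\<^sub>R y))\<^sup>2 \<le> ((1 - t) * \<phi> x + t * \<phi> y)\<^sup>2"
    by (intro power_mono) auto
  also have "\<dots> = (1 - t) * (\<phi> x)\<^sup>2 + t * (\<phi> y)\<^sup>2 - (1 - t) * t * (\<phi> x - \<phi> y)\<^sup>2"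
    by (simp add: power2_eq_square algebra_simps)
  also have "\<dots> \<le> (1 - t) * (\<phi> x)\<^sup>2 + t * (\<phi> y)\<^sup>2" using t by simp
  finally show "(\<phi> ((1 - t) *\<^sub>R x + t *\<^sub>R y))\<^sup>2 \<le> (1 - t) * (\<phi> x)\<^sup>2 + t * (\<phi> y)\<^sup>2" .
qed simp

text \<open>With \<open>V = K \<phi> + \<phi>\<^sup>2 / (2 \<sigma>)\<close>, the maximisers of \<open>y \<bullet> p - V y\<close> are \<open>s \<cdot> \<partial>\<phi>\<^sup>*(p)\<close> with
  \<open>s = \<sigma> (\<phi>\<^sup>*(p) - K)\<^sup>+\<close>, and \<open>(s + \<tau>) q\<close> is still maximal up to \<open>\<epsilon>\<close> for \<open>\<tau>\<^sup>2 = 2 \<sigma> \<epsilon>\<close>. So the variance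
  in the direction \<open>q \<in> \<partial>\<phi>\<^sup>*(p)\<close> is at least of order \<open>\<tau>\<^sup>2\<close>, and \<open>D\<^sup>2W\<close> is of order \<open>1 / \<sigma>\<close> there.\<close>

lemma smooth_cone:
  assumes K: "0 < K" and S0: "0 \<le> S0" and r0: "0 < r0" and \<theta>: "0 < \<theta>" and c: "0 < c"
  obtains W where
    "\<And>x. \<phi> x \<le> S0 \<Longrightarrow> \<bar>W x - K * \<phi> x\<bar> \<le> \<theta>"
    "continuous_on {x. \<phi> x \<le> S0} W"
    "\<And>x0. \<phi> x0 \<le> S0 \<Longrightarrow> \<exists>p A. linear A \<and>
      (\<forall>\<^sub>F x in nhds x0. W x \<le> W x0 + p \<bullet> (x - x0) + (1/2) * (A (x - x0) \<bullet> (x - x0))) \<and>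
      dual_norm \<phi> p \<le> K + \<theta> \<and>
      (r0 \<le> \<phi> x0 \<longrightarrow> K \<le> dual_norm \<phi> p \<and> (\<forall>q\<in>subdifferential (dual_norm \<phi>) p. A q \<bullet> q \<le> c))"
proof -
  define k0 :: real where "k0 = 2 ^ DIM(real^'n) * 8 * exp 1 + 2"
  have k0: "0 < k0" by (simp add: k0_def add_pos_pos)
  \<comment> \<open>The three summands make small, in turn, the Hessian in the relevant directions,
    the deviation of \<open>V\<close> from \<open>K * \<phi>\<close>, and the excess of the slope
    over \<open>K\<close>.\<close>
  define \<sigma> where "\<sigma> = 4 * k0 / c + S0\<^sup>2 / \<theta> + (2 * S0 + 1) / \<theta>"
  have \<sigma>: "0 < \<sigma>" "4 * k0 / \<sigma> \<le> c" "S0\<^sup>2 / (2 * \<sigma>) \<le> \<theta> / 2" "(2 * S0 + 1) / (2 * \<sigma>) \<le> \<theta> / 2"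
  proof -
    have *: "0 < 4 * k0 / c" "0 \<le> S0\<^sup>2 / \<theta>" "0 < (2 * S0 + 1) / \<theta>"
      using k0 c \<theta> S0 by auto
    show s: "0 < \<sigma>" using * by (simp add: \<sigma>_def)
    have "4 * k0 / c \<le> \<sigma>" "S0\<^sup>2 / \<theta> \<le> \<sigma>" "(2 * S0 + 1) / \<theta> \<le> \<sigma>" using * by (auto simp: \<sigma>_def)
    then show "4 * k0 / \<sigma> \<le> c" "S0\<^sup>2 / (2 * \<sigma>) \<le> \<theta> / 2" "(2 * S0 + 1) / (2 * \<sigma>) \<le> \<theta> / 2"
      using s c \<theta> by (auto simp: field_simps)
  qed
  \<comment> \<open>Tolerance for the difference of \<open>W\<close> and \<open>V\<close>. The entry
    with \<open>\<theta>\<close> serves the slope bound, the one with \<open>r0\<close> keeps the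
    slope at least \<open>K\<close> away from the tip, and the last one bounds the radius
    \<open>s\<close> of the maximisers.\<close>
  define \<theta>2 where "\<theta>2 = min (\<theta> / 4) (min (r0\<^sup>2 / (4 * \<sigma>)) (1 / (4 * \<sigma>)))"
  have \<theta>2: "0 < \<theta>2" "\<theta>2 \<le> \<theta> / 4" "4 * \<sigma> * \<theta>2 \<le> r0\<^sup>2" "4 * \<sigma> * \<theta>2 \<le> 1"
  proof -
    show "0 < \<theta>2" "\<theta>2 \<le> \<theta> / 4" using \<theta> r0 \<sigma> by (auto simp: \<theta>2_def)
    have "\<theta>2 \<le> r0\<^sup>2 / (4 * \<sigma>)" "\<theta>2 \<le> 1 / (4 * \<sigma>)" by (auto simp: \<theta>2_def)
    then show "4 * \<sigma> * \<theta>2 \<le> r0\<^sup>2" "4 * \<sigma> * \<theta>2 \<le> 1"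
      using \<sigma> by (auto simp: field_simps)
  qed
  define V where "V y = K * \<phi> y + (\<phi> y)\<^sup>2 / (2 * \<sigma>)" for y
  \<comment> \<open>The margin 3 leaves room for points displaced by at most two units, together
    with the small balls around them used in the Laplace estimate.\<close>
  define C where "C = {y. \<phi> y \<le> S0 + 3}"
  have Vc: "continuous_on A V" for A
    unfolding V_def using \<sigma> by (intro continuous_intros phi_continuous_on) auto
  have Vmono: "V x \<le> K * s + s\<^sup>2 / (2 * \<sigma>)" if "\<phi> x \<le> s" for x s
    unfolding V_def using that K \<sigma> by (intro add_mono mult_left_mono divide_right_mono power_mono) auto
  have V_conv: "convex_on C V"
  proof -
    have "convex_on UNIV (\<lambda>y. K * \<phi> y + (1 / (2 * \<sigma>)) * (\<phi> y)\<^sup>2)"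
      using K \<sigma> by (intro convex_on_add convex_on_cmul phi_convex phi_square_convex) auto
    then have "convex_on UNIV V" by (simp add: V_def[abs_def])
    then show ?thesis by (rule convex_on_subset) (auto simp: C_def phi_ball_convex)
  qed
  have C_cpt: "compact C" "convex C" unfolding C_def by (rule phi_ball_compact phi_ball_convex)+
  obtain d where d: "0 < d" "\<And>x. \<phi> x \<le> d * norm x" using phi_bounds by metis
  have "uniformly_continuous_on C V"
    by (intro compact_uniformly_continuous Vc C_cpt)
  then obtain \<delta>1 where \<delta>1: "0 < \<delta>1" "\<And>y y'. y \<in> C \<Longrightarrow> y' \<in> C \<Longrightarrow> dist y' y < \<delta>1 \<Longrightarrow> dist (V y') (V y) < \<theta>2 / 2"
    unfolding uniformly_continuous_on_def using \<theta>2(1) by (metis half_gt_zero)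
  define \<delta> where "\<delta> = min (\<delta>1 / 2) (1 / d)"
  have \<delta>: "0 < \<delta>" "\<delta> < \<delta>1" "d * \<delta> \<le> 1"
    using \<delta>1 d by (auto simp: \<delta>_def min_def field_simps)
  have phi_near: "\<phi> y \<le> \<phi> x + 1" if "dist x y \<le> \<delta>" for x y
  proof -
    have "\<phi> y \<le> \<phi> x + \<phi> (y - x)" using phi_triangle[of x "y - x"] by simp
    also have "\<phi> (y - x) \<le> d * norm (y - x)" by (rule d)
    also have "\<dots> \<le> d * \<delta>" using that d by (intro mult_left_mono) (auto simp: dist_norm norm_minus_commute)
    finally show ?thesis using \<delta> by simp
  qed
  define b where "b = measure lborel (cball (0::real^'n) (\<delta> / 2))"
  have b: "measure lborel (cball z (\<delta> / 2)) = b" for z :: "real^'n"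
    using \<delta> by (simp add: b_def content_cball)
  \<comment> \<open>Chosen last, after the radius \<open>\<delta>\<close> has fixed the volume
    \<open>b\<close>, so that both logarithmic volume terms become negligible. The first entry
    ensures that \<tau> \<le> 1 below.\<close>
  define \<epsilon> where "\<epsilon> = min (1 / (2 * \<sigma>)) (\<theta>2 / 2 / (1 + \<bar>ln b\<bar> + \<bar>ln (measure lborel C)\<bar>))"
  have \<epsilon>: "0 < \<epsilon>" "2 * \<sigma> * \<epsilon> \<le> 1" "- (\<epsilon> * ln b) \<le> \<theta>2 / 2" "\<epsilon> * ln (measure lborel C) \<le> \<theta>2"
  proof -
    define D where "D = 1 + \<bar>ln b\<bar> + \<bar>ln (measure lborel C)\<bar>"
    have D: "0 < D" by (auto simp: D_def)
    show e: "0 < \<epsilon>" using \<sigma> \<theta>2 D by (simp add: \<epsilon>_def D_def)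
    have "\<epsilon> \<le> 1 / (2 * \<sigma>)" "\<epsilon> \<le> \<theta>2 / 2 / D" by (auto simp: \<epsilon>_def D_def)
    then have 1: "2 * \<sigma> * \<epsilon> \<le> 1" "\<epsilon> * D \<le> \<theta>2 / 2" using \<sigma> D by (auto simp: field_simps)
    show "2 * \<sigma> * \<epsilon> \<le> 1" by (rule 1)
    have D2: "- ln b \<le> D" "ln (measure lborel C) \<le> D" by (auto simp: D_def)
    have "\<epsilon> * (- ln b) \<le> \<epsilon> * D" "\<epsilon> * ln (measure lborel C) \<le> \<epsilon> * D"
      using mult_left_mono[OF D2(1), of \<epsilon>] mult_left_mono[OF D2(2), of \<epsilon>] e by auto
    then show "- (\<epsilon> * ln b) \<le> \<theta>2 / 2" "\<epsilon> * ln (measure lborel C) \<le> \<theta>2"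
      using 1 \<theta>2 by auto
  qed
  interpret g: gibbs C V \<epsilon>
  proof
    have "ball 0 \<delta> \<subseteq> C"
    proof
      fix y :: "real^'n" assume "y \<in> ball 0 \<delta>"
      then show "y \<in> C" using phi_near[of 0 y] S0 by (simp add: C_def)
    qed
    then have "0 \<in> interior C"
      using \<delta>(1) by (intro interiorI[of "ball 0 \<delta>"]) auto
    then show "interior C \<noteq> {}" by blast
  qed (use C_cpt Vc V_conv \<epsilon> in auto)
  have up: "p \<bullet> x - g.H p \<le> V x + \<theta>2" if x: "\<phi> x \<le> S0 + 2" for x p
  proof -
    \<comment> \<open>Moving the centre in the direction of \<open>p\<close> places the whole ball
      in the half-space \<open>x \<bullet> p \<le> y \<bullet> p\<close>. The linear term then loses
      nothing, so the estimate is uniform in the unbounded variable \<open>p\<close>.\<close>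
    define y0 where "y0 = x + (\<delta> / 2) *\<^sub>R sgn p"
    have sub: "cball y0 (\<delta> / 2) \<subseteq> cball x \<delta>"
    proof
      fix y assume y: "y \<in> cball y0 (\<delta> / 2)"
      have "dist x y \<le> dist x y0 + dist y0 y" by (rule dist_triangle)
      also have "dist x y0 \<le> \<delta> / 2" using \<delta> by (simp add: y0_def dist_norm norm_sgn)
      finally show "y \<in> cball x \<delta>" using y by simp
    qed
    have sub': "cball x \<delta> \<subseteq> C"
    proof
      fix y assume "y \<in> cball x \<delta>"
      then show "y \<in> C" using phi_near[of x y] x by (simp add: C_def)
    qed
    have xC: "x \<in> C" using x by (simp add: C_def)
    have "x \<bullet> p - V x - \<theta>2 / 2 + \<epsilon> * ln (measure lborel (cball y0 (\<delta> / 2))) \<le> g.H p"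
    proof (rule g.H_ge)
      show "cball y0 (\<delta> / 2) \<subseteq> C" using sub sub' by blast
      show "0 < \<delta> / 2" using \<delta> by simp
      fix y assume y: "y \<in> cball y0 (\<delta> / 2)"
      then have yx: "y \<in> cball x \<delta>" using sub by blast
      have "dist (V y) (V x) < \<theta>2 / 2"
        using yx sub' xC \<delta> by (intro \<delta>1) (auto simp: dist_commute)
      moreover have "x \<bullet> p \<le> y \<bullet> p"
      proof -
        have "- ((y - y0) \<bullet> p) \<le> norm (y - y0) * norm p"
          using Cauchy_Schwarz_ineq2[of "y - y0" p] by linarith
        also have "\<dots> \<le> (\<delta> / 2) * norm p"
          using y by (intro mult_right_mono) (auto simp: dist_norm norm_minus_commute)
        also have "\<dots> = (y0 - x) \<bullet> p"
          by (cases "p = 0") (auto simp: y0_def sgn_div_norm dot_square_norm power2_eq_square)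
        finally show ?thesis by (simp add: inner_diff_left)
      qed
      ultimately show "x \<bullet> p - V x - \<theta>2 / 2 \<le> y \<bullet> p - V y" unfolding dist_real_def by linarith
    qed
    then show ?thesis using \<epsilon>(3) unfolding b by (simp add: inner_commute)
  qed
  have bdd: "bdd_above (range (\<lambda>p. p \<bullet> x - g.H p))" if "\<phi> x \<le> S0 + 2" for x
    using up[OF that] by (auto intro!: bdd_aboveI)
  have W_up: "g.W x \<le> V x + \<theta>2" if "\<phi> x \<le> S0 + 2" for x
    unfolding g.W_def using up[OF that] by (intro cSUP_least) auto
  have W_ge: "p \<bullet> x - g.H p \<le> g.W x" if "\<phi> x \<le> S0 + 2" for x p
    unfolding g.W_def using bdd[OF that] by (rule cSUP_upper[rotated]) simp
  have W_low: "V x - \<theta>2 \<le> g.W x" if x: "\<phi> x \<le> S0 + 2" for x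
  proof -
    obtain p1 where p1: "dual_norm \<phi> p1 \<le> 1" "p1 \<bullet> x = \<phi> x" using phi_supporting by blast
    \<comment> \<open>The covector \<open>l *\<^sub>R p1\<close> is a subgradient of
      \<open>V\<close> at \<open>x\<close>: \<open>l\<close> is the derivative of K r + r^2 / (2
      \<sigma>) at r = \<open>\<phi> x\<close>.\<close>
    define l where "l = K + \<phi> x / \<sigma>"
    have l: "0 < l" using K \<sigma> by (simp add: l_def add_pos_nonneg)
    have "g.H (l *\<^sub>R p1) \<le> (\<phi> x)\<^sup>2 / (2 * \<sigma>) + \<epsilon> * ln (measure lborel C)"
    proof (rule g.H_le)
      fix y
      have "p1 \<bullet> y \<le> 1 * \<phi> y"
        using inner_le_dual[of p1 y] mult_right_mono[OF p1(1), of "\<phi> y"] by simp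
      then have "l * (p1 \<bullet> y) \<le> l * \<phi> y" using l by simp
      have "0 \<le> (\<phi> x - \<phi> y)\<^sup>2 / (2 * \<sigma>)" using \<sigma> by simp
      moreover have "(\<phi> x)\<^sup>2 / (2 * \<sigma>) - ((\<phi> x / \<sigma>) * \<phi> y - (\<phi> y)\<^sup>2 / (2 * \<sigma>)) = (\<phi> x - \<phi> y)\<^sup>2 / (2 * \<sigma>)"
        using \<sigma>(1) by (simp add: power2_eq_square field_simps)
      ultimately have "(\<phi> x / \<sigma>) * \<phi> y - (\<phi> y)\<^sup>2 / (2 * \<sigma>) \<le> (\<phi> x)\<^sup>2 / (2 * \<sigma>)"
        by linarith
      with \<open>l * (p1 \<bullet> y) \<le> l * \<phi> y\<close> show "y \<bullet> (l *\<^sub>R p1) - V y \<le> (\<phi> x)\<^sup>2 / (2 * \<sigma>)"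
        by (simp add: V_def l_def inner_commute distrib_right)
    qed
    moreover have "(l *\<^sub>R p1) \<bullet> x = V x + (\<phi> x)\<^sup>2 / (2 * \<sigma>)"
      using \<sigma> by (simp add: p1 l_def V_def power2_eq_square field_simps)
    ultimately show ?thesis using W_ge[OF x, of "l *\<^sub>R p1"] \<epsilon>(4) by linarith
  qed
  have max_ex: "\<exists>p0. \<forall>p. p \<bullet> x0 - g.H p \<le> p0 \<bullet> x0 - g.H p0" if x0: "\<phi> x0 \<le> S0 + 1" for x0
  proof -
    define f where "f p = p \<bullet> x0 - g.H p" for p
    define B where "B = K * (S0 + 2) + (S0 + 2)\<^sup>2 / (2 * \<sigma>) + \<theta>2"
    \<comment> \<open>Coercivity comes from evaluating the bound \<open>up\<close> not at
      \<open>x0\<close> but at a point displaced by \<open>\<delta>\<close> in the direction of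
      \<open>p\<close>.\<close>
    have far: "f p \<le> B - \<delta> * norm p" for p
    proof -
      have "dist x0 (x0 + \<delta> *\<^sub>R sgn p) \<le> \<delta>" using \<delta> by (simp add: dist_norm norm_sgn)
      then have *: "\<phi> (x0 + \<delta> *\<^sub>R sgn p) \<le> S0 + 2" using phi_near[of x0] x0 by fastforce
      have "p \<bullet> (x0 + \<delta> *\<^sub>R sgn p) - g.H p \<le> B"
        using up[OF *, of p] Vmono[OF *] by (simp add: B_def)
      moreover have "p \<bullet> sgn p = norm p"
        by (cases "p = 0") (auto simp: sgn_div_norm dot_square_norm power2_eq_square)
      ultimately show ?thesis by (simp add: f_def inner_add_right)
    qed
    define R where "R = \<bar>(B - f 0) / \<delta>\<bar>"
    have "continuous_on (cball 0 R) f"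
      unfolding f_def by (intro continuous_intros continuous_on_subset[OF g.H_continuous]) auto
    moreover have R0: "0 \<le> R" unfolding R_def by (rule abs_ge_zero)
    then have "cball (0::real^'n) R \<noteq> {}" by simp
    ultimately obtain p0 where p0: "p0 \<in> cball 0 R" "\<And>p. p \<in> cball 0 R \<Longrightarrow> f p \<le> f p0"
      using continuous_attains_sup[OF compact_cball] by blast
    have "f p \<le> f p0" for p
    proof (cases "norm p \<le> R")
      case False
      then have "(B - f 0) / \<delta> < norm p" unfolding R_def by linarith
      then have "B - f 0 < \<delta> * norm p" using \<delta> by (simp add: field_simps)
      then have "f p \<le> f 0" using far[of p] by simp
      also have "\<dots> \<le> f p0" using R0 by (intro p0) simp
      finally show ?thesis .
    qed (use p0 in auto)
    then show ?thesis unfolding f_def by blast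
  qed
  have jet: "\<exists>p A. linear A \<and>
      (\<forall>\<^sub>F x in nhds x0. g.W x \<le> g.W x0 + p \<bullet> (x - x0) + (1/2) * (A (x - x0) \<bullet> (x - x0))) \<and>
      (\<forall>x. \<phi> x \<le> S0 + 2 \<longrightarrow> g.W x0 + p \<bullet> (x - x0) \<le> g.W x) \<and>
      dual_norm \<phi> p \<le> K + \<theta> \<and>
      (r0 \<le> \<phi> x0 \<longrightarrow> K \<le> dual_norm \<phi> p \<and> (\<forall>q\<in>subdifferential (dual_norm \<phi>) p. A q \<bullet> q \<le> c))"
    if x0: "\<phi> x0 \<le> S0" for x0
  proof -
    obtain p0 where p0: "\<And>p. p \<bullet> x0 - g.H p \<le> p0 \<bullet> x0 - g.H p0"
      using max_ex[of x0] x0 by auto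
    interpret gm: gibbs_max C V \<epsilon> x0 p0
      by unfold_locales (rule p0)
    have low: "g.W x0 + p0 \<bullet> (x - x0) \<le> g.W x" if "\<phi> x \<le> S0 + 2" for x
      using W_ge[OF that, of p0] gm.W_max by (simp add: inner_diff_right)
    define t where "t = dual_norm \<phi> p0"
    obtain q0 where q0: "\<phi> q0 \<le> 1" "p0 \<bullet> q0 = t" using dual_attained[of p0] by (auto simp: t_def)
    have t_up: "t \<le> K + (2 * \<phi> x0 + 1) / (2 * \<sigma>) + 2 * \<theta>2"
    proof -
      have *: "\<phi> (x0 + q0) \<le> \<phi> x0 + 1" using phi_triangle[of x0 q0] q0 by simp
      \<comment> \<open>The slope is read off from the increment of \<open>W\<close> over one step
        \<open>q0\<close>, because \<open>p0\<close> is a subgradient of \<open>W\<close> at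
        \<open>x0\<close>.\<close>
      then have "t \<le> g.W (x0 + q0) - g.W x0" using low[of "x0 + q0"] x0 q0 by simp
      also have "\<dots> \<le> K * (\<phi> x0 + 1) + (\<phi> x0 + 1)\<^sup>2 / (2 * \<sigma>) + \<theta>2 - (V x0 - \<theta>2)"
        using W_up[of "x0 + q0"] * x0 Vmono[OF *] W_low[of x0] by simp
      also have "\<dots> = K + ((\<phi> x0 + 1)\<^sup>2 / (2 * \<sigma>) - (\<phi> x0)\<^sup>2 / (2 * \<sigma>)) + 2 * \<theta>2"
        by (simp add: V_def algebra_simps)
      also have "(\<phi> x0 + 1)\<^sup>2 / (2 * \<sigma>) - (\<phi> x0)\<^sup>2 / (2 * \<sigma>) = (2 * \<phi> x0 + 1) / (2 * \<sigma>)"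
        by (simp add: power2_eq_square algebra_simps flip: diff_divide_distrib)
      finally show ?thesis .
    qed
    have t_le: "t \<le> K + \<theta>"
    proof -
      have "(2 * \<phi> x0 + 1) / (2 * \<sigma>) \<le> (2 * S0 + 1) / (2 * \<sigma>)"
        using x0 \<sigma> by (intro divide_right_mono) auto
      then show ?thesis using t_up \<sigma>(4) \<theta>2(2) by linarith
    qed
    define s where "s = \<sigma> * max (t - K) 0"
    \<comment> \<open>This keeps the maximisers, and their extensions by at most one unit along a
      subgradient, inside \<open>C\<close>.\<close>
    have s: "0 \<le> s" "s \<le> S0 + 1"
    proof -
      show "0 \<le> s" using \<sigma> by (simp add: s_def)
      have "\<sigma> * (t - K) \<le> \<sigma> * ((2 * \<phi> x0 + 1) / (2 * \<sigma>) + 2 * \<theta>2)"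
        using t_up \<sigma> by (intro mult_left_mono) auto
      also have "\<dots> = \<phi> x0 + 1/2 + (4 * \<sigma> * \<theta>2) / 2" using \<sigma> by (simp add: field_simps)
      also have "\<dots> \<le> S0 + 1" using x0 \<theta>2(4) by simp
      finally show "s \<le> S0 + 1" using S0 by (auto simp: s_def max_def)
    qed
    define m where "m = s * (t - K) - s\<^sup>2 / (2 * \<sigma>)"
    have f_le: "y \<bullet> p0 - V y \<le> m" for y
    proof -
      have "y \<bullet> p0 \<le> t * \<phi> y" using inner_le_dual[of p0 y] by (simp add: t_def inner_commute)
      then have "y \<bullet> p0 - V y \<le> \<phi> y * (t - K) - (\<phi> y)\<^sup>2 / (2 * \<sigma>)"
        by (simp add: V_def algebra_simps)
      also have "\<dots> \<le> m"
      proof (cases "K \<le> t")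
        case True
        then have tK: "t - K = s / \<sigma>" using \<sigma> by (simp add: s_def)
        have "0 \<le> (\<phi> y - s)\<^sup>2 / (2 * \<sigma>)" using \<sigma> by simp
        moreover have "m - (\<phi> y * (t - K) - (\<phi> y)\<^sup>2 / (2 * \<sigma>)) = (\<phi> y - s)\<^sup>2 / (2 * \<sigma>)"
          unfolding m_def tK using \<sigma>(1) by (simp add: power2_eq_square field_simps)
        ultimately show ?thesis by linarith
      next
        case False
        then have "s = 0" by (simp add: s_def)
        moreover have "\<phi> y * (t - K) \<le> 0" using False by (intro mult_nonneg_nonpos) auto
        moreover have "0 \<le> (\<phi> y)\<^sup>2 / (2 * \<sigma>)" using \<sigma> by simp
        ultimately show ?thesis by (simp add: m_def)
      qed
      finally show ?thesis .
    qed
    have near: "gm.near_max y" if "\<phi> y \<le> S0 + 3" "m - \<epsilon> \<le> y \<bullet> p0 - V y" for y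
      unfolding gm.near_max_def
    proof (intro conjI ballI)
      show "y \<in> C" using that by (simp add: C_def)
      show "y' \<bullet> p0 - V y' \<le> y \<bullet> p0 - V y + \<epsilon>" for y' using that(2) f_le[of y'] by linarith
    qed
    have f_ray: "s' * (t - K) - s'\<^sup>2 / (2 * \<sigma>) \<le> (s' *\<^sub>R q) \<bullet> p0 - V (s' *\<^sub>R q)"
      if "q \<in> subdifferential (dual_norm \<phi>) p0" "0 \<le> s'" for q s'
    proof -
      have q: "\<phi> q \<le> 1" "p0 \<bullet> q = t" using that by (auto simp: subdifferential_dual_iff t_def)
      have "\<phi> (s' *\<^sub>R q) \<le> s'" using q that(2) by (simp add: phi_scale mult_left_le)
      from Vmono[OF this] show ?thesis using q by (simp add: inner_commute algebra_simps)
    qed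
    have q0F: "q0 \<in> subdifferential (dual_norm \<phi>) p0" using q0 by (simp add: subdifferential_dual_iff t_def)
    have phi_ray: "\<phi> (s' *\<^sub>R q) \<le> s'" if "q \<in> subdifferential (dual_norm \<phi>) p0" "0 \<le> s'" for q s'
      using that by (simp add: phi_scale subdifferential_dual_iff mult_left_le)
    obtain r where r: "0 < r" "\<And>y. y \<in> cball (s *\<^sub>R q0) r \<Longrightarrow> gm.near_max y"
    proof -
      \<comment> \<open>Strict inequalities make the set open, which yields the full ball of
        near-maximisers demanded by \<open>upper_jet\<close>.\<close>
      define O1 where "O1 = {y. \<phi> y < S0 + 3} \<inter> {y. m - \<epsilon> < y \<bullet> p0 - V y}"
      have "open O1" unfolding O1_def
        by (intro open_Int open_Collect_less continuous_intros phi_continuous_on Vc)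
      moreover have "s *\<^sub>R q0 \<in> O1"
        using phi_ray[OF q0F s(1)] s f_ray[OF q0F s(1)] \<epsilon>(1) by (simp add: O1_def m_def)
      ultimately obtain r where "0 < r" "cball (s *\<^sub>R q0) r \<subseteq> O1"
        using open_contains_cball by blast
      moreover have "gm.near_max y" if "y \<in> O1" for y
        using that by (intro near) (auto simp: O1_def)
      ultimately show ?thesis using that by blast
    qed
    obtain A where A: "linear A"
      "\<forall>\<^sub>F x in nhds x0. g.W x \<le> g.W x0 + p0 \<bullet> (x - x0) + (1/2) * (A (x - x0) \<bullet> (x - x0))"
      "\<And>q c. (\<And>h. (q \<bullet> h)\<^sup>2 \<le> c * gm.Q h) \<Longrightarrow> A q \<bullet> q \<le> 2 * c"
      using gm.upper_jet[OF r] by blast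
    have "K \<le> t \<and> (\<forall>q\<in>subdifferential (dual_norm \<phi>) p0. A q \<bullet> q \<le> c)" if r0x: "r0 \<le> \<phi> x0"
    proof
      have x0pos: "0 < \<phi> x0" using r0x r0 by linarith
      \<comment> \<open>Comparing with the tip shows that the slope is at least \<open>K\<close>:
        the quadratic part of \<open>V\<close>, at least \<open>r0\<^sup>2 / (2 * \<sigma>)\<close>
        at \<open>x0\<close>, absorbs the error of replacing \<open>W\<close> by \<open>V\<close> at
        both ends.\<close>
      have "g.W x0 \<le> g.W 0 + p0 \<bullet> x0" using low[of 0] S0 by simp
      then have "V x0 - 2 * \<theta>2 \<le> t * \<phi> x0"
        using W_low[of x0] W_up[of 0] inner_le_dual[of p0 x0] x0 S0 by (simp add: t_def V_def)
      moreover have "2 * \<theta>2 \<le> (\<phi> x0)\<^sup>2 / (2 * \<sigma>)"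
      proof -
        have "4 * \<sigma> * \<theta>2 \<le> (\<phi> x0)\<^sup>2" using \<theta>2(3) power_mono[OF r0x, of 2] r0 by linarith
        then show ?thesis using \<sigma> by (simp add: field_simps)
      qed
      ultimately have "K * \<phi> x0 \<le> t * \<phi> x0" by (simp add: V_def)
      then show Kt: "K \<le> t" using x0pos by simp
      show "\<forall>q\<in>subdifferential (dual_norm \<phi>) p0. A q \<bullet> q \<le> c"
      proof
        fix q assume q: "q \<in> subdifferential (dual_norm \<phi>) p0"
        define \<tau> where "\<tau> = sqrt (2 * \<sigma> * \<epsilon>)"
        have \<tau>: "0 < \<tau>" "\<tau> \<le> 1" "\<tau>\<^sup>2 = 2 * \<sigma> * \<epsilon>" using \<sigma> \<epsilon> by (auto simp: \<tau>_def)
        have tK: "t - K = s / \<sigma>" using \<sigma> Kt by (simp add: s_def)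
        have n1: "gm.near_max (s *\<^sub>R q)"
          using phi_ray[OF q s(1)] s f_ray[OF q s(1)] \<epsilon>(1) by (intro near) (auto simp: m_def)
        have n2: "gm.near_max ((s + \<tau>) *\<^sub>R q)"
        proof (rule near)
          have st: "0 \<le> s + \<tau>" using s \<tau> by simp
          show "\<phi> ((s + \<tau>) *\<^sub>R q) \<le> S0 + 3" using phi_ray[OF q st] s \<tau> by linarith
          have "m - \<epsilon> = m - \<tau>\<^sup>2 / (2 * \<sigma>)" using \<tau> \<sigma> by simp
          also have "\<dots> = (s + \<tau>) * (t - K) - (s + \<tau>)\<^sup>2 / (2 * \<sigma>)"
            unfolding m_def tK using \<sigma> by (simp add: power2_eq_square field_simps)
          also have "\<dots> \<le> ((s + \<tau>) *\<^sub>R q) \<bullet> p0 - V ((s + \<tau>) *\<^sub>R q)" by (rule f_ray[OF q st])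
          finally show "m - \<epsilon> \<le> ((s + \<tau>) *\<^sub>R q) \<bullet> p0 - V ((s + \<tau>) *\<^sub>R q)" .
        qed
        have "(q \<bullet> h)\<^sup>2 \<le> (2 * k0 / \<sigma>) * gm.Q h" for h
        proof -
          have "(s + \<tau>) *\<^sub>R q - s *\<^sub>R q = \<tau> *\<^sub>R q" by (simp add: algebra_simps)
          then have "\<tau>\<^sup>2 * (q \<bullet> h)\<^sup>2 \<le> 4 * k0 * \<epsilon> * gm.Q h"
            using gm.near_max_pair[OF n1 n2, of h] by (simp add: gm.K\<^sub>0_def k0_def power_mult_distrib)
          then have "(2 * \<epsilon>) * (\<sigma> * (q \<bullet> h)\<^sup>2) \<le> (2 * \<epsilon>) * (2 * k0 * gm.Q h)"
            unfolding \<tau>(3) by (simp add: algebra_simps)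
          then have "\<sigma> * (q \<bullet> h)\<^sup>2 \<le> 2 * k0 * gm.Q h" using \<epsilon>(1) by (simp only: mult_le_cancel_left_pos zero_less_numeral mult_pos_pos)
          then show ?thesis using \<sigma> by (simp add: field_simps)
        qed
        then have "A q \<bullet> q \<le> 2 * (2 * k0 / \<sigma>)" by (rule A(3))
        then show "A q \<bullet> q \<le> c" using \<sigma>(2) by simp
      qed
    qed
    then show ?thesis using A(1,2) low t_le unfolding t_def by blast
  qed
  show ?thesis
  proof
    fix x assume x: "\<phi> x \<le> S0"
    have "(\<phi> x)\<^sup>2 / (2 * \<sigma>) \<le> S0\<^sup>2 / (2 * \<sigma>)"
      using x \<sigma> by (intro divide_right_mono power_mono) auto
    then have "V x \<le> K * \<phi> x + \<theta> / 2" "K * \<phi> x \<le> V x" using \<sigma> by (auto simp: V_def)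
    then show "\<bar>g.W x - K * \<phi> x\<bar> \<le> \<theta>" using W_up[of x] W_low[of x] x \<theta>2(1,2) by linarith
  next
    \<comment> \<open>At each point \<open>W\<close> is squeezed between its affine minorant and its
      quadratic majorant.\<close>
    show "continuous_on {x. \<phi> x \<le> S0} g.W"
      unfolding continuous_on_def
    proof
      fix x0 assume "x0 \<in> {x. \<phi> x \<le> S0}"
      then have x0: "\<phi> x0 \<le> S0" by simp
      obtain p A where A: "linear A"
        "\<forall>\<^sub>F x in nhds x0. g.W x \<le> g.W x0 + p \<bullet> (x - x0) + (1/2) * (A (x - x0) \<bullet> (x - x0))"
        "\<And>x. \<phi> x \<le> S0 + 2 \<Longrightarrow> g.W x0 + p \<bullet> (x - x0) \<le> g.W x"
        using jet[OF x0] by blast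
      show "(g.W \<longlongrightarrow> g.W x0) (at x0 within {x. \<phi> x \<le> S0})"
      proof (rule tendsto_sandwich)
        show "\<forall>\<^sub>F x in at x0 within {x. \<phi> x \<le> S0}. g.W x0 + p \<bullet> (x - x0) \<le> g.W x"
          unfolding eventually_at_filter by (rule always_eventually) (use A(3) in auto)
        show "\<forall>\<^sub>F x in at x0 within {x. \<phi> x \<le> S0}. g.W x \<le> g.W x0 + p \<bullet> (x - x0) + (1/2) * (A (x - x0) \<bullet> (x - x0))"
          unfolding eventually_at_filter using A(2) by (rule eventually_mono) simp
        show "((\<lambda>x. g.W x0 + p \<bullet> (x - x0)) \<longlongrightarrow> g.W x0) (at x0 within {x. \<phi> x \<le> S0})"
          by (auto intro!: tendsto_eq_intros)
        have "continuous_on UNIV (\<lambda>x. g.W x0 + p \<bullet> (x - x0) + (1/2) * (A (x - x0) \<bullet> (x - x0)))"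
          by (intro continuous_intros linear_continuous_on_compose[OF _ A(1)])
        then have "((\<lambda>x. g.W x0 + p \<bullet> (x - x0) + (1/2) * (A (x - x0) \<bullet> (x - x0))) \<longlongrightarrow>
            g.W x0 + p \<bullet> (x0 - x0) + (1/2) * (A (x0 - x0) \<bullet> (x0 - x0))) (at x0 within {x. \<phi> x \<le> S0})"
          unfolding continuous_on_def by (meson UNIV_I tendsto_within_subset subset_UNIV)
        then show "((\<lambda>x. g.W x0 + p \<bullet> (x - x0) + (1/2) * (A (x - x0) \<bullet> (x - x0))) \<longlongrightarrow> g.W x0) (at x0 within {x. \<phi> x \<le> S0})"
          by simp
      qed
    qed
  next
    show "\<exists>p A. linear A \<and>
      (\<forall>\<^sub>F x in nhds x0. g.W x \<le> g.W x0 + p \<bullet> (x - x0) + (1/2) * (A (x - x0) \<bullet> (x - x0))) \<and>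
      dual_norm \<phi> p \<le> K + \<theta> \<and>
      (r0 \<le> \<phi> x0 \<longrightarrow> K \<le> dual_norm \<phi> p \<and> (\<forall>q\<in>subdifferential (dual_norm \<phi>) p. A q \<bullet> q \<le> c))"
      if "\<phi> x0 \<le> S0" for x0
      using jet[OF that] by blast
  qed
qed

end

subsection \<open>Quadratic test functions and comparison with cones\<close>

text \<open>\<open>A\<close> may be any linear map. Differentiation symmetrises it, and the
  operators \<open>G_upper\<close> and \<open>G_lower\<close> see only its quadratic form.\<close>

definition quad :: "real^'n \<Rightarrow> real \<Rightarrow> real^'n \<Rightarrow> (real^'n \<Rightarrow> real^'n) \<Rightarrow> real^'n \<Rightarrow> real" where
  "quad x0 a p A x = a + p \<bullet> (x - x0) + (1/2) * (A (x - x0) \<bullet> (x - x0))"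

lemma quad_has_derivative:
  assumes "linear A"
  shows "(quad x0 a p A has_derivative
    (\<lambda>h. p \<bullet> h + (1/2) * (A h \<bullet> (x - x0) + A (x - x0) \<bullet> h))) (at x)"
proof -
  have "bounded_linear A" using assms by (rule linear_conv_bounded_linear[THEN iffD1])
  moreover have "((\<lambda>x. x - x0) has_derivative (\<lambda>h. h)) (at x)"
    by (auto intro!: derivative_eq_intros)
  ultimately have "((\<lambda>x. A (x - x0)) has_derivative A) (at x)"
    by (rule bounded_linear.has_derivative)
  then show ?thesis unfolding quad_def[abs_def]
    by (auto intro!: derivative_eq_intros simp: inner_commute algebra_simps)
qed

lemma partial_deriv_quad:
  assumes "linear A"
  shows "partial_deriv i (quad x0 a p A) =
    quad x0 (p $ i) ((1/2) *\<^sub>R (A (axis i 1) + adjoint A (axis i 1))) (\<lambda>_. 0)"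
proof
  fix x
  have "p \<bullet> axis i 1 = p $ i" by (simp add: inner_axis)
  moreover have "A (x - x0) \<bullet> axis i 1 = adjoint A (axis i 1) \<bullet> (x - x0)"
    using adjoint_works[OF assms, of "x - x0" "axis i 1"] by (simp add: inner_commute)
  moreover have "partial_deriv i (quad x0 a p A) x =
      p \<bullet> axis i 1 + (1/2) * (A (axis i 1) \<bullet> (x - x0) + A (x - x0) \<bullet> axis i 1)"
    unfolding partial_deriv_def
    by (simp only: frechet_derivative_at[OF quad_has_derivative[OF assms], symmetric])
  ultimately show "partial_deriv i (quad x0 a p A) x =
    quad x0 (p $ i) ((1/2) *\<^sub>R (A (axis i 1) + adjoint A (axis i 1))) (\<lambda>_. 0) x"
    by (simp add: quad_def inner_add_left)
qed

lemma quad_differentiable_on: "linear A \<Longrightarrow> quad x0 a p A differentiable_on S"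
  unfolding differentiable_on_def differentiable_def
  using has_derivative_at_withinI[OF quad_has_derivative[of A x0 a p]] by blast

text \<open>The induction closes because a partial derivative of a \<open>quad\<close> is again a
  \<open>quad\<close>, with zero quadratic part.\<close>

lemma Ck_on_quad: "linear A \<Longrightarrow> Ck_on k (quad x0 a p A) S"
proof (induction k arbitrary: a p A)
  case 0
  then show ?case by (simp add: differentiable_imp_continuous_on quad_differentiable_on)
next
  case (Suc k)
  have "linear (\<lambda>_::real^'n. 0::real^'n)" by (simp add: linear_iff)
  then show ?case using Suc by (auto simp: partial_deriv_quad quad_differentiable_on)
qed

lemma smooth_on_quad: "linear A \<Longrightarrow> smooth_on (quad x0 a p A) S"
  by (simp add: smooth_on_def Ck_on_quad)

lemma grad_quad: "linear A \<Longrightarrow> grad (quad x0 a p A) x0 = p"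
  by (simp add: grad_def partial_deriv_quad quad_def vec_eq_iff)

lemma hessian_quad:
  assumes "linear A"
  shows "(hessian (quad x0 a p A) x0 *v q) \<bullet> q = A q \<bullet> q"
proof -
  have lin0: "linear (\<lambda>_::real^'n. 0::real^'n)" by (simp add: linear_iff)
  have adj: "adjoint A (axis j 1) $ i = A (axis i 1) $ j" for i j
    using adjoint_works[OF assms, of "axis i 1" "axis j 1"] by (simp add: inner_axis inner_axis')
  have "hessian (quad x0 a p A) x0 = (1/2) *\<^sub>R (matrix A + transpose (matrix A))"
    by (simp add: hessian_def partial_deriv_quad[OF assms] partial_deriv_quad[OF lin0]
        quad_def vec_eq_iff matrix_def transpose_def adj)
  then have "hessian (quad x0 a p A) x0 *v q = (1/2) *\<^sub>R (matrix A *v q + transpose (matrix A) *v q)"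
    by (simp add: scaleR_matrix_vector_assoc[symmetric] matrix_vector_mult_add_rdistrib)
  moreover have "(transpose (matrix A) *v q) \<bullet> q = q \<bullet> (matrix A *v q)"
    by (simp add: transpose_matrix_vector dot_lmul_matrix)
  ultimately show ?thesis using assms
    by (simp add: inner_add_left inner_add_right inner_commute matrix_works)
qed

lemma viscosity_le_jet:
  assumes "viscosity_le F u U" "x0 \<in> U" "linear A"
    and "\<forall>\<^sub>F x in at x0 within U. u x \<le> quad x0 (u x0) p A x"
  obtains X where "\<And>q. (X *v q) \<bullet> q = A q \<bullet> q" "F x0 (u x0) p X \<le> 0"
proof
  have "quad x0 (u x0) p A x0 = u x0" by (simp add: quad_def)
  then have "\<forall>\<^sub>F x in at x0 within U. u x - quad x0 (u x0) p A x \<le> u x0 - quad x0 (u x0) p A x0"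
    using assms(4) by simp
  then have "F x0 (u x0) (grad (quad x0 (u x0) p A) x0) (hessian (quad x0 (u x0) p A) x0) \<le> 0"
    using assms(1)[unfolded viscosity_le_def, rule_format, OF assms(2), of UNIV "quad x0 (u x0) p A"]
      smooth_on_quad[OF assms(3), of x0 "u x0" p UNIV] by simp
  then show "F x0 (u x0) p (hessian (quad x0 (u x0) p A) x0) \<le> 0"
    using assms(3) by (simp add: grad_quad)
qed (rule hessian_quad[OF assms(3)])

lemma viscosity_ge_jet:
  assumes "viscosity_ge F u U" "x0 \<in> U" "linear A"
    and "\<forall>\<^sub>F x in at x0 within U. quad x0 (u x0) p A x \<le> u x"
  obtains X where "\<And>q. (X *v q) \<bullet> q = A q \<bullet> q" "0 \<le> F x0 (u x0) p X"
proof
  have "quad x0 (u x0) p A x0 = u x0" by (simp add: quad_def)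
  then have "\<forall>\<^sub>F x in at x0 within U. u x - quad x0 (u x0) p A x \<ge> u x0 - quad x0 (u x0) p A x0"
    using assms(4) by simp
  then have "F x0 (u x0) (grad (quad x0 (u x0) p A) x0) (hessian (quad x0 (u x0) p A) x0) \<ge> 0"
    using assms(1)[unfolded viscosity_ge_def, rule_format, OF assms(2), of UNIV "quad x0 (u x0) p A"]
      smooth_on_quad[OF assms(3), of x0 "u x0" p UNIV] by simp
  then show "0 \<le> F x0 (u x0) p (hessian (quad x0 (u x0) p A) x0)"
    using assms(3) by (simp add: grad_quad)
qed (rule hessian_quad[OF assms(3)])

section \<open>Comparison with cones from above\<close>

context finsler
begin

lemma G_upper_le:
  assumes "\<And>q. (X *v q) \<bullet> q = A q \<bullet> q" "\<And>q. q \<in> subdifferential (dual_norm \<phi>) p \<Longrightarrow> A q \<bullet> q \<le> c"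
  shows "G_upper \<phi> p X \<le> c"
  unfolding G_upper_def using assms subdifferential_dual_nonempty by (intro cSUP_least) auto

lemma G_lower_ge:
  assumes "\<And>q. (X *v q) \<bullet> q = A q \<bullet> q" "\<And>q. q \<in> subdifferential (dual_norm \<phi>) p \<Longrightarrow> c \<le> A q \<bullet> q"
  shows "c \<le> G_lower \<phi> p X"
  unfolding G_lower_def using assms subdifferential_dual_nonempty by (intro cINF_greatest) auto

lemma subdifferential_norm_bound:
  obtains m where "0 < m" "\<And>p q. q \<in> subdifferential (dual_norm \<phi>) p \<Longrightarrow> norm q \<le> m"
proof -
  obtain c where c: "0 < c" "\<And>x. c * norm x \<le> \<phi> x" using phi_bounds by metis
  have "norm q \<le> 1 / c" if "q \<in> subdifferential (dual_norm \<phi>) p" for p q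
    using c(2)[of q] that c(1) by (simp add: subdifferential_dual_iff field_simps)
  then show ?thesis using c(1) that[of "1 / c"] by simp
qed

text \<open>Away from \<open>p = 0\<close> subgradients cannot be short, so a definite Hessian gives
  a strict sign in the second-order alternative. At \<open>p = 0\<close> this fails, since
  \<open>0\<close> is then a subgradient.\<close>

lemma subdifferential_norm_lower:
  assumes "p \<noteq> 0" "q \<in> subdifferential (dual_norm \<phi>) p"
  shows "dual_norm \<phi> p / norm p \<le> norm q"
proof -
  have "dual_norm \<phi> p \<le> norm p * norm q"
    using assms norm_cauchy_schwarz[of p q] by (simp add: subdifferential_dual_iff)
  then show ?thesis using assms(1) by (simp add: field_simps)
qed

text \<open>Composing the smoothed cone with the concave map \<open>s \<mapsto> s - a s\<^sup>2\<close> makes its second derivative strictly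
  negative on \<open>\<partial>\<phi>\<^sup>*(p)\<close>, because \<open>p \<bullet> q = \<phi>\<^sup>*(p) \<ge> K\<close> for all \<open>q\<close> in this set.\<close>

lemma cone_comparison:
  assumes D: "open D" "bounded D" and v: "continuous_on (closure D) v"
    and sub: "\<And>x0 p A c. x0 \<in> D \<Longrightarrow> linear A \<Longrightarrow>
      \<forall>\<^sub>F x in nhds x0. v x \<le> quad x0 (v x0) p A x \<Longrightarrow> \<kappa> < dual_norm \<phi> p \<Longrightarrow> 0 < c \<Longrightarrow>
      \<forall>q\<in>subdifferential (dual_norm \<phi>) p. A q \<bullet> q \<le> - c \<Longrightarrow> False"
    and \<kappa>: "0 \<le> \<kappa>" "\<kappa> < K" and y: "y \<notin> D"
    and bdry: "\<And>x. x \<in> frontier D \<Longrightarrow> v x \<le> b + K * \<phi> (x - y)"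
    and x1: "x1 \<in> D"
  shows "v x1 \<le> b + K * \<phi> (x1 - y)"
proof (rule ccontr)
  assume "\<not> v x1 \<le> b + K * \<phi> (x1 - y)"
  then have "0 < v x1 - b - K * \<phi> (x1 - y)" by simp
  then obtain e where e: "0 < e" "e = v x1 - b - K * \<phi> (x1 - y)" by blast
  have K: "0 < K" using \<kappa> by simp
  have cpt: "compact (closure D)" using D by simp
  have x1c: "x1 \<in> closure D" using x1 closure_subset by blast
  have excess_cont: "continuous_on (closure D) (\<lambda>x. v x - b - K * \<phi> (x - y))"
    by (intro continuous_intros v)
  \<comment> \<open>By \<open>bdry\<close> this set stays inside \<open>D\<close>, hence away from
    the tip \<open>y\<close>. So \<open>r0\<close> is fixed before the cone is smoothed, and the
    maximum of the perturbed difference will still lie in \<open>B\<close>.\<close>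
  define B where "B = {x \<in> closure D. e / 2 \<le> v x - b - K * \<phi> (x - y)}"
  have "closed B" unfolding B_def
    using continuous_closed_preimage[OF excess_cont closed_closure, of "{e / 2..}"]
    by (simp add: vimage_def Int_def)
  moreover have "bounded B" using D by (auto simp: B_def intro: bounded_subset[OF bounded_closure])
  ultimately have "compact B" by (simp add: compact_eq_bounded_closed)
  moreover have "x1 \<in> B" using x1c e by (simp add: B_def)
  moreover have "continuous_on B (\<lambda>x. \<phi> (x - y))" by (intro continuous_intros)
  ultimately obtain xm where xm: "xm \<in> B" "\<And>x. x \<in> B \<Longrightarrow> \<phi> (xm - y) \<le> \<phi> (x - y)"
    using continuous_attains_inf[of B "\<lambda>x. \<phi> (x - y)"] by blast
  have BD: "x \<in> D" if "x \<in> B" for x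
  proof (rule ccontr)
    assume "x \<notin> D"
    then have "x \<in> frontier D" using that D by (simp add: frontier_def B_def interior_open)
    then show False using bdry[of x] that e by (simp add: B_def)
  qed
  define r0 where "r0 = \<phi> (xm - y)"
  have r0: "0 < r0" using BD[OF xm(1)] y unfolding r0_def by (intro phi_pos) auto
  obtain xM where xM: "xM \<in> closure D" "\<And>x. x \<in> closure D \<Longrightarrow> \<phi> (x - y) \<le> \<phi> (xM - y)"
  proof -
    have "continuous_on (closure D) (\<lambda>x. \<phi> (x - y))" by (intro continuous_intros)
    moreover have "closure D \<noteq> {}" using x1 by auto
    ultimately show ?thesis using continuous_attains_sup[OF cpt] that by blast
  qed
  define S0 where "S0 = \<phi> (xM - y)"
  define N where "N = K * S0 + 1"
  have N: "1 \<le> N" using K by (simp add: N_def S0_def)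
  \<comment> \<open>The first entry makes the concave correction small against \<open>e\<close>, the
    second keeps the slope above \<open>\<kappa>\<close> after composition, and the third makes
    \<open>g\<close> increasing with derivative between 1/2 and 3/2 on the values of
    \<open>W\<close>.\<close>
  define a where "a = min (e / (8 * N\<^sup>2)) (min ((K - \<kappa>) / (4 * K * N)) (1 / (4 * N)))"
  have a: "0 < a" "a * N\<^sup>2 \<le> e / 8" "4 * K * (a * N) \<le> K - \<kappa>" "4 * (a * N) \<le> 1"
  proof -
    show "0 < a" using e(1) N K \<kappa> by (simp add: a_def)
    have "a \<le> e / (8 * N\<^sup>2)" "a \<le> (K - \<kappa>) / (4 * K * N)" "a \<le> 1 / (4 * N)" by (auto simp: a_def)
    then show "a * N\<^sup>2 \<le> e / 8" "4 * K * (a * N) \<le> K - \<kappa>" "4 * (a * N) \<le> 1"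
      using N K by (auto simp: field_simps)
  qed
  define \<theta> where "\<theta> = min (e / 8) 1"
  have \<theta>: "0 < \<theta>" "\<theta> \<le> e / 8" "\<theta> \<le> 1" using e(1) unfolding \<theta>_def by linarith+
  have c: "0 < a * K\<^sup>2 / 3" using a K by simp
  obtain W where W: "\<And>x. \<phi> x \<le> S0 \<Longrightarrow> \<bar>W x - K * \<phi> x\<bar> \<le> \<theta>"
    "continuous_on {x. \<phi> x \<le> S0} W"
    "\<And>x0. \<phi> x0 \<le> S0 \<Longrightarrow> \<exists>p A. linear A \<and>
      (\<forall>\<^sub>F x in nhds x0. W x \<le> W x0 + p \<bullet> (x - x0) + (1/2) * (A (x - x0) \<bullet> (x - x0))) \<and>
      dual_norm \<phi> p \<le> K + \<theta> \<and>
      (r0 \<le> \<phi> x0 \<longrightarrow> K \<le> dual_norm \<phi> p \<and> (\<forall>q\<in>subdifferential (dual_norm \<phi>) p. A q \<bullet> q \<le> a * K\<^sup>2 / 3))"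
    by (rule smooth_cone[OF K phi_nonneg[of "xM - y", folded S0_def] r0 \<theta>(1) c]) blast
  define g where "g s = s - a * s\<^sup>2" for s :: real
  define \<Theta> where "\<Theta> x = v x - b - g (W (x - y))" for x
  have S0x: "\<phi> (x - y) \<le> S0" if "x \<in> closure D" for x using xM that by (simp add: S0_def)
  have WN: "\<bar>W (x - y)\<bar> \<le> N" if "x \<in> closure D" for x
  proof -
    have "K * \<phi> (x - y) \<le> K * S0" using S0x[OF that] K by simp
    moreover have "0 \<le> K * \<phi> (x - y)" using K by simp
    ultimately show ?thesis using W(1)[OF S0x[OF that]] \<theta>(3) by (simp add: N_def)
  qed
  have gW: "\<bar>g (W (x - y)) - K * \<phi> (x - y)\<bar> \<le> e / 4" if "x \<in> closure D" for x
  proof -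
    have "(W (x - y))\<^sup>2 \<le> N\<^sup>2" using WN[OF that] N by (intro abs_le_square_iff[THEN iffD1]) simp
    then have "a * (W (x - y))\<^sup>2 \<le> e / 8" using a(1,2) mult_left_mono[of "(W (x - y))\<^sup>2" "N\<^sup>2" a] by linarith
    moreover have "0 \<le> a * (W (x - y))\<^sup>2" using a by simp
    ultimately show ?thesis using W(1)[OF S0x[OF that]] \<theta>(2) unfolding g_def by linarith
  qed
  have "continuous_on (closure D) (\<lambda>x. W (x - y))"
    by (rule continuous_on_compose2[OF W(2)]) (use S0x in \<open>auto intro!: continuous_intros\<close>)
  then have "continuous_on (closure D) \<Theta>"
    unfolding \<Theta>_def g_def by (intro continuous_intros v)
  then obtain x0 where x0: "x0 \<in> closure D" "\<And>x. x \<in> closure D \<Longrightarrow> \<Theta> x \<le> \<Theta> x0"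
    using continuous_attains_sup[OF cpt] x1c by (metis empty_iff)
  have "x0 \<in> B"
  proof -
    have "3 * e / 4 \<le> \<Theta> x1" using gW[OF x1c] e unfolding \<Theta>_def by linarith
    also have "\<Theta> x1 \<le> \<Theta> x0" by (rule x0(2)[OF x1c])
    finally have "e / 2 \<le> v x0 - b - K * \<phi> (x0 - y)"
      using gW[OF x0(1)] unfolding \<Theta>_def by linarith
    then show ?thesis using x0(1) by (simp add: B_def)
  qed
  then have x0D: "x0 \<in> D" and r0x: "r0 \<le> \<phi> (x0 - y)" using BD xm by (auto simp: r0_def)
  obtain p A where pA: "linear A"
      "\<forall>\<^sub>F x in nhds (x0 - y). W x \<le> W (x0 - y) + p \<bullet> (x - (x0 - y)) + (1/2) * (A (x - (x0 - y)) \<bullet> (x - (x0 - y)))"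
      "K \<le> dual_norm \<phi> p" "\<And>q. q \<in> subdifferential (dual_norm \<phi>) p \<Longrightarrow> A q \<bullet> q \<le> a * K\<^sup>2 / 3"
    using W(3)[OF S0x[OF x0(1)]] r0x by blast
  define W0 where "W0 = W (x0 - y)"
  define l where "l z = p \<bullet> z + (1/2) * (A z \<bullet> z)" for z
  \<comment> \<open>The derivative of \<open>g\<close> at \<open>W0\<close>.\<close>
  define \<mu> where "\<mu> = 1 - 2 * a * W0"
  have aW0: "\<bar>a * W0\<bar> \<le> 1/4"
  proof -
    have "\<bar>a * W0\<bar> = a * \<bar>W0\<bar>" using a by (simp add: abs_mult)
    also have "\<dots> \<le> a * N" using WN[OF x0(1)] a by (simp add: W0_def)
    finally show ?thesis using a(4) by simp
  qed
  then have \<mu>: "1/2 \<le> \<mu>" "\<mu> \<le> 3/2" by (auto simp: \<mu>_def abs_le_iff)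
  obtain m where m: "0 < m" "\<And>p q. q \<in> subdifferential (dual_norm \<phi>) p \<Longrightarrow> norm q \<le> m"
    using subdifferential_norm_bound by blast
  \<comment> \<open>An allowance for third-order terms, small enough that
    \<open>2 * k * (norm q)\<^sup>2 \<le> a * K\<^sup>2 / 2\<close> for every subgradient
    \<open>q\<close>.\<close>
  define k where "k = a * K\<^sup>2 / (4 * m\<^sup>2)"
  have k: "0 < k" using a K m by (simp add: k_def)
  have bl: "bounded_linear A" using pA(1) by (rule linear_conv_bounded_linear[THEN iffD1])
  obtain M where M: "0 < M" "\<And>z. norm (A z) \<le> M * norm z"
    using bounded_linear.pos_bounded[OF bl] by (auto simp: mult.commute)
  have lcont: "continuous_on UNIV (\<lambda>x. l (x - x0))" unfolding l_def
    by (intro continuous_intros linear_continuous_on_compose[OF _ pA(1)])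
  have l0: "l (x0 - x0) = 0" by (simp add: l_def linear_0[OF pA(1)])
  have ev_l: "\<forall>\<^sub>F x in nhds x0. l (x - x0) < 1 / (4 * a)"
  proof -
    have "open {x. l (x - x0) < 1 / (4 * a)}"
      by (intro open_Collect_less lcont continuous_intros)
    moreover have "x0 \<in> {x. l (x - x0) < 1 / (4 * a)}" using l0 a by simp
    ultimately show ?thesis using eventually_nhds_in_open by fastforce
  qed
  have ev_D: "\<forall>\<^sub>F x in nhds x0. x \<in> D" using D x0D by (rule_tac eventually_nhds_in_open)
  have "((\<lambda>x. x - y) \<longlongrightarrow> x0 - y) (nhds x0)" by (intro tendsto_intros filterlim_ident)
  note this[unfolded filterlim_iff, rule_format, OF pA(2)]
  moreover have "x - y - (x0 - y) = x - x0" for x by simp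
  ultimately have ev_W: "\<forall>\<^sub>F x in nhds x0. W (x - y) \<le> W0 + l (x - x0)"
    by (simp only: W0_def l_def add.assoc)
  have ev_small: "\<forall>\<^sub>F x in nhds x0. dist x x0 < k / (a * (norm p + 1) * M)"
    unfolding eventually_nhds_metric using k a M by (intro exI[of _ "k / (a * (norm p + 1) * M)"]) (auto simp: add_pos_nonneg add_nonneg_pos)
  \<comment> \<open>The chain rule for \<open>g\<close> composed with the quadratic majorant of
    \<open>W\<close>: first derivative times \<open>A\<close>, second derivative
    \<open>- 2 * a\<close> times the square of \<open>p\<close>, and the allowance \<open>k\<close>
    added.\<close>
  define A' where "A' z = \<mu> *\<^sub>R A z - (2 * a * (p \<bullet> z)) *\<^sub>R p + (2 * k) *\<^sub>R z" for z
  have A'q: "A' z \<bullet> z = \<mu> * (A z \<bullet> z) - 2 * a * (p \<bullet> z)\<^sup>2 + 2 * k * (norm z)\<^sup>2" for z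
    by (simp add: A'_def inner_add_left inner_diff_left power2_eq_square dot_square_norm)
  have linA': "linear A'"
    using linear_add[OF pA(1)] linear_cmul[OF pA(1)]
    by (intro linearI) (simp_all add: A'_def inner_add_right algebra_simps)
  have jet: "\<forall>\<^sub>F x in nhds x0. v x \<le> quad x0 (v x0) (\<mu> *\<^sub>R p) A' x"
    using ev_l ev_D ev_W ev_small
  proof eventually_elim
    fix x
    assume *: "l (x - x0) < 1 / (4 * a)" "x \<in> D" "W (x - y) \<le> W0 + l (x - x0)"
      "dist x x0 < k / (a * (norm p + 1) * M)"
    define z where "z = x - x0"
    have "v x - b - g (W (x - y)) \<le> v x0 - b - g W0"
      using x0(2)[of x] *(2) closure_subset[of D] by (auto simp: \<Theta>_def W0_def)
    \<comment> \<open>The upper bound on \<open>W\<close> may be inserted because \<open>g\<close>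
      is increasing on the values in question; for arguments above \<open>W0\<close> this is what
      the restriction \<open>ev_l\<close> provides.\<close>
    moreover have "g (W (x - y)) \<le> g (W0 + l z)"
    proof -
      define s t where "s = W (x - y)" and "t = W0 + l z"
      have st: "s \<le> t" using * by (simp add: s_def t_def z_def)
      have "a * t \<le> 1/2"
      proof -
        have "a * l z \<le> 1/4" using *(1) a by (simp add: z_def field_simps)
        then show ?thesis using aW0 by (simp add: t_def distrib_left abs_le_iff)
      qed
      moreover have "a * s \<le> a * t" using st a by simp
      ultimately have "0 \<le> (t - s) * (1 - a * (t + s))" using st by (intro mult_nonneg_nonneg) (auto simp: distrib_left)
      also have "\<dots> = g t - g s" by (simp add: g_def power2_eq_square algebra_simps)
      finally show ?thesis by (simp add: s_def t_def)
    qed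
    moreover have "g (W0 + l z) - g W0 = \<mu> * l z - a * (l z)\<^sup>2"
      by (simp add: g_def \<mu>_def power2_eq_square algebra_simps)
    \<comment> \<open>Expanding the square of \<open>l z\<close>, the mixed term is cubic in
      \<open>z\<close> and is absorbed by \<open>k * (norm z)\<^sup>2\<close> near
      \<open>x0\<close>; the quartic term has the favourable sign.\<close>
    moreover have "- (a * (l z)\<^sup>2) \<le> - (a * (p \<bullet> z)\<^sup>2) + k * (norm z)\<^sup>2"
    proof -
      have "\<bar>p \<bullet> z\<bar> * \<bar>A z \<bullet> z\<bar> \<le> (norm p * norm z) * (M * norm z * norm z)"
      proof (intro mult_mono)
        show "\<bar>p \<bullet> z\<bar> \<le> norm p * norm z" by (rule Cauchy_Schwarz_ineq2)
        have "\<bar>A z \<bullet> z\<bar> \<le> norm (A z) * norm z" by (rule Cauchy_Schwarz_ineq2)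
        also have "\<dots> \<le> M * norm z * norm z" using M by (intro mult_right_mono) auto
        finally show "\<bar>A z \<bullet> z\<bar> \<le> M * norm z * norm z" .
      qed auto
      also have "\<dots> = (norm p * M * norm z) * (norm z)\<^sup>2" by (simp add: power2_eq_square)
      also have "\<dots> \<le> (k / a) * (norm z)\<^sup>2"
      proof (intro mult_right_mono)
        have np: "0 < norm p + 1" by (simp add: add_nonneg_pos)
        have "norm z * (a * (norm p + 1) * M) \<le> k"
          using *(4) a M np by (simp add: z_def dist_norm pos_less_divide_eq)
        moreover have "norm p * M * norm z * a \<le> norm z * (a * (norm p + 1) * M)"
          using a M by (simp add: algebra_simps)
        ultimately show "norm p * M * norm z \<le> k / a" using a by (simp add: field_simps)
      qed simp
      finally have "\<bar>(p \<bullet> z) * (A z \<bullet> z)\<bar> \<le> (k / a) * (norm z)\<^sup>2" by (simp add: abs_mult)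
      then have "- ((k / a) * (norm z)\<^sup>2) \<le> (p \<bullet> z) * (A z \<bullet> z)" by (simp add: abs_le_iff)
      then have "(p \<bullet> z)\<^sup>2 - (k / a) * (norm z)\<^sup>2 \<le> (p \<bullet> z)\<^sup>2 + (p \<bullet> z) * (A z \<bullet> z) + ((1/2) * (A z \<bullet> z))\<^sup>2"
        using zero_le_power2[of "(1/2) * (A z \<bullet> z)"] by linarith
      also have "\<dots> = (l z)\<^sup>2" by (simp add: l_def power2_eq_square algebra_simps)
      finally have "a * ((p \<bullet> z)\<^sup>2 - (k / a) * (norm z)\<^sup>2) \<le> a * (l z)\<^sup>2" using a by simp
      then show ?thesis using a by (simp add: right_diff_distrib)
    qed
    ultimately have "v x \<le> v x0 + (\<mu> * l z - a * (p \<bullet> z)\<^sup>2 + k * (norm z)\<^sup>2)" by linarith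
    moreover have "quad x0 (v x0) (\<mu> *\<^sub>R p) A' x = v x0 + (\<mu> * l z - a * (p \<bullet> z)\<^sup>2 + k * (norm z)\<^sup>2)"
      by (simp add: quad_def z_def[symmetric] A'q l_def algebra_simps)
    ultimately show "v x \<le> quad x0 (v x0) (\<mu> *\<^sub>R p) A' x" by simp
  qed
  have "\<kappa> < dual_norm \<phi> (\<mu> *\<^sub>R p)"
  proof -
    have "\<mu> * K \<le> \<mu> * dual_norm \<phi> p" using \<mu> pA(3) by simp
    moreover have "\<kappa> < \<mu> * K"
    proof -
      have "2 * (a * W0) * K \<le> 2 * (a * N) * K"
        using WN[OF x0(1)] a K by (intro mult_right_mono mult_left_mono) (auto simp: W0_def abs_le_iff)
      then have "K - (K - \<kappa>) / 2 \<le> \<mu> * K" using a(3) by (simp add: \<mu>_def algebra_simps)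
      moreover have "\<kappa> < K - (K - \<kappa>) / 2" using \<kappa> by (simp add: field_simps)
      ultimately show ?thesis by linarith
    qed
    ultimately have "\<kappa> < \<mu> * dual_norm \<phi> p" by linarith
    then show ?thesis using \<mu> by (simp add: dual_scale)
  qed
  moreover have "0 < a * K\<^sup>2" using a K by simp
  moreover have "\<forall>q\<in>subdifferential (dual_norm \<phi>) (\<mu> *\<^sub>R p). A' q \<bullet> q \<le> - (a * K\<^sup>2)"
  proof
    fix q assume "q \<in> subdifferential (dual_norm \<phi>) (\<mu> *\<^sub>R p)"
    then have q: "q \<in> subdifferential (dual_norm \<phi>) p" using \<mu> by (simp add: subdifferential_dual_scale)
    \<comment> \<open>Three contributions are balanced: smoothing costs at most
      \<open>a * K\<^sup>2 / 2\<close>, the allowance \<open>k\<close> the same, and the concavity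
      of \<open>g\<close> gains \<open>2 * a * K\<^sup>2\<close>.\<close>
    have "\<mu> * (A q \<bullet> q) \<le> \<mu> * (a * K\<^sup>2 / 3)" using pA(4)[OF q] \<mu> by (intro mult_left_mono) auto
    also have "\<dots> \<le> (3/2) * (a * K\<^sup>2 / 3)" using \<mu> c by (intro mult_right_mono) auto
    finally have 1: "\<mu> * (A q \<bullet> q) \<le> a * K\<^sup>2 / 2" by simp
    have "K\<^sup>2 \<le> (p \<bullet> q)\<^sup>2" using pA(3) q K by (intro power_mono) (auto simp: subdifferential_dual_iff)
    then have 2: "a * K\<^sup>2 \<le> a * (p \<bullet> q)\<^sup>2" using a by simp
    have "(norm q)\<^sup>2 \<le> m\<^sup>2" using m(2)[OF q] by (intro power_mono) auto
    then have "k * (norm q)\<^sup>2 \<le> k * m\<^sup>2" using k by simp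
    then have 3: "k * (norm q)\<^sup>2 \<le> a * K\<^sup>2 / 4" using m by (simp add: k_def)
    show "A' q \<bullet> q \<le> - (a * K\<^sup>2)" unfolding A'q using 1 2 3 by linarith
  qed
  ultimately show False by (rule sub[OF x0D linA' jet])
qed

end

subsection \<open>Viscosity eigenfunctions\<close>

text \<open>Cone comparison demands a slope strictly above the threshold; this passes to the
  limit.\<close>

lemma le_mult_limit:
  fixes a t K0 :: real
  assumes "\<And>K. K0 < K \<Longrightarrow> a \<le> K * t" "0 \<le> t"
  shows "a \<le> K0 * t"
proof (rule field_le_epsilon)
  fix e :: real assume e: "0 < e"
  have t: "0 < t + 1" using assms(2) by simp
  have "a \<le> (K0 + e / (t + 1)) * t" using e t by (intro assms(1)) simp
  also have "\<dots> = K0 * t + e * (t / (t + 1))" by (simp add: distrib_right)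
  also have "e * (t / (t + 1)) \<le> e * 1" using e assms(2) t by (intro mult_left_mono) auto
  finally show "a \<le> K0 * t + e" by simp
qed

lemma eventually_nhds_reflect:
  fixes z x0 :: "'a::real_normed_vector"
  assumes "\<forall>\<^sub>F \<xi> in nhds (z - x0). P \<xi>"
  shows "\<forall>\<^sub>F x in nhds x0. P (z - x)"
proof -
  have "((\<lambda>x. z - x) \<longlongrightarrow> z - x0) (nhds x0)" by (intro tendsto_intros filterlim_ident)
  from this[unfolded filterlim_iff, rule_format, OF assms] show ?thesis .
qed

text \<open>Negation and reflection each change the sign of the gradient, so \<open>p\<close> is
  kept while the Hessian changes sign. This turns a supersolution into a subsolution for the same
  \<open>\<phi>\<close>, without evenness.\<close>

lemma quad_reflect:
  assumes "linear A"
  shows "- quad (z - y0) (- a) p A (z - y) = quad y0 a p (\<lambda>h. - A h) y"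
proof -
  have e: "z - y - (z - y0) = - (y - y0)" by simp
  have n: "A (- (y - y0)) = - A (y - y0)" by (rule linear_neg[OF assms])
  show ?thesis unfolding quad_def e n inner_minus_left inner_minus_right by simp
qed

lemma norm_square_shift:
  fixes x x0 z :: "'a::real_inner"
  shows "(norm (x - z))\<^sup>2 = (norm (x0 - z))\<^sup>2 + 2 * ((x0 - z) \<bullet> (x - x0)) + (norm (x - x0))\<^sup>2"
  by (simp add: power2_norm_eq_inner inner_diff_left inner_diff_right inner_commute algebra_simps)

text \<open>Nontriviality is required on every component because zero satisfies both inequalities
  for every \<open>\<Lambda>\<close>: otherwise \<open>u\<close> could be supported on some
  components only, and \<open>\<Lambda>\<close> would say nothing about the others.\<close>

locale finsler_eigenfunction = finsler \<phi> for \<phi> :: "real^'n \<Rightarrow> real" +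
  fixes U :: "(real^'n) set" and \<Lambda> :: real and u :: "real^'n \<Rightarrow> real"
  assumes open_U: "open U" and bounded_U: "bounded U" and U_ne: "U \<noteq> {}"
    and u_cont: "continuous_on (closure U) u"
    and visc_le: "viscosity_le (\<lambda>x r p X. min (dual_norm \<phi> p - \<Lambda> * r) (- G_upper \<phi> p X)) u U"
    and visc_ge: "viscosity_ge (\<lambda>x r p X. min (dual_norm \<phi> p - \<Lambda> * r) (- G_lower \<phi> p X)) u U"
    and u_frontier: "\<And>x. x \<in> frontier U \<Longrightarrow> u x = 0"
    and nontrivial: "\<And>C. C \<in> components U \<Longrightarrow> \<exists>x\<in>C. u x \<noteq> 0"
begin

lemma sub_contra:
  assumes "x0 \<in> U" "linear A" "\<forall>\<^sub>F x in nhds x0. u x \<le> quad x0 (u x0) p A x"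
    and "\<Lambda> * u x0 < dual_norm \<phi> p" "0 < c" "\<And>q. q \<in> subdifferential (dual_norm \<phi>) p \<Longrightarrow> A q \<bullet> q \<le> - c"
  shows False
proof -
  have "\<forall>\<^sub>F x in at x0 within U. u x \<le> quad x0 (u x0) p A x"
    using assms(3) unfolding eventually_at_filter by (rule eventually_mono) simp
  then obtain X where X: "\<And>q. (X *v q) \<bullet> q = A q \<bullet> q"
      "min (dual_norm \<phi> p - \<Lambda> * u x0) (- G_upper \<phi> p X) \<le> 0"
    using viscosity_le_jet[OF visc_le assms(1,2)] by blast
  have "G_upper \<phi> p X \<le> - c" by (rule G_upper_le[OF X(1) assms(6)])
  then show False using X(2) assms(4,5) by (simp add: min_def split: if_splits)
qed

lemma super_contra:
  assumes "x0 \<in> U" "linear A" "\<forall>\<^sub>F x in nhds x0. quad x0 (u x0) p A x \<le> u x"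
    and "dual_norm \<phi> p < \<Lambda> * u x0 \<or> 0 < c \<and> (\<forall>q\<in>subdifferential (dual_norm \<phi>) p. c \<le> A q \<bullet> q)"
  shows False
proof -
  have "\<forall>\<^sub>F x in at x0 within U. quad x0 (u x0) p A x \<le> u x"
    using assms(3) unfolding eventually_at_filter by (rule eventually_mono) simp
  then obtain X where X: "\<And>q. (X *v q) \<bullet> q = A q \<bullet> q"
      "0 \<le> min (dual_norm \<phi> p - \<Lambda> * u x0) (- G_lower \<phi> p X)"
    using viscosity_ge_jet[OF visc_ge assms(1,2)] by blast
  then have *: "\<Lambda> * u x0 \<le> dual_norm \<phi> p" "G_lower \<phi> p X \<le> 0" by auto
  show False using assms(4)
  proof
    assume "0 < c \<and> (\<forall>q\<in>subdifferential (dual_norm \<phi>) p. c \<le> A q \<bullet> q)"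
    then have "c \<le> G_lower \<phi> p X" "0 < c" using G_lower_ge[OF X(1)] by auto
    then show False using * by simp
  qed (use * in simp)
qed

section \<open>Signs of the solution and of the eigenvalue\<close>

lemma outer_point: obtains z R where "z \<notin> U" "0 < R" "\<And>x. x \<in> closure U \<Longrightarrow> norm (x - z) \<le> R"
proof -
  have "U \<noteq> UNIV" using bounded_U not_bounded_UNIV by auto
  then obtain z where z: "z \<notin> U" by blast
  have "bounded ((\<lambda>x. x - z) ` closure U)"
    by (intro compact_imp_bounded compact_continuous_image continuous_intros) (simp add: bounded_U)
  then show ?thesis using that z unfolding bounded_pos by auto
qed

lemma closure_cases: "x \<in> closure U \<Longrightarrow> x \<in> U \<or> x \<in> frontier U"
  using open_U by (auto simp: frontier_def interior_open)

lemma closure_ne: "closure U \<noteq> {}" and closure_compact: "compact (closure U)"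
  using U_ne bounded_U by auto

lemma linear_scale: "linear (\<lambda>z::real^'n. c *\<^sub>R z)"
  by (simp add: linear_iff algebra_simps)

text \<open>Minimum principle. Subtracting a small convex paraboloid from \<open>u\<close> keeps a
  negative minimum interior, and there a positive definite test Hessian contradicts the second-order
  alternative.\<close>

lemma u_nonneg: assumes "x \<in> closure U" shows "0 \<le> u x"
proof (rule ccontr)
  assume neg: "\<not> 0 \<le> u x"
  obtain z R where z: "z \<notin> U" "0 < R" "\<And>x. x \<in> closure U \<Longrightarrow> norm (x - z) \<le> R" using outer_point by blast
  \<comment> \<open>The paraboloid then varies by at most half of \<open>- u x\<close> on the
    closure of \<open>U\<close>. Its centre \<open>z\<close> lies outside \<open>U\<close>, so its
    gradient does not vanish in \<open>U\<close>.\<close>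
  define e where "e = - u x / R\<^sup>2"
  have "0 < - u x / R\<^sup>2" using neg z by (intro divide_pos_pos) auto
  then have e: "0 < e" "e * R\<^sup>2 = - u x" using z(2) by (auto simp: e_def)
  define f where "f y = u y - (e / 2) * (norm (y - z))\<^sup>2" for y
  have "continuous_on (closure U) f" unfolding f_def by (intro continuous_intros u_cont)
  then obtain x0 where x0: "x0 \<in> closure U" "\<And>y. y \<in> closure U \<Longrightarrow> f x0 \<le> f y"
    using continuous_attains_inf[OF closure_compact closure_ne] by blast
  have "f x \<le> u x" using e by (simp add: f_def)
  then have fx0: "f x0 \<le> u x" using x0(2)[OF assms] by simp
  have x0U: "x0 \<in> U"
  proof (rule ccontr)
    assume "x0 \<notin> U"
    then have "u x0 = 0" using closure_cases[OF x0(1)] u_frontier by blast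
    moreover have "(norm (x0 - z))\<^sup>2 \<le> R\<^sup>2" using z(3)[OF x0(1)] by (intro power_mono) auto
    then have "(e / 2) * (norm (x0 - z))\<^sup>2 \<le> (e / 2) * R\<^sup>2" using e by (intro mult_left_mono) auto
    ultimately show False using fx0 e neg by (simp add: f_def)
  qed
  define p where "p = e *\<^sub>R (x0 - z)"
  have p: "p \<noteq> 0" using e z x0U by (auto simp: p_def)
  have "\<forall>\<^sub>F y in nhds x0. y \<in> U" by (rule eventually_nhds_in_open[OF open_U x0U])
  then have jet: "\<forall>\<^sub>F y in nhds x0. quad x0 (u x0) p (\<lambda>h. e *\<^sub>R h) y \<le> u y"
  proof eventually_elim
    fix y assume "y \<in> U"
    then have "f x0 \<le> f y" using x0(2) closure_subset by blast
    then have "u x0 + (e / 2) * ((norm (y - z))\<^sup>2 - (norm (x0 - z))\<^sup>2) \<le> u y"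
      by (simp add: f_def right_diff_distrib)
    moreover have "quad x0 (u x0) p (\<lambda>h. e *\<^sub>R h) y = u x0 + (e / 2) * ((norm (y - z))\<^sup>2 - (norm (x0 - z))\<^sup>2)"
      by (subst norm_square_shift[of y z x0]) (simp add: quad_def p_def power2_norm_eq_inner algebra_simps)
    ultimately show "quad x0 (u x0) p (\<lambda>h. e *\<^sub>R h) y \<le> u y" by simp
  qed
  have c: "0 < dual_norm \<phi> p / norm p" using dual_pos[OF p] p by simp
  show False
  proof (rule super_contra[OF x0U linear_scale jet])
    show "dual_norm \<phi> p < \<Lambda> * u x0 \<or> 0 < e * (dual_norm \<phi> p / norm p)\<^sup>2 \<and>
      (\<forall>q\<in>subdifferential (dual_norm \<phi>) p. e * (dual_norm \<phi> p / norm p)\<^sup>2 \<le> (e *\<^sub>R q) \<bullet> q)"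
    proof (intro disjI2 conjI ballI)
      show "0 < e * (dual_norm \<phi> p / norm p)\<^sup>2" using e c by (intro mult_pos_pos zero_less_power)
      fix q assume "q \<in> subdifferential (dual_norm \<phi>) p"
      then have "(dual_norm \<phi> p / norm p)\<^sup>2 \<le> (norm q)\<^sup>2"
        using c subdifferential_norm_lower[OF p] by (intro power_mono) auto
      then have "e * (dual_norm \<phi> p / norm p)\<^sup>2 \<le> e * (norm q)\<^sup>2" using e by (intro mult_left_mono) auto
      then show "e * (dual_norm \<phi> p / norm p)\<^sup>2 \<le> (e *\<^sub>R q) \<bullet> q" by (simp add: power2_norm_eq_inner)
    qed
  qed
qed

lemma positive_point: obtains x where "x \<in> U" "0 < u x"
proof -
  obtain y where y: "y \<in> U" using U_ne by blast
  then have "connected_component_set U y \<in> components U" by (simp add: componentsI)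
  then obtain x where x: "x \<in> connected_component_set U y" "u x \<noteq> 0" using nontrivial by blast
  then have "x \<in> U" using connected_component_subset by blast
  then show ?thesis using that[of x] x u_nonneg[of x] closure_subset by force
qed

text \<open>If \<Lambda> \<le> 0, the first-order alternative fails at every nonzero gradient
  because \<open>u\<close> is nonnegative. A concave paraboloid touching from above then violates
  the remaining alternative, as in the minimum principle.\<close>

lemma Lambda_pos: "0 < \<Lambda>"
proof (rule ccontr)
  assume neg: "\<not> 0 < \<Lambda>"
  obtain x where x: "x \<in> U" "0 < u x" by (rule positive_point)
  obtain z R where z: "z \<notin> U" "0 < R" "\<And>x. x \<in> closure U \<Longrightarrow> norm (x - z) \<le> R" using outer_point by blast
  define e where "e = u x / R\<^sup>2"
  have e: "0 < e" "e * R\<^sup>2 = u x" using x z by (auto simp: e_def)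
  define f where "f y = u y + (e / 2) * (norm (y - z))\<^sup>2" for y
  have "continuous_on (closure U) f" unfolding f_def by (intro continuous_intros u_cont)
  then obtain x0 where x0: "x0 \<in> closure U" "\<And>y. y \<in> closure U \<Longrightarrow> f y \<le> f x0"
    using continuous_attains_sup[OF closure_compact closure_ne] by blast
  have "u x \<le> f x" using e by (simp add: f_def)
  then have fx0: "u x \<le> f x0" using x0(2)[of x] x closure_subset[of U] by force
  have x0U: "x0 \<in> U"
  proof (rule ccontr)
    assume "x0 \<notin> U"
    then have "u x0 = 0" using closure_cases[OF x0(1)] u_frontier by blast
    moreover have "(norm (x0 - z))\<^sup>2 \<le> R\<^sup>2" using z(3)[OF x0(1)] by (intro power_mono) auto
    then have "(e / 2) * (norm (x0 - z))\<^sup>2 \<le> (e / 2) * R\<^sup>2" using e by (intro mult_left_mono) auto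
    ultimately show False using fx0 e x by (simp add: f_def)
  qed
  define p where "p = (- e) *\<^sub>R (x0 - z)"
  have p: "p \<noteq> 0" using e z x0U by (auto simp: p_def)
  have "\<forall>\<^sub>F y in nhds x0. y \<in> U" by (rule eventually_nhds_in_open[OF open_U x0U])
  then have jet: "\<forall>\<^sub>F y in nhds x0. u y \<le> quad x0 (u x0) p (\<lambda>h. (- e) *\<^sub>R h) y"
  proof eventually_elim
    fix y assume "y \<in> U"
    then have "f y \<le> f x0" using x0(2) closure_subset by blast
    then have "u y \<le> u x0 - (e / 2) * ((norm (y - z))\<^sup>2 - (norm (x0 - z))\<^sup>2)"
      by (simp add: f_def right_diff_distrib)
    moreover have "quad x0 (u x0) p (\<lambda>h. (- e) *\<^sub>R h) y = u x0 - (e / 2) * ((norm (y - z))\<^sup>2 - (norm (x0 - z))\<^sup>2)"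
      by (subst norm_square_shift[of y z x0]) (simp add: quad_def p_def power2_norm_eq_inner algebra_simps)
    ultimately show "u y \<le> quad x0 (u x0) p (\<lambda>h. (- e) *\<^sub>R h) y" by simp
  qed
  have c: "0 < dual_norm \<phi> p / norm p" using dual_pos[OF p] p by simp
  show False
  proof (rule sub_contra[OF x0U linear_scale jet])
    have "\<Lambda> * u x0 \<le> 0" using neg u_nonneg[OF x0(1)] by (intro mult_nonpos_nonneg) auto
    then show "\<Lambda> * u x0 < dual_norm \<phi> p" using dual_pos[OF p] by simp
    show "0 < e * (dual_norm \<phi> p / norm p)\<^sup>2" using e c by (intro mult_pos_pos zero_less_power)
    fix q assume "q \<in> subdifferential (dual_norm \<phi>) p"
    then have "(dual_norm \<phi> p / norm p)\<^sup>2 \<le> (norm q)\<^sup>2"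
      using c subdifferential_norm_lower[OF p] by (intro power_mono) auto
    then have "e * (dual_norm \<phi> p / norm p)\<^sup>2 \<le> e * (norm q)\<^sup>2" using e by (intro mult_left_mono) auto
    then show "((- e) *\<^sub>R q) \<bullet> q \<le> - (e * (dual_norm \<phi> p / norm p)\<^sup>2)" by (simp add: power2_norm_eq_inner)
  qed
qed

text \<open>Extending by zero makes the Lipschitz estimate global, so that difference quotients
  across the boundary of \<open>U\<close> need no regularity of that boundary.\<close>

definition "u0 x = (if x \<in> U then u x else 0)"

lemma u0_nonneg: "0 \<le> u0 x"
  using u_nonneg closure_subset by (force simp: u0_def)

lemma u0_closure: "x \<in> closure U \<Longrightarrow> u0 x = u x"
  using closure_cases u_frontier by (auto simp: u0_def)

text \<open>Where the test slope exceeds \<open>\<Lambda> * M\<close>, the first alternative of the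
  subsolution inequality is excluded and only the second-order one is left; this is the situation
  covered by \<open>cone_comparison\<close> with \<open>\<kappa> = \<Lambda> * M\<close>.\<close>

lemma u_lipschitz:
  assumes M: "\<And>x. x \<in> U \<Longrightarrow> u x \<le> M"
  shows "u0 x \<le> u0 y + \<Lambda> * M * \<phi> (x - y)"
proof -
  have M0: "0 \<le> \<Lambda> * M"
  proof -
    obtain x where "x \<in> U" "0 < u x" by (rule positive_point)
    then show ?thesis using M[of x] Lambda_pos by simp
  qed
  show ?thesis
  proof (cases "x \<in> U \<and> x \<noteq> y")
    case False
    then show ?thesis using u0_nonneg[of y] M0 by (auto simp: u0_def)
  next
    case True
    have "u x - u0 y \<le> \<Lambda> * M * \<phi> (x - y)"
    proof (rule le_mult_limit)
      fix K assume K: "\<Lambda> * M < K"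
      \<comment> \<open>Removing the tip makes it a boundary point, where the cone equals
        \<open>u\<close> by construction.\<close>
      define D where "D = U - {y}"
      have Dsub: "closure D \<subseteq> closure U" unfolding D_def by (intro closure_mono) auto
      have "u x \<le> u0 y + K * \<phi> (x - y)"
      proof (rule cone_comparison[where D=D and \<kappa>="\<Lambda> * M"])
        show openD: "open D" unfolding D_def by (intro open_delete open_U)
        show "bounded D" using bounded_U by (auto simp: D_def intro: bounded_subset)
        show "continuous_on (closure D) u" by (rule continuous_on_subset[OF u_cont Dsub])
        show "0 \<le> \<Lambda> * M" "\<Lambda> * M < K" by (rule M0 K)+
        show "y \<notin> D" "x \<in> D" using True by (auto simp: D_def)
        show "u x' \<le> u0 y + K * \<phi> (x' - y)" if "x' \<in> frontier D" for x'
        proof -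
          have x': "x' \<in> closure U" "x' \<notin> D" using that Dsub openD by (auto simp: frontier_def interior_open)
          show ?thesis
          proof (cases "x' = y")
            case True
            then show ?thesis using u0_closure[OF x'(1)] by simp
          next
            case False
            then have "u x' = 0" using x' closure_cases u_frontier by (auto simp: D_def)
            then show ?thesis using u0_nonneg[of y] M0 K by simp
          qed
        qed
        fix x0 p A c
        assume *: "x0 \<in> D" "linear A" "\<forall>\<^sub>F x in nhds x0. u x \<le> quad x0 (u x0) p A x"
          "\<Lambda> * M < dual_norm \<phi> p" "0 < c" "\<forall>q\<in>subdifferential (dual_norm \<phi>) p. A q \<bullet> q \<le> - c"
        show False
        proof (rule sub_contra[OF _ *(2,3) _ *(5)])
          show "x0 \<in> U" using * by (simp add: D_def)
          then have "\<Lambda> * u x0 \<le> \<Lambda> * M" using M Lambda_pos by simp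
          then show "\<Lambda> * u x0 < dual_norm \<phi> p" using *(4) by simp
        qed (use *(6) in auto)
      qed
      then show "u x - u0 y \<le> K * \<phi> (x - y)" by simp
    qed simp
    then show ?thesis using True by (simp add: u0_def)
  qed
qed

text \<open>The function \<open>u z - K * \<phi> (z - x)\<close> is a lower barrier on a punctured
  backward ball. It agrees with \<open>u\<close> at the centre and is at most zero on the boundary
  sphere as soon as \<open>K\<close> times the radius reaches \<open>u z\<close>. After reflection
  this is cone comparison with threshold 0.\<close>

lemma harnack:
  assumes s: "0 < s" "{x. \<phi> (z - x) < s} \<subseteq> U" and x: "\<phi> (z - x) < s"
  shows "u z * (1 - \<phi> (z - x) / s) \<le> u x"
proof (cases "x = z")
  case False
  have zU: "z \<in> U" using s by auto
  have uz: "0 \<le> u z" using zU u_nonneg closure_subset by blast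
  have "u z - u x \<le> (u z / s) * \<phi> (z - x)"
  proof (rule le_mult_limit)
    fix K assume K: "u z / s < K"
    moreover have "0 \<le> u z / s" using uz s(1) by simp
    ultimately have K0: "0 < K" by linarith
    have uzK: "u z / K < s" using K K0 s(1) by (simp add: field_simps)
    define m where "m = max (\<phi> (z - x)) (u z / K)"
    have m: "\<phi> (z - x) \<le> m" "u z / K \<le> m" "m < s" using x uzK by (auto simp: m_def)
    \<comment> \<open>Below \<open>s\<close>, so that the closed backward ball lies in
      \<open>U\<close>; above \<open>u z / K\<close>, so that the barrier is nonpositive on its
      boundary; and large enough to contain \<open>x\<close>.\<close>
    define s' where "s' = (m + s) / 2"
    have s': "\<phi> (z - x) < s'" "u z / K < s'" "s' < s" "0 < s'"
    proof -
      show 1: "\<phi> (z - x) < s'" and "s' < s" using m by (simp_all add: s'_def)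
      have "m < s'" using m by (simp add: s'_def)
      then show "u z / K < s'" using m(2) by (rule le_less_trans[rotated])
      show "0 < s'" using 1 phi_nonneg[of "z - x"] by linarith
    qed
    define D where "D = {\<xi>. \<phi> \<xi> < s'} - {0}"
    define v where "v \<xi> = - u (z - \<xi>)" for \<xi>
    have "closure D \<subseteq> {\<xi>. \<phi> \<xi> \<le> s'}"
      by (rule closure_minimal) (auto simp: D_def compact_imp_closed[OF phi_ball_compact])
    then have cl: "\<phi> \<xi> \<le> s'" "z - \<xi> \<in> U" if "\<xi> \<in> closure D" for \<xi>
      using that s(2) s'(3) by (auto simp: subset_iff)
    have "v (z - x) \<le> - u z + K * \<phi> ((z - x) - 0)"
    proof (rule cone_comparison[where D=D and \<kappa>=0])
      show openD: "open D" unfolding D_def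
        by (intro open_delete open_Collect_less phi_continuous_on continuous_intros)
      show "bounded D" by (rule bounded_subset[OF compact_imp_bounded[OF phi_ball_compact[of s']]]) (auto simp: D_def)
      show "continuous_on (closure D) v" unfolding v_def
        by (intro continuous_intros continuous_on_compose2[OF u_cont]) (use cl closure_subset in auto)
      show "(0::real) \<le> 0" "0 < K" "0 \<notin> D" "z - x \<in> D" using K0 s' False by (auto simp: D_def)
      show "v \<xi> \<le> - u z + K * \<phi> (\<xi> - 0)" if "\<xi> \<in> frontier D" for \<xi>
      proof -
        have \<xi>: "\<xi> \<in> closure D" "\<xi> \<notin> D" using that openD by (auto simp: frontier_def interior_open)
        show ?thesis
        proof (cases "\<xi> = 0")
          case False
          then have "\<phi> \<xi> = s'" using \<xi> cl(1)[OF \<xi>(1)] by (auto simp: D_def)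
          moreover have "u z \<le> K * s'" using s'(2) K0 by (simp add: field_simps)
          moreover have "0 \<le> u (z - \<xi>)" using cl(2)[OF \<xi>(1)] u_nonneg closure_subset by blast
          ultimately show ?thesis by (simp add: v_def)
        qed (simp add: v_def)
      qed
      fix x0 p A c
      assume *: "x0 \<in> D" "linear A" "\<forall>\<^sub>F x in nhds x0. v x \<le> quad x0 (v x0) p A x"
        "0 < dual_norm \<phi> p" "0 < c" "\<forall>q\<in>subdifferential (dual_norm \<phi>) p. A q \<bullet> q \<le> - c"
      define y0 where "y0 = z - x0"
      have "\<forall>\<^sub>F y in nhds y0. v (z - y) \<le> quad x0 (v x0) p A (z - y)"
        using *(3) by (intro eventually_nhds_reflect) (simp add: y0_def)
      then have jet: "\<forall>\<^sub>F y in nhds y0. quad y0 (u y0) p (\<lambda>h. - A h) y \<le> u y"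
      proof eventually_elim
        fix y assume a: "v (z - y) \<le> quad x0 (v x0) p A (z - y)"
        have "x0 = z - y0" by (simp add: y0_def)
        with a show "quad y0 (u y0) p (\<lambda>h. - A h) y \<le> u y"
          unfolding quad_reflect[OF *(2), of z y0 "u y0" p y, symmetric] by (simp add: v_def)
      qed
      show False
      proof (rule super_contra[OF _ _ jet])
        show "y0 \<in> U" using *(1) closure_subset cl(2) by (auto simp: y0_def)
        show "linear (\<lambda>h. - A h)" using *(2) by (rule linear_compose_neg)
        show "dual_norm \<phi> p < \<Lambda> * u y0 \<or> 0 < c \<and> (\<forall>q\<in>subdifferential (dual_norm \<phi>) p. c \<le> - A q \<bullet> q)"
          using *(5,6) by force
      qed
    qed
    then show "u z - u x \<le> K * \<phi> (z - x)" by (simp add: v_def)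
  qed simp
  then show ?thesis by (simp add: right_diff_distrib)
qed simp

text \<open>The Harnack inequality shows that the zero set of \<open>u\<close> is open in \<open>U\<close>.\<close>

lemma u_pos: assumes "x \<in> U" shows "0 < u x"
proof -
  obtain c d where cd: "0 < c" "0 < d" "\<And>x. c * norm x \<le> \<phi> x" "\<And>x. \<phi> x \<le> d * norm x"
    using phi_bounds by blast
  define P Q where "P = {y \<in> U. 0 < u y}" and "Q = {y \<in> U. u y \<le> 0}"
  have ucU: "continuous_on U u" using u_cont closure_subset by (rule continuous_on_subset)
  have "open P"
    using continuous_open_preimage[OF ucU open_U, of "{0<..}"] by (simp add: P_def vimage_def Int_def)
  moreover have "open Q"
    unfolding open_contains_ball
  proof
    fix y assume y: "y \<in> Q"
    then obtain r where r: "0 < r" "ball y r \<subseteq> U" using open_U unfolding open_contains_ball Q_def by blast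
    \<comment> \<open>For centres \<open>y'\<close> this close to \<open>y\<close>, the backward
      ball of radius \<open>c * r / 2\<close> around \<open>y'\<close> lies in \<open>U\<close> and
      contains \<open>y\<close>. Harnack then carries positivity from \<open>y'\<close> to
      \<open>y\<close>.\<close>
    define t where "t = min (r / 2) (c * r / (2 * d))"
    have t: "0 < t" "t \<le> r / 2" "d * t \<le> c * r / 2"
    proof -
      show "0 < t" "t \<le> r / 2" using r cd by (auto simp: t_def)
      have "t \<le> c * r / (2 * d)" by (simp add: t_def)
      then show "d * t \<le> c * r / 2" using cd by (simp add: field_simps)
    qed
    have "y' \<in> Q" if y': "y' \<in> ball y t" for y'
    proof -
      have dy: "dist y y' < t" using y' by simp
      have y'U: "y' \<in> U" using r dy t by (auto intro!: subsetD[OF r(2)])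
      have sub: "{x. \<phi> (y' - x) < c * r / 2} \<subseteq> U"
      proof
        fix x assume "x \<in> {x. \<phi> (y' - x) < c * r / 2}"
        then have "c * norm (y' - x) < c * (r / 2)" using cd(3)[of "y' - x"] by simp
        then have "dist y' x < r / 2" using cd(1) by (simp add: dist_norm)
        then have "dist y x < r" using dy t(2) dist_triangle[of y x y'] by linarith
        then show "x \<in> U" using r by auto
      qed
      have "\<phi> (y' - y) \<le> d * norm (y' - y)" by (rule cd)
      also have "\<dots> < d * t" using dy cd by (simp add: dist_norm norm_minus_commute)
      finally have near: "\<phi> (y' - y) < c * r / 2" using t by simp
      have "u y' \<le> 0"
      proof (rule ccontr)
        assume "\<not> u y' \<le> 0"
        moreover have "0 < c * r / 2" using cd r by simp
        moreover have "0 < 1 - \<phi> (y' - y) / (c * r / 2)"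
          using near \<open>0 < c * r / 2\<close> by (simp only: less_diff_eq add_0 divide_less_eq_1_pos)
        ultimately have "0 < u y' * (1 - \<phi> (y' - y) / (c * r / 2))" by (intro mult_pos_pos) auto
        also have "\<dots> \<le> u y" by (rule harnack[OF \<open>0 < c * r / 2\<close> sub near])
        finally show False using y by (simp add: Q_def)
      qed
      then show ?thesis using y'U by (simp add: Q_def)
    qed
    then show "\<exists>e>0. ball y e \<subseteq> Q" using t(1) by blast
  qed
  moreover define C where "C = connected_component_set U x"
  have "C \<in> components U" using assms by (simp add: C_def componentsI)
  then obtain y where y: "y \<in> C" "u y \<noteq> 0" using nontrivial by blast
  have CU: "C \<subseteq> U" unfolding C_def by (rule connected_component_subset)
  then have yU: "y \<in> U" using y by blast
  have "y \<in> P" using y(2) yU u_nonneg[OF subsetD[OF closure_subset yU]] by (simp add: P_def)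
  moreover have "connected C" by (simp add: C_def)
  moreover have "C \<subseteq> P \<union> Q" "P \<inter> Q \<inter> C = {}" using CU by (auto simp: P_def Q_def)
  ultimately have "Q \<inter> C = {}" using connectedD[of C P Q] y by blast
  moreover have "x \<in> C" using assms by (simp add: C_def)
  ultimately show ?thesis using assms by (auto simp: Q_def not_le)
qed

text \<open>Otherwise \<open>u\<close> could be touched from below, near the centre of the ball, by a reversed cone of slope \<open>K\<close>
  slightly above \<open>u x1 / s\<close>, although the gradient constraint forces slopes of at least \<open>\<Lambda> u\<close>.\<close>

lemma inradius_bound:
  assumes s: "0 < s" "{x. \<phi> (x1 - x) < s} \<subseteq> U"
  shows "\<Lambda> * s \<le> 1"
proof (rule ccontr)
  assume "\<not> \<Lambda> * s \<le> 1"
  then have big: "1 < \<Lambda> * s" by simp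
  have x1U: "x1 \<in> U" using s by auto
  define m where "m = u x1"
  have m: "0 < m" unfolding m_def by (rule u_pos[OF x1U])
  \<comment> \<open>Half of the gap between \<open>s\<close> and \<open>1 / \<Lambda>\<close>, so
    that the reduced radius \<open>s - r\<close> still exceeds \<open>1 / \<Lambda>\<close>.\<close>
  define r where "r = (s - 1 / \<Lambda>) / 2"
  have r: "0 < r" "r < s" "1 < \<Lambda> * (s - r)"
  proof -
    have "1 / \<Lambda> < s" using big Lambda_pos by (auto simp: field_simps)
    then show "0 < r" by (simp add: r_def)
    have "- (1 / \<Lambda>) < s" by (rule less_trans[OF _ s(1)]) (simp add: Lambda_pos)
    then show "r < s" by (simp add: r_def)
    have "\<Lambda> * (s - r) = \<Lambda> * ((s + 1 / \<Lambda>) / 2)" by (simp add: r_def field_simps)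
    also have "\<dots> = (\<Lambda> * s + 1) / 2" using Lambda_pos by (simp add: field_simps)
    finally show "1 < \<Lambda> * (s - r)" using big by simp
  qed
  \<comment> \<open>Harnack's lower bound for \<open>\<Lambda> * u\<close> on the backward ball of
    radius \<open>r\<close>. It exceeds \<open>m / s\<close> exactly because
    \<open>1 < \<Lambda> * (s - r)\<close>, which leaves room for the cone slope
    \<open>K\<close>.\<close>
  define \<kappa> where "\<kappa> = \<Lambda> * (m * (1 - r / s))"
  have "m / s < \<kappa>"
  proof -
    have "m / s * 1 < m / s * (\<Lambda> * (s - r))" using r(3) m s by (intro mult_strict_left_mono) auto
    also have "\<dots> = \<kappa>" using s by (simp add: \<kappa>_def field_simps)
    finally show ?thesis by simp
  qed
  then obtain K where K: "m / s < K" "K < \<kappa>" using dense by blast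
  have "0 < m / s" using m s by simp
  then have K0: "0 < K" using K by linarith
  \<comment> \<open>The first entry keeps the gradient of the smoothed cone, at most
    \<open>K + \<theta>\<close>, below \<open>\<kappa>\<close>; the second keeps the minimum of
    \<open>f\<close> off the sphere of radius \<open>r\<close>.\<close>
  have "0 < min (\<kappa> - K) (r * (K - m / s) / 2)" using K r by simp
  then obtain \<theta> where "0 < \<theta>" "\<theta> < min (\<kappa> - K) (r * (K - m / s) / 2)" using dense by blast
  then have \<theta>: "0 < \<theta>" "\<theta> < \<kappa> - K" "\<theta> < r * (K - m / s) / 2" by auto
  obtain W where W: "\<And>x. \<phi> x \<le> r \<Longrightarrow> \<bar>W x - K * \<phi> x\<bar> \<le> \<theta>"
    "continuous_on {x. \<phi> x \<le> r} W"
    "\<And>x0. \<phi> x0 \<le> r \<Longrightarrow> \<exists>p A. linear A \<and>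
      (\<forall>\<^sub>F x in nhds x0. W x \<le> W x0 + p \<bullet> (x - x0) + (1/2) * (A (x - x0) \<bullet> (x - x0))) \<and>
      dual_norm \<phi> p \<le> K + \<theta> \<and>
      (1 \<le> \<phi> x0 \<longrightarrow> K \<le> dual_norm \<phi> p \<and> (\<forall>q\<in>subdifferential (dual_norm \<phi>) p. A q \<bullet> q \<le> 1))"
    by (rule smooth_cone[OF K0 less_imp_le[OF r(1)] zero_less_one \<theta>(1) zero_less_one]) blast
  define f where "f \<xi> = u (x1 - \<xi>) + W \<xi>" for \<xi>
  have inU: "x1 - \<xi> \<in> U" if "\<phi> \<xi> \<le> r" for \<xi> using that s(2) r(2) by auto
  have low: "m * (1 - r / s) \<le> u (x1 - \<xi>)" if "\<phi> \<xi> \<le> r" for \<xi>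
  proof -
    have "m * (1 - r / s) \<le> m * (1 - \<phi> \<xi> / s)"
      using that m s by (intro mult_left_mono diff_left_mono divide_right_mono) auto
    also have "\<dots> \<le> u (x1 - \<xi>)" using harnack[OF s, of "x1 - \<xi>"] that r(2) by (simp add: m_def)
    finally show ?thesis .
  qed
  have "continuous_on {\<xi>. \<phi> \<xi> \<le> r} f"
    unfolding f_def using inU closure_subset
    by (intro continuous_intros W continuous_on_compose2[OF u_cont]) auto
  moreover have "0 \<in> {\<xi>. \<phi> \<xi> \<le> r}" using r by simp
  ultimately obtain \<xi>0 where \<xi>0: "\<phi> \<xi>0 \<le> r" "\<And>\<xi>. \<phi> \<xi> \<le> r \<Longrightarrow> f \<xi>0 \<le> f \<xi>"
    using continuous_attains_inf[OF phi_ball_compact, of r f] by blast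
  \<comment> \<open>On the sphere the cone has risen by about \<open>K * r\<close>, whereas Harnack
    lets \<open>u\<close> fall by at most \<open>(m / s) * r\<close>, which is less.\<close>
  have int: "\<phi> \<xi>0 < r"
  proof (rule ccontr)
    assume "\<not> \<phi> \<xi>0 < r"
    then have eq: "\<phi> \<xi>0 = r" using \<xi>0 by simp
    have "m * (1 - r / s) + (K * r - \<theta>) \<le> f \<xi>0"
      using low[OF \<xi>0(1)] W(1)[OF \<xi>0(1)] eq unfolding f_def by (simp add: abs_le_iff)
    also have "f \<xi>0 \<le> f 0" using \<xi>0(2)[of 0] r by simp
    also have "f 0 \<le> m + \<theta>" using W(1)[of 0] r by (simp add: f_def m_def)
    finally have "r * (K - m / s) \<le> 2 * \<theta>" by (simp add: algebra_simps)
    then have "r * (K - m / s) / 2 \<le> \<theta>" by simp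
    then show False using \<theta>(3) by simp
  qed
  obtain p A where pA: "linear A"
      "\<forall>\<^sub>F x in nhds \<xi>0. W x \<le> W \<xi>0 + p \<bullet> (x - \<xi>0) + (1/2) * (A (x - \<xi>0) \<bullet> (x - \<xi>0))"
      "dual_norm \<phi> p \<le> K + \<theta>"
    using W(3)[OF \<xi>0(1)] by blast
  define y0 where "y0 = x1 - \<xi>0"
  have y0U: "y0 \<in> U" unfolding y0_def by (rule inU[OF \<xi>0(1)])
  have "open {\<xi>. \<phi> \<xi> < r}" by (intro open_Collect_less phi_continuous_on continuous_intros)
  then have "\<forall>\<^sub>F x in nhds \<xi>0. x \<in> {\<xi>. \<phi> \<xi> < r}" using int by (intro eventually_nhds_in_open) auto
  with pA(2) have "\<forall>\<^sub>F x in nhds \<xi>0. - quad \<xi>0 (- u y0) p A x \<le> u (x1 - x)"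
  proof eventually_elim
    fix x assume a: "W x \<le> W \<xi>0 + p \<bullet> (x - \<xi>0) + (1/2) * (A (x - \<xi>0) \<bullet> (x - \<xi>0))" "x \<in> {\<xi>. \<phi> \<xi> < r}"
    have "f \<xi>0 \<le> f x" using a by (intro \<xi>0(2)) auto
    then show "- quad \<xi>0 (- u y0) p A x \<le> u (x1 - x)"
      using a(1) by (simp add: f_def y0_def quad_def)
  qed
  then have "\<forall>\<^sub>F y in nhds y0. - quad \<xi>0 (- u y0) p A (x1 - y) \<le> u (x1 - (x1 - y))"
    by (intro eventually_nhds_reflect) (simp add: y0_def)
  moreover have "\<xi>0 = x1 - y0" by (simp add: y0_def)
  ultimately have jet: "\<forall>\<^sub>F y in nhds y0. quad y0 (u y0) p (\<lambda>h. - A h) y \<le> u y"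
    by (simp add: quad_reflect[OF pA(1)])
  show False
  proof (rule super_contra[OF y0U linear_compose_neg[OF pA(1)] jet])
    have "\<kappa> \<le> \<Lambda> * u y0" using low[OF \<xi>0(1)] Lambda_pos by (simp add: \<kappa>_def y0_def)
    then have "dual_norm \<phi> p < \<Lambda> * u y0" using pA(3) \<theta>(2) by simp
    then show "dual_norm \<phi> p < \<Lambda> * u y0 \<or> (0::real) < 1 \<and> (\<forall>q\<in>subdifferential (dual_norm \<phi>) p. 1 \<le> - A q \<bullet> q)" ..
  qed
qed

end

subsection \<open>Smooth bump functions\<close>

lemma tendsto_poly_exp_0: "((\<lambda>s. s ^ k * poly p s / exp s) \<longlongrightarrow> (0::real)) at_top"
proof (induction p arbitrary: k)
  case (pCons a p)
  have "((\<lambda>s. a * (s ^ k / exp s) + s ^ Suc k * poly p s / exp s) \<longlongrightarrow> a * 0 + 0) at_top"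
    by (intro tendsto_intros tendsto_power_div_exp_0 pCons)
  then show ?case by (simp add: add_divide_distrib distrib_left mult_ac)
qed simp

text \<open>The polynomial parameter makes the family closed under differentiation, so smoothness at
  0 follows from a single derivative computation.\<close>

definition exp_inv :: "real poly \<Rightarrow> real \<Rightarrow> real" where
  "exp_inv p t = (if 0 < t then poly p (1 / t) * exp (- (1 / t)) else 0)"

text \<open>With s = 1/t, the chain rule for p(s) exp(-s) yields s^2 (p(s) - p'(s)) exp(-s).\<close>

definition exp_inv_deriv :: "real poly \<Rightarrow> real poly" where
  "exp_inv_deriv p = [:0, 0, 1:] * (p - pderiv p)"

lemma exp_inv_has_derivative:
  "(exp_inv p has_real_derivative exp_inv (exp_inv_deriv p) t) (at t)"
proof -
  consider "0 < t" | "t < 0" | "t = 0" by linarith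
  then show ?thesis
  proof cases
    case 1
    have "((\<lambda>t. poly p (1 / t) * exp (- (1 / t))) has_real_derivative exp_inv (exp_inv_deriv p) t) (at t)"
      using 1 by (auto intro!: derivative_eq_intros
          simp: exp_inv_def exp_inv_deriv_def field_simps power2_eq_square)
    moreover have "\<forall>\<^sub>F s in nhds t. exp_inv p s = poly p (1 / s) * exp (- (1 / s))"
      using eventually_nhds_in_open[of "{0<..}" t] 1
      by (auto simp: exp_inv_def elim!: eventually_mono)
    ultimately show ?thesis by (subst DERIV_cong_ev) auto
  next
    case 2
    have "\<forall>\<^sub>F s in nhds t. exp_inv p s = 0"
      using eventually_nhds_in_open[of "{..<0}" t] 2
      by (auto simp: exp_inv_def elim!: eventually_mono)
    then have "(exp_inv p has_real_derivative 0) (at t)" by (subst DERIV_cong_ev) auto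
    then show ?thesis using 2 by (simp add: exp_inv_def)
  next
    case 3
    have "((\<lambda>s. s ^ 1 * poly p s / exp s) \<longlongrightarrow> (0::real)) at_top" by (rule tendsto_poly_exp_0)
    then have "((\<lambda>h. (inverse h) ^ 1 * poly p (inverse h) / exp (inverse h)) \<longlongrightarrow> (0::real)) (at_right 0)"
      by (rule filterlim_compose) (rule filterlim_inverse_at_top_right)
    moreover have "\<forall>\<^sub>F h in at_right 0. (inverse h) ^ 1 * poly p (inverse h) / exp (inverse h) = exp_inv p h / h"
      unfolding eventually_at_right_field
      by (intro exI[of _ 1]) (auto simp: exp_inv_def exp_minus field_simps)
    ultimately have "((\<lambda>h. exp_inv p h / h) \<longlongrightarrow> 0) (at_right 0)"
      by (rule Lim_transform_eventually)
    moreover have "((\<lambda>h. exp_inv p h / h) \<longlongrightarrow> 0) (at_left 0)"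
      by (rule Lim_transform_eventually[of "\<lambda>_. 0"])
         (auto simp: eventually_at_left_field exp_inv_def intro!: exI[of _ "-1"])
    ultimately have "((\<lambda>h. exp_inv p h / h) \<longlongrightarrow> 0) (at 0)"
      by (simp add: filterlim_split_at)
    then show ?thesis using 3 by (simp add: DERIV_def exp_inv_def)
  qed
qed

lemma partial_deriv_eq: "(f has_derivative f') (at x) \<Longrightarrow> partial_deriv i f x = f' (axis i 1)"
  unfolding partial_deriv_def using frechet_derivative_at by metis

lemma Ck_Suc_UNIV:
  "Ck_on (Suc k) f UNIV \<longleftrightarrow> (\<forall>x. f differentiable (at x)) \<and> (\<forall>i. Ck_on k (partial_deriv i f) UNIV)"
  by (simp add: differentiable_on_def)

lemma Ck_continuous: "Ck_on k f UNIV \<Longrightarrow> continuous_on UNIV f"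
  by (cases k) (auto intro: differentiable_imp_continuous_on)

lemma Ck_Suc_imp: "Ck_on (Suc k) f UNIV \<Longrightarrow> Ck_on k f UNIV"
proof (induction k arbitrary: f)
  case 0
  then show ?case by (auto intro: differentiable_imp_continuous_on)
next
  case (Suc k)
  then show ?case by (meson Ck_Suc_UNIV)
qed

lemma Ck_const: "Ck_on k (\<lambda>_. c) UNIV"
proof (induction k arbitrary: c)
  case (Suc k)
  have "partial_deriv i (\<lambda>_. c) = (\<lambda>_. 0)" for i :: 'a
    by (rule ext, subst partial_deriv_eq[where f'="\<lambda>_. 0"]) auto
  then show ?case using Suc by (simp add: Ck_Suc_UNIV)
qed simp

lemma Ck_add: "Ck_on k f UNIV \<Longrightarrow> Ck_on k g UNIV \<Longrightarrow> Ck_on k (\<lambda>x. f x + g x) UNIV"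
proof (induction k arbitrary: f g)
  case (Suc k)
  have "partial_deriv i (\<lambda>x. f x + g x) = (\<lambda>x. partial_deriv i f x + partial_deriv i g x)" for i
  proof
    fix x
    have "(f has_derivative frechet_derivative f (at x)) (at x)"
         "(g has_derivative frechet_derivative g (at x)) (at x)"
      using Suc.prems by (auto simp only: Ck_Suc_UNIV frechet_derivative_works[symmetric])
    then have "((\<lambda>x. f x + g x) has_derivative (\<lambda>h. frechet_derivative f (at x) h + frechet_derivative g (at x) h)) (at x)"
      by (rule has_derivative_add)
    from partial_deriv_eq[OF this]
    show "partial_deriv i (\<lambda>x. f x + g x) x = partial_deriv i f x + partial_deriv i g x"
      by (simp add: partial_deriv_def)
  qed
  then show ?case using Suc by (simp only: Ck_Suc_UNIV) (auto intro: differentiable_add)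
qed (auto intro: continuous_intros)

lemma partial_deriv_mult:
  assumes "f differentiable (at x)" "g differentiable (at x)"
  shows "partial_deriv i (\<lambda>x. f x * g x) x = f x * partial_deriv i g x + partial_deriv i f x * g x"
proof -
  have "(f has_derivative frechet_derivative f (at x)) (at x)"
       "(g has_derivative frechet_derivative g (at x)) (at x)"
    using assms by (auto simp only: frechet_derivative_works[symmetric])
  then have "((\<lambda>x. f x * g x) has_derivative (\<lambda>h. f x * frechet_derivative g (at x) h + frechet_derivative f (at x) h * g x)) (at x)"
    by (rule has_derivative_mult)
  from partial_deriv_eq[OF this] show ?thesis by (simp add: partial_deriv_def)
qed

lemma Ck_mult: "Ck_on k f UNIV \<Longrightarrow> Ck_on k g UNIV \<Longrightarrow> Ck_on k (\<lambda>x. f x * g x) UNIV"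
proof (induction k arbitrary: f g)
  case (Suc k)
  have "partial_deriv i (\<lambda>x. f x * g x) = (\<lambda>x. f x * partial_deriv i g x + partial_deriv i f x * g x)" for i
    using Suc.prems by (intro ext partial_deriv_mult) (auto simp only: Ck_Suc_UNIV)
  moreover have "Ck_on k (\<lambda>x. f x * partial_deriv i g x + partial_deriv i f x * g x) UNIV" for i
    using Suc.prems by (intro Ck_add Suc.IH Ck_Suc_imp[of k f] Ck_Suc_imp[of k g]) (auto simp only: Ck_Suc_UNIV)
  ultimately show ?case using Suc.prems by (simp only: Ck_Suc_UNIV) (auto intro: differentiable_mult)
qed (auto intro: continuous_intros)

text \<open>The outer function comes with the whole sequence of its derivatives, so the induction on
  \<open>k\<close> can shift \<open>n\<close> and needs only the product rule.\<close>

lemma Ck_compose: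
  assumes h: "\<And>n t. (h n has_real_derivative h (Suc n) t) (at t)" and q: "\<And>k. Ck_on k q UNIV"
  shows "Ck_on k (\<lambda>x. h n (q x)) UNIV"
proof (induction k arbitrary: n)
  case 0
  have "continuous_on UNIV (h n)"
    using h by (auto intro!: DERIV_continuous_on[of UNIV "h n" "h (Suc n)"])
  then show ?case using Ck_continuous[OF q] by (auto intro: continuous_on_compose2)
next
  case (Suc k)
  have qd: "q differentiable (at x)" for x using q[of 1] by (simp add: differentiable_on_def)
  have d: "((\<lambda>x. h n (q x)) has_derivative (\<lambda>v. h (Suc n) (q x) * frechet_derivative q (at x) v)) (at x)" for x
    using has_derivative_compose[OF qd[of x, unfolded frechet_derivative_works] h[of n "q x", unfolded has_field_derivative_def]]
    by simp
  have "partial_deriv i (\<lambda>x. h n (q x)) = (\<lambda>x. h (Suc n) (q x) * partial_deriv i q x)" for i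
    by (rule ext, subst partial_deriv_eq[OF d]) (simp add: partial_deriv_def)
  moreover have "Ck_on k (partial_deriv i q) UNIV" for i using q[of "Suc k"] by (simp only: Ck_Suc_UNIV)
  moreover have "(\<lambda>x. h n (q x)) differentiable (at x)" for x
    using d[of x] unfolding differentiable_def by blast
  ultimately show ?case using Suc by (simp only: Ck_Suc_UNIV) (auto intro!: Ck_mult)
qed

lemma smooth_add: "smooth_on f UNIV \<Longrightarrow> smooth_on g UNIV \<Longrightarrow> smooth_on (\<lambda>x. f x + g x) UNIV"
  and smooth_mult: "smooth_on f UNIV \<Longrightarrow> smooth_on g UNIV \<Longrightarrow> smooth_on (\<lambda>x. f x * g x) UNIV"
  and smooth_const: "smooth_on (\<lambda>_. c) UNIV"
  by (auto simp: smooth_on_def Ck_add Ck_mult Ck_const)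

lemma smooth_minus: "smooth_on f UNIV \<Longrightarrow> smooth_on (\<lambda>x. c - f x) UNIV"
  using smooth_add[OF smooth_const[of c] smooth_mult[OF smooth_const[of "-1"]], of f] by simp

lemma smooth_power: "smooth_on f UNIV \<Longrightarrow> smooth_on (\<lambda>x. f x ^ n) UNIV"
  by (induction n) (auto intro: smooth_const smooth_mult)

lemma smooth_prod: "finite I \<Longrightarrow> (\<And>i. i \<in> I \<Longrightarrow> smooth_on (f i) UNIV) \<Longrightarrow> smooth_on (\<lambda>x. \<Prod>i\<in>I. f i x) UNIV"
  by (induction I rule: finite_induct) (auto intro: smooth_const smooth_mult)

lemma smooth_differentiable: "smooth_on f UNIV \<Longrightarrow> f differentiable (at x)"
  unfolding smooth_on_def using Ck_Suc_UNIV[of 0 f, THEN iffD1] by blast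

lemma smooth_partial: "smooth_on f UNIV \<Longrightarrow> smooth_on (partial_deriv i f) UNIV"
  unfolding smooth_on_def using Ck_Suc_UNIV[of _ f, THEN iffD1] by blast

lemma smooth_continuous: "smooth_on f UNIV \<Longrightarrow> continuous_on UNIV f"
  unfolding smooth_on_def using Ck_continuous by blast

definition bump :: "real^'n \<Rightarrow> real \<Rightarrow> real^'n \<Rightarrow> real" where
  "bump z r x = exp_inv 1 (1 - (norm (x - z))\<^sup>2 / r\<^sup>2)"

lemma bump_nonneg: "0 \<le> bump z r x"
  by (simp add: bump_def exp_inv_def)

lemma bump_le_1: "bump z r x \<le> 1"
  by (simp add: bump_def exp_inv_def)

lemma bump_pos_iff: "0 < r \<Longrightarrow> 0 < bump z r x \<longleftrightarrow> norm (x - z) < r"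
  using abs_square_less_1[of "norm (x - z) / r"] by (simp add: bump_def exp_inv_def power_divide)

lemma bump_nonzero_iff: "0 < r \<Longrightarrow> bump z r x \<noteq> 0 \<longleftrightarrow> x \<in> ball z r"
  using bump_pos_iff[of r z x] bump_nonneg[of z r x] by (simp add: dist_norm norm_minus_commute less_le)

lemma smooth_bump: "smooth_on (bump z r) UNIV"
proof -
  define h where "h n = exp_inv ((exp_inv_deriv ^^ n) 1)" for n
  define q where "q = quad z 1 0 (\<lambda>v. (- 2 / r\<^sup>2) *\<^sub>R v)"
  have "linear (\<lambda>v::real^'n. (- 2 / r\<^sup>2) *\<^sub>R v)" by (simp add: linear_iff algebra_simps)
  then have q: "Ck_on k q UNIV" for k unfolding q_def by (rule Ck_on_quad)
  have h: "(h n has_real_derivative h (Suc n) t) (at t)" for n t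
    using exp_inv_has_derivative by (simp add: h_def)
  have "Ck_on k (\<lambda>x. h 0 (q x)) UNIV" for k by (rule Ck_compose[of h q, OF h q])
  moreover have "(\<lambda>x. h 0 (q x)) = bump z r"
    by (auto simp: h_def q_def bump_def quad_def power2_norm_eq_inner)
  ultimately show ?thesis by (simp add: smooth_on_def)
qed

lemma test_function_bump:
  assumes "0 < r" "cball z r \<subseteq> U"
  shows "test_function U (bump z r)"
proof -
  have "{x. bump z r x \<noteq> 0} = ball z r" using bump_nonzero_iff[OF assms(1)] by blast
  then show ?thesis using assms smooth_bump by (simp add: test_function_def)
qed

lemma test_function_vanishes: "test_function U \<psi> \<Longrightarrow> x \<notin> U \<Longrightarrow> \<psi> x = 0"
  unfolding test_function_def using closure_subset[of "{x. \<psi> x \<noteq> 0}"] by blast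

lemma test_function_smooth: "test_function U \<psi> \<Longrightarrow> smooth_on \<psi> UNIV"
  by (simp add: test_function_def)

lemma test_functionI:
  assumes "smooth_on \<psi> UNIV" "compact K" "K \<subseteq> U" "\<And>x. x \<notin> K \<Longrightarrow> \<psi> x = 0"
  shows "test_function U \<psi>"
proof -
  have "closure {x. \<psi> x \<noteq> 0} \<subseteq> K"
    using assms by (intro closure_minimal) (auto intro: compact_imp_closed)
  moreover from this have "closure {x. \<psi> x \<noteq> 0} = K \<inter> closure {x. \<psi> x \<noteq> 0}" by blast
  then have "compact (closure {x. \<psi> x \<noteq> 0})"
    using compact_Int_closed[OF assms(2) closed_closure] by metis
  ultimately show ?thesis using assms by (simp add: test_function_def)
qed

lemma test_functionE:
  assumes "test_function U \<psi>"
  obtains K where "compact K" "K \<subseteq> U" "\<And>x. x \<notin> K \<Longrightarrow> \<psi> x = 0"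
proof
  show "compact (closure {x. \<psi> x \<noteq> 0})" "closure {x. \<psi> x \<noteq> 0} \<subseteq> U"
    using assms by (auto simp: test_function_def)
  show "\<psi> x = 0" if "x \<notin> closure {x. \<psi> x \<noteq> 0}" for x
    using that closure_subset[of "{x. \<psi> x \<noteq> 0}"] by blast
qed

lemma test_function_add:
  assumes "test_function U \<psi>" "test_function U \<omega>"
  shows "test_function U (\<lambda>x. \<psi> x + \<omega> x)"
proof -
  obtain K where K: "compact K" "K \<subseteq> U" "\<And>x. x \<notin> K \<Longrightarrow> \<psi> x = 0" using test_functionE[OF assms(1)] by blast
  obtain L where L: "compact L" "L \<subseteq> U" "\<And>x. x \<notin> L \<Longrightarrow> \<omega> x = 0" using test_functionE[OF assms(2)] by blast
  show ?thesis
    by (rule test_functionI[of _ "K \<union> L"])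
       (use K L assms in \<open>auto intro: smooth_add test_function_smooth\<close>)
qed

lemma test_function_mult_left:
  assumes "smooth_on f UNIV" "test_function U \<psi>"
  shows "test_function U (\<lambda>x. f x * \<psi> x)"
proof -
  obtain K where K: "compact K" "K \<subseteq> U" "\<And>x. x \<notin> K \<Longrightarrow> \<psi> x = 0" using test_functionE[OF assms(2)] by blast
  show ?thesis
    by (rule test_functionI[of _ K]) (use K assms in \<open>auto intro: smooth_mult test_function_smooth\<close>)
qed

lemma test_function_partial:
  assumes "test_function U \<psi>"
  shows "test_function U (partial_deriv i \<psi>)"
proof -
  obtain K where K: "compact K" "K \<subseteq> U" "\<And>x. x \<notin> K \<Longrightarrow> \<psi> x = 0" using test_functionE[OF assms] by blast
  show ?thesis
  proof (rule test_functionI[of _ K])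
    show "smooth_on (partial_deriv i \<psi>) UNIV" using assms by (intro smooth_partial test_function_smooth)
    fix x assume x: "x \<notin> K"
    have "open (- K)" using K(1) by (simp add: compact_imp_closed open_Compl)
    then have "(\<psi> has_derivative (\<lambda>_. 0)) (at x)"
      by (rule has_derivative_transform_within_open[OF has_derivative_const]) (use x K in auto)
    from partial_deriv_eq[OF this] show "partial_deriv i \<psi> x = 0" by simp
  qed (use K in auto)
qed

lemma frechet_derivative_partial:
  assumes "f differentiable (at x)"
  shows "frechet_derivative f (at x) q = (\<Sum>i\<in>UNIV. q $ i * partial_deriv i f x)"
proof -
  have lin: "linear (frechet_derivative f (at x))"
    using assms by (rule linear_frechet_derivative)
  have "frechet_derivative f (at x) q = frechet_derivative f (at x) (\<Sum>i\<in>UNIV. q $ i *\<^sub>R axis i 1)"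
    using basis_expansion[of q] by (simp add: scalar_mult_eq_scaleR)
  then show ?thesis using lin by (simp add: linear_sum linear_cmul partial_deriv_def)
qed

section \<open>The fundamental lemma of the calculus of variations\<close>

lemma open_lebesgue [simp]: "open U \<Longrightarrow> U \<in> sets lebesgue"
  by (simp add: borel_open)

lemma integral_lebesgue_on_supported:
  fixes h :: "'a::euclidean_space \<Rightarrow> real"
  assumes "U \<in> sets lebesgue" "\<And>x. x \<notin> U \<Longrightarrow> h x = 0"
  shows "(LINT x|lebesgue_on U. h x) = (LINT x|lebesgue. h x)"
proof -
  have "(LINT x|lebesgue_on U. h x) = (LINT x|lebesgue. indicator U x *\<^sub>R h x)"
    using assms(1) by (intro integral_restrict_space) simp
  also have "(\<lambda>x. indicator U x *\<^sub>R h x) = h"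
    using assms(2) by (intro ext) (auto simp: indicator_def of_bool_def)
  finally show ?thesis .
qed

lemma continuous_measurable_lebesgue:
  fixes f :: "'a::euclidean_space \<Rightarrow> 'b::euclidean_space"
  assumes "continuous_on UNIV f" shows "f \<in> borel_measurable lebesgue"
  by (rule measurable_completion) (simp add: assms borel_measurable_continuous_onI)

text \<open>Inside the balls some factor is below 1 and its powers tend to 0; outside, all factors
  equal 1. This approximates the indicator of a finite union of balls by test functions without a
  partition of unity.\<close>

lemma cover_function:
  fixes Z :: "(real^'n) set"
  assumes Z: "finite Z" and r: "0 < r" and sub: "\<And>z. z \<in> Z \<Longrightarrow> cball z r \<subseteq> U"
  defines "\<psi> N x \<equiv> 1 - (\<Prod>z\<in>Z. (1 - bump z r x) ^ N)"
  shows "N \<noteq> 0 \<Longrightarrow> test_function U (\<psi> N)" "0 \<le> \<psi> N x" "\<psi> N x \<le> 1"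
    "N \<noteq> 0 \<Longrightarrow> x \<notin> (\<Union>z\<in>Z. ball z r) \<Longrightarrow> \<psi> N x = 0"
    "(\<lambda>N. \<psi> N x) \<longlonglongrightarrow> indicator (\<Union>z\<in>Z. ball z r) x"
proof -
  have f01: "0 \<le> 1 - bump z r x" "1 - bump z r x \<le> 1" for z x
    using bump_nonneg[of z r x] bump_le_1[of z r x] by auto
  have p01: "0 \<le> (1 - bump z r x) ^ N" "(1 - bump z r x) ^ N \<le> 1" for z x N
    using f01[of z x] by (auto intro: power_le_one)
  show "0 \<le> \<psi> N x" "\<psi> N x \<le> 1" for N x
    using p01 by (auto simp: \<psi>_def intro!: prod_le_1 prod_nonneg)
  show out: "\<psi> N x = 0" if "N \<noteq> 0" "x \<notin> (\<Union>z\<in>Z. ball z r)" for N x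
  proof -
    have "bump z r x = 0" if "z \<in> Z" for z
      using bump_nonzero_iff[OF r, of z x] \<open>x \<notin> _\<close> that by blast
    then show ?thesis by (simp add: \<psi>_def)
  qed
  show "test_function U (\<psi> N)" if "N \<noteq> 0" for N
  proof (rule test_functionI)
    show "smooth_on (\<psi> N) UNIV"
      unfolding \<psi>_def[abs_def] by (intro smooth_minus smooth_prod smooth_power smooth_bump Z)
    show "compact (\<Union>z\<in>Z. cball z r)" using Z by auto
    show "(\<Union>z\<in>Z. cball z r) \<subseteq> U" using sub by blast
    show "\<psi> N x = 0" if "x \<notin> (\<Union>z\<in>Z. cball z r)" for x
      using that by (intro out \<open>N \<noteq> 0\<close>) auto
  qed
  show "(\<lambda>N. \<psi> N x) \<longlonglongrightarrow> indicator (\<Union>z\<in>Z. ball z r) x"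
  proof (cases "x \<in> (\<Union>z\<in>Z. ball z r)")
    case False
    have "\<forall>\<^sub>F N in sequentially. 0 = \<psi> N x"
      using eventually_gt_at_top[of 0] by eventually_elim (use out False in auto)
    then have "(\<lambda>N. \<psi> N x) \<longlonglongrightarrow> 0" by (rule Lim_transform_eventually[OF tendsto_const])
    then show ?thesis using False by simp
  next
    case True
    then obtain z where z: "z \<in> Z" "x \<in> ball z r" by blast
    then have b: "0 < bump z r x" using bump_nonzero_iff[OF r, of z x] bump_nonneg[of z r x] by simp
    have "(\<lambda>N. \<Prod>z\<in>Z. (1 - bump z r x) ^ N) \<longlonglongrightarrow> 0"
    proof (rule tendsto_sandwich[OF always_eventually always_eventually tendsto_const])
      show "(\<lambda>N. (1 - bump z r x) ^ N) \<longlonglongrightarrow> 0"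
        using b f01[of z x] by (intro LIMSEQ_realpow_zero) auto
      show "\<forall>N. 0 \<le> (\<Prod>z\<in>Z. (1 - bump z r x) ^ N)" using p01 by (auto intro: prod_nonneg)
      show "\<forall>N. (\<Prod>z\<in>Z. (1 - bump z r x) ^ N) \<le> (1 - bump z r x) ^ N"
      proof
        fix N
        have "(\<Prod>z\<in>Z. (1 - bump z r x) ^ N) = (1 - bump z r x) ^ N * (\<Prod>z\<in>Z - {z}. (1 - bump z r x) ^ N)"
          using Z z by (simp add: prod.remove)
        also have "\<dots> \<le> (1 - bump z r x) ^ N * 1"
          using p01 by (intro mult_left_mono prod_le_1) auto
        finally show "(\<Prod>z\<in>Z. (1 - bump z r x) ^ N) \<le> (1 - bump z r x) ^ N" by simp
      qed
    qed
    from tendsto_diff[OF tendsto_const[of 1] this] show ?thesis using True by (simp add: \<psi>_def)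
  qed
qed

definition locally_integrable :: "(real^'n) set \<Rightarrow> (real^'n \<Rightarrow> 'b::euclidean_space) \<Rightarrow> bool" where
  "locally_integrable U f \<longleftrightarrow> (\<forall>K. compact K \<and> K \<subseteq> U \<longrightarrow> set_integrable lebesgue K f)"

text \<open>Two dominated limits: powers of bumps give the indicator of a finite cover of
  \<open>A\<close> by balls, and shrinking the radius gives the indicator of \<open>A\<close>. The
  closed neighbourhood \<open>K\<close> supplies one integrable majorant for both.\<close>

lemma compact_integral_nonneg:
  fixes f :: "real^'n \<Rightarrow> real"
  assumes U: "open U" and f: "locally_integrable U f"
    and pos: "\<And>\<psi>. test_function U \<psi> \<Longrightarrow> (\<And>x. 0 \<le> \<psi> x) \<Longrightarrow> 0 \<le> (LINT x|lebesgue_on U. f x * \<psi> x)"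
    and A: "compact A" "A \<subseteq> U"
  shows "0 \<le> (LINT x:A|lebesgue. f x)"
proof -
  obtain r1 where r1: "0 < r1" "(\<Union>a\<in>A. cball a r1) \<subseteq> U"
    using compact_subset_open_imp_cball_epsilon_subset[OF A(1) U A(2)] by blast
  define K where "K = (\<Union>a\<in>A. cball a r1)"
  have K_eq: "K = {x + y | x y. x \<in> A \<and> y \<in> cball 0 r1}"
  proof (intro set_eqI iffI)
    fix w assume "w \<in> K"
    then obtain a where "a \<in> A" "w \<in> cball a r1" by (auto simp: K_def)
    then have "w = a + (w - a)" "w - a \<in> cball 0 r1" by (auto simp: dist_norm norm_minus_commute)
    then show "w \<in> {x + y | x y. x \<in> A \<and> y \<in> cball 0 r1}" using \<open>a \<in> A\<close> by blast
  next
    fix w assume "w \<in> {x + y | x y. x \<in> A \<and> y \<in> cball 0 r1}"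
    then obtain a y where "w = a + y" "a \<in> A" "norm y \<le> r1" by auto
    then show "w \<in> K" unfolding K_def by (intro UN_I[of a]) (auto simp: dist_norm)
  qed
  have "compact K" unfolding K_eq by (rule compact_sums[OF A(1) compact_cball])
  moreover have "K \<subseteq> U" unfolding K_def by (rule r1(2))
  ultimately have K: "compact K" "K \<subseteq> U" by blast+
  define F where "F x = indicator K x * f x" for x
  have F: "integrable lebesgue F"
    using f K by (simp add: locally_integrable_def set_integrable_def F_def[abs_def])
  then have Fm: "F \<in> borel_measurable lebesgue" by simp
  define r where "r n = r1 / real (Suc n)" for n
  have r: "0 < r n" "r n \<le> r1" for n using r1 by (auto simp: r_def field_simps)
  have "\<exists>Z. finite Z \<and> Z \<subseteq> A \<and> A \<subseteq> (\<Union>z\<in>Z. ball z (r n))" for n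
  proof -
    have "A \<subseteq> (\<Union>z\<in>A. ball z (r n))" using r(1)[of n] by force
    then obtain Z where "Z \<subseteq> A" "finite Z" "A \<subseteq> (\<Union>z\<in>Z. ball z (r n))"
      using compactE_image[OF A(1), of A "\<lambda>z. ball z (r n)"] by auto
    then show ?thesis by blast
  qed
  then obtain Z where Z: "\<And>n. finite (Z n)" "\<And>n. Z n \<subseteq> A" "\<And>n. A \<subseteq> (\<Union>z\<in>Z n. ball z (r n))" by metis
  define O' where "O' n = (\<Union>z\<in>Z n. ball z (r n))" for n
  have sub: "cball z (r n) \<subseteq> K" if "z \<in> Z n" for z n
    using that Z(2)[of n] r(2)[of n] subset_cball[of "r n" r1 z] by (auto simp: K_def)
  have OK: "O' n \<subseteq> K" for n using sub by (fastforce simp: O'_def)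
  have step: "0 \<le> (LINT x|lebesgue. F x * indicator (O' n) x)" for n
  proof -
    define \<psi> where "\<psi> N x = 1 - (\<Prod>z\<in>Z n. (1 - bump z (r n) x) ^ N)" for N x
    have subU: "cball z (r n) \<subseteq> U" if "z \<in> Z n" for z using sub[OF that] K by blast
    note \<psi> = cover_function[OF Z(1) r(1) subU, of n, folded \<psi>_def]
    have lim: "(\<lambda>N. LINT x|lebesgue. F x * \<psi> (Suc N) x) \<longlonglongrightarrow> (LINT x|lebesgue. F x * indicator (O' n) x)"
    proof (rule integral_dominated_convergence[where w="\<lambda>x. \<bar>F x\<bar>"])
      have "open (O' n)" by (auto simp: O'_def)
      then have "O' n \<in> sets lebesgue" by simp
      then show "(\<lambda>x. F x * indicator (O' n) x) \<in> borel_measurable lebesgue"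
        using F by (intro borel_measurable_times borel_measurable_indicator) auto
      have "smooth_on (\<psi> (Suc N)) UNIV" for N using \<psi>(1)[of "Suc N"] by (intro test_function_smooth) auto
      then show "(\<lambda>x. F x * \<psi> (Suc N) x) \<in> borel_measurable lebesgue" for N
        by (intro borel_measurable_times Fm continuous_measurable_lebesgue smooth_continuous)
      show "integrable lebesgue (\<lambda>x. \<bar>F x\<bar>)" using F by auto
      show "AE x in lebesgue. (\<lambda>N. F x * \<psi> (Suc N) x) \<longlonglongrightarrow> F x * indicator (O' n) x"
        unfolding O'_def by (intro AE_I2 tendsto_mult tendsto_const LIMSEQ_Suc[OF \<psi>(5)])
      show "AE x in lebesgue. norm (F x * \<psi> (Suc N) x) \<le> \<bar>F x\<bar>" for N
        using \<psi>(2,3) by (auto simp: abs_mult mult_left_le)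
    qed
    have "0 \<le> (LINT x|lebesgue. F x * \<psi> (Suc N) x)" for N
    proof -
      have Feq: "F x * \<psi> (Suc N) x = f x * \<psi> (Suc N) x" for x
      proof (cases "x \<in> K")
        case False
        then have "x \<notin> (\<Union>z\<in>Z n. ball z (r n))" using OK[of n] unfolding O'_def by blast
        then show ?thesis using \<psi>(4)[of "Suc N" x] by simp
      qed (simp add: F_def)
      have "(LINT x|lebesgue_on U. f x * \<psi> (Suc N) x) = (LINT x|lebesgue. f x * \<psi> (Suc N) x)"
        using U test_function_vanishes[OF \<psi>(1)[of "Suc N"]] by (intro integral_lebesgue_on_supported) auto
      then show ?thesis unfolding Feq using pos[OF \<psi>(1)[of "Suc N"]] \<psi>(2)[of "Suc N"] by simp
    qed
    then show ?thesis by (intro LIMSEQ_le_const[OF lim]) auto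
  qed
  have "(\<lambda>n. LINT x|lebesgue. F x * indicator (O' n) x) \<longlonglongrightarrow> (LINT x|lebesgue. F x * indicator A x)"
  proof (rule integral_dominated_convergence[where w="\<lambda>x. \<bar>F x\<bar>"])
    have "A \<in> sets lebesgue" using A by (simp add: compact_imp_closed borel_closed)
    then show "(\<lambda>x. F x * indicator A x) \<in> borel_measurable lebesgue"
      using F by (intro borel_measurable_times borel_measurable_indicator) auto
    have "open (O' n)" for n by (auto simp: O'_def)
    then have "O' n \<in> sets lebesgue" for n by simp
    then show "(\<lambda>x. F x * indicator (O' n) x) \<in> borel_measurable lebesgue" for n
      using F by (intro borel_measurable_times borel_measurable_indicator) auto
    show "integrable lebesgue (\<lambda>x. \<bar>F x\<bar>)" using F by auto
    show "AE x in lebesgue. (\<lambda>n. F x * indicator (O' n) x) \<longlonglongrightarrow> F x * indicator A x"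
    proof (intro AE_I2 tendsto_mult tendsto_const)
      fix x
      show "(\<lambda>n. indicator (O' n) x :: real) \<longlonglongrightarrow> indicator A x"
      proof (cases "x \<in> A")
        case True
        then have "x \<in> O' n" for n using Z(3)[of n] unfolding O'_def by blast
        then show ?thesis using True by simp
      next
        case False
        have "open (- A)" using A by (simp add: compact_imp_closed open_Compl)
        then obtain e where e: "0 < e" "ball x e \<subseteq> - A" using False open_contains_ball by blast
        have "r \<longlonglongrightarrow> 0" unfolding r_def using LIMSEQ_Suc[OF lim_const_over_n[of r1]] by simp
        then have "\<forall>\<^sub>F n in sequentially. r n < e" using e(1) by (rule order_tendstoD)
        then have "\<forall>\<^sub>F n in sequentially. 0 = (indicator (O' n) x :: real)"
        proof eventually_elim
          fix n assume n: "r n < e"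
          have "x \<notin> O' n"
          proof
            assume "x \<in> O' n"
            then obtain z where "z \<in> Z n" "dist z x < r n" by (auto simp: O'_def)
            then show False using n e(2) Z(2)[of n] by (force simp: dist_commute)
          qed
          then show "0 = (indicator (O' n) x :: real)" by simp
        qed
        then have "(\<lambda>n. indicator (O' n) x :: real) \<longlonglongrightarrow> 0"
          by (rule Lim_transform_eventually[OF tendsto_const])
        then show ?thesis using False by simp
      qed
    qed
    show "AE x in lebesgue. norm (F x * indicator (O' n) x) \<le> \<bar>F x\<bar>" for n
      by (auto simp: abs_mult indicator_def)
  qed
  then have "0 \<le> (LINT x|lebesgue. F x * indicator A x)"
    using step by (intro LIMSEQ_le_const) auto
  also have "(\<lambda>x. F x * indicator A x) = (\<lambda>x. indicator A x *\<^sub>R f x)"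
  proof
    have "A \<subseteq> K" using r1(1) by (force simp: K_def)
    then show "F x * indicator A x = indicator A x *\<^sub>R f x" for x by (auto simp: F_def indicator_def)
  qed
  finally show ?thesis by (simp add: set_lebesgue_integral_def)
qed

text \<open>Inner regularity reduces the set where \<open>f\<close> is negative to compact subsets.
  On each of them the integral of \<open>f\<close> is nonnegative although \<open>f < 0\<close>, so
  the subset is null.\<close>

theorem fundamental_lemma_nonneg:
  fixes f :: "real^'n \<Rightarrow> real"
  assumes U: "open U" and f: "locally_integrable U f"
    and pos: "\<And>\<psi>. test_function U \<psi> \<Longrightarrow> (\<And>x. 0 \<le> \<psi> x) \<Longrightarrow> 0 \<le> (LINT x|lebesgue_on U. f x * \<psi> x)"
  shows "AE x in lebesgue_on U. 0 \<le> f x"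
proof -
  obtain C :: "nat \<Rightarrow> (real^'n) set" where C: "\<And>n. compact (C n)" "\<And>n. C n \<subseteq> U" "(\<Union>n. C n) = U"
  proof (rule open_Union_compact_subsets[OF U])
    fix C :: "nat \<Rightarrow> (real^'n) set"
    assume a: "\<And>n. compact (C n)" "\<And>n. C n \<subseteq> U" "\<Union> (range C) = U"
    show ?thesis by (rule that[of C, OF a])
  qed
  define S where "S n = {x \<in> C n. f x < 0}" for n :: nat
  have S_null: "S n \<in> null_sets lebesgue" for n
  proof -
    have meas: "(\<lambda>x. indicator (C n) x *\<^sub>R f x) \<in> borel_measurable lebesgue"
      using f C(1,2) by (auto simp: locally_integrable_def set_integrable_def)
    have "S n = (\<lambda>x. indicator (C n) x *\<^sub>R f x) -` {..<0} \<inter> space lebesgue"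
      by (auto simp: S_def indicator_def of_bool_def split: if_splits)
    then have S_leb: "S n \<in> sets lebesgue" using measurable_sets[OF meas, of "{..<0}"] by simp
    have "emeasure lebesgue (S n) \<le> ennreal e" if e: "0 < e" for e :: real
    proof -
      obtain T where T: "closed T" "T \<subseteq> S n" "S n - T \<in> lmeasurable" "emeasure lebesgue (S n - T) < ennreal e"
        using sets_lebesgue_inner_closed[OF S_leb e] by blast
      have TC: "T \<subseteq> C n" using T(2) by (auto simp: S_def)
      have Tc: "compact T" using compact_Int_closed[OF C(1)[of n] T(1)] TC by (simp add: inf.absorb2)
      have Tl: "T \<in> sets lebesgue" using T(1) by (simp add: borel_closed)
      have int: "integrable lebesgue (\<lambda>x. indicator T x *\<^sub>R f x)"
        using f Tc TC C(2)[of n] by (auto simp: locally_integrable_def set_integrable_def)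
      have "0 \<le> (LINT x:T|lebesgue. f x)"
        using TC C(2)[of n] by (intro compact_integral_nonneg[OF U f pos Tc]) auto
      moreover have nn: "0 \<le> - (indicator T x *\<^sub>R f x)" for x
        using T(2) by (auto simp: S_def indicator_def)
      have "0 \<le> (LINT x|lebesgue. - (indicator T x *\<^sub>R f x))"
        using nn by (intro Bochner_Integration.integral_nonneg) auto
      ultimately have "(LINT x|lebesgue. - (indicator T x *\<^sub>R f x)) = 0"
        by (simp add: set_lebesgue_integral_def)
      then have "AE x in lebesgue. - (indicator T x *\<^sub>R f x) = 0"
        using int nn by (subst (asm) integral_nonneg_eq_0_iff_AE) auto
      then have "AE x in lebesgue. x \<notin> T"
        by eventually_elim (use T(2) in \<open>auto simp: S_def indicator_def of_bool_def split: if_splits\<close>)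
      then have "T \<in> null_sets lebesgue" using Tl by (simp add: AE_iff_null_sets[symmetric])
      then have "emeasure lebesgue (S n - T) = emeasure lebesgue (S n)"
        using S_leb by (rule emeasure_Diff_null_set)
      then show ?thesis using T(4) by simp
    qed
    then have "emeasure lebesgue (S n) = 0"
      by (metis ennreal_le_epsilon add_0 le_zero_eq)
    then show ?thesis using S_leb by auto
  qed
  have "(\<Union>n. S n) \<in> null_sets lebesgue" using S_null by auto
  then have "AE x in lebesgue. x \<notin> (\<Union>n. S n)" by (rule AE_not_in)
  then have "AE x in lebesgue. x \<in> U \<longrightarrow> 0 \<le> f x"
    by eventually_elim (use C(3) in \<open>auto simp: S_def not_less[symmetric]\<close>)
  then show ?thesis using U by (simp add: AE_restrict_space_iff)
qed

section \<open>Representation of functionals bounded in the L1 norm\<close>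

lemma summable_integral_AE_summable:
  fixes f :: "nat \<Rightarrow> 'a \<Rightarrow> real"
  assumes f: "\<And>k. integrable M (f k)" and s: "summable (\<lambda>k. LINT x|M. \<bar>f k x\<bar>)"
  shows "AE x in M. summable (\<lambda>k. norm (f k x))"
proof -
  have [measurable]: "f k \<in> borel_measurable M" for k using f by auto
  have "(\<integral>\<^sup>+x. (\<Sum>k. ennreal \<bar>f k x\<bar>) \<partial>M) = (\<Sum>k. \<integral>\<^sup>+x. ennreal \<bar>f k x\<bar> \<partial>M)"
    by (rule nn_integral_suminf) measurable
  also have "\<dots> = (\<Sum>k. ennreal (LINT x|M. \<bar>f k x\<bar>))"
    using f by (intro suminf_cong nn_integral_eq_integral) auto
  also have "\<dots> \<noteq> \<infinity>"
    using s by (subst suminf_ennreal2) auto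
  finally have "AE x in M. (\<Sum>k. ennreal \<bar>f k x\<bar>) \<noteq> \<infinity>"
    by (intro nn_integral_PInf_AE) measurable
  then show ?thesis
    by eventually_elim (auto intro: summable_suminf_not_top)
qed

text \<open>A functional that is bounded in \<open>L\<^sup>1\<close> is represented by the limit of a minimising sequence of
  \<open>\<integral>\<psi>\<^sup>2 - 2 T \<psi>\<close>; this only needs completeness of \<open>L\<^sup>1\<close>.\<close>

locale L1_functional = finite_measure M for M :: "'a measure" +
  fixes V :: "('a \<Rightarrow> real) set" and T :: "('a \<Rightarrow> real) \<Rightarrow> real" and L :: real
  assumes V_zero: "(\<lambda>_. 0) \<in> V"
    and V_lin: "\<psi> \<in> V \<Longrightarrow> \<omega> \<in> V \<Longrightarrow> (\<lambda>x. a * \<psi> x + b * \<omega> x) \<in> V"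
    and V_meas: "\<psi> \<in> V \<Longrightarrow> \<psi> \<in> borel_measurable M"
    and V_bdd: "\<psi> \<in> V \<Longrightarrow> \<exists>B. \<forall>x. \<bar>\<psi> x\<bar> \<le> B"
    and T_lin: "\<psi> \<in> V \<Longrightarrow> \<omega> \<in> V \<Longrightarrow> T (\<lambda>x. a * \<psi> x + b * \<omega> x) = a * T \<psi> + b * T \<omega>"
    and T_bdd: "\<psi> \<in> V \<Longrightarrow> \<bar>T \<psi>\<bar> \<le> L * (LINT x|M. \<bar>\<psi> x\<bar>)"
begin

lemma V_integrable: assumes "\<psi> \<in> V" shows "integrable M \<psi>"
proof -
  obtain B where "\<And>x. \<bar>\<psi> x\<bar> \<le> B" using V_bdd[OF assms] by blast
  then show ?thesis using V_meas[OF assms] by (intro integrable_const_bound[of _ B]) auto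
qed

lemma V_mult_integrable: assumes "\<psi> \<in> V" "\<omega> \<in> V" shows "integrable M (\<lambda>x. \<psi> x * \<omega> x)"
proof -
  obtain B C where B: "\<And>x. \<bar>\<psi> x\<bar> \<le> B" and C: "\<And>x. \<bar>\<omega> x\<bar> \<le> C"
    using V_bdd[OF assms(1)] V_bdd[OF assms(2)] by blast
  have "\<bar>\<psi> x * \<omega> x\<bar> \<le> B * C" for x
    unfolding abs_mult using B[of x] C[of x] by (intro mult_mono) (auto intro: order_trans[OF abs_ge_zero])
  then show ?thesis
    using V_meas[OF assms(1)] V_meas[OF assms(2)] by (intro integrable_const_bound[of _ "B * C"]) auto
qed

definition "J \<psi> = (LINT x|M. \<psi> x * \<psi> x) - 2 * T \<psi>"

text \<open>The inequality 2 L |a| - L^2 \<le> a^2 converts the L1 bound on \<open>T\<close> into a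
  lower bound for the quadratic functional; finiteness of the measure makes the constant
  integrable.\<close>

lemma J_lower: assumes "\<psi> \<in> V" shows "- (L\<^sup>2 * measure M (space M)) \<le> J \<psi>"
proof -
  have "(LINT x|M. 2 * L * \<bar>\<psi> x\<bar> - L\<^sup>2) \<le> (LINT x|M. \<psi> x * \<psi> x)"
  proof (rule integral_mono)
    show "integrable M (\<lambda>x. 2 * L * \<bar>\<psi> x\<bar> - L\<^sup>2)" using V_integrable[OF assms] by auto
    show "integrable M (\<lambda>x. \<psi> x * \<psi> x)" using assms by (intro V_mult_integrable)
    show "2 * L * \<bar>\<psi> x\<bar> - L\<^sup>2 \<le> \<psi> x * \<psi> x" for x
      using zero_le_power2[of "\<bar>\<psi> x\<bar> - L"] by (simp add: power2_eq_square algebra_simps)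
  qed
  moreover have "(LINT x|M. 2 * L * \<bar>\<psi> x\<bar> - L\<^sup>2) = 2 * (L * (LINT x|M. \<bar>\<psi> x\<bar>)) - L\<^sup>2 * measure M (space M)"
    using V_integrable[OF assms] by simp
  ultimately show ?thesis using T_bdd[OF assms] by (simp add: J_def abs_le_iff)
qed

lemma J_combination:
  assumes "\<psi> \<in> V" "\<omega> \<in> V"
  shows "J (\<lambda>x. a * \<psi> x + b * \<omega> x) = a\<^sup>2 * (LINT x|M. \<psi> x * \<psi> x) + 2 * a * b * (LINT x|M. \<psi> x * \<omega> x)
    + b\<^sup>2 * (LINT x|M. \<omega> x * \<omega> x) - 2 * (a * T \<psi> + b * T \<omega>)"
proof -
  have "(\<lambda>x. (a * \<psi> x + b * \<omega> x) * (a * \<psi> x + b * \<omega> x)) =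
      (\<lambda>x. a\<^sup>2 * (\<psi> x * \<psi> x) + (2 * a * b) * (\<psi> x * \<omega> x) + b\<^sup>2 * (\<omega> x * \<omega> x))"
    by (simp add: power2_eq_square algebra_simps)
  then show ?thesis
    unfolding J_def T_lin[OF assms] using V_mult_integrable assms by simp
qed

theorem representation:
  obtains g where "integrable M g" "\<And>\<psi>. \<psi> \<in> V \<Longrightarrow> T \<psi> = (LINT x|M. g x * \<psi> x)"
proof -
  define j where "j = Inf (J ` V)"
  have bdd: "bdd_below (J ` V)" using J_lower by (auto intro!: bdd_belowI2)
  have j_le: "j \<le> J \<psi>" if "\<psi> \<in> V" for \<psi>
    unfolding j_def using that bdd by (intro cINF_lower)
  have "\<exists>\<psi>\<in>V. J \<psi> < j + (1/16)^k" for k :: nat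
    using cInf_lessD[of "J ` V" "j + (1/16)^k"] V_zero by (auto simp: j_def)
  \<comment> \<open>The rate 1/16 is the square of 1/4. The quadratic estimate loses a square root
    on the way to L1, and a summable rate 1/4 remains.\<close>
  then obtain \<psi> where \<psi>: "\<And>k. \<psi> k \<in> V" "\<And>k. J (\<psi> k) < j + (1/16)^k" by metis
  define d where "d k x = \<psi> (Suc k) x - \<psi> k x" for k x
  have dV: "d k \<in> V" for k
    using V_lin[OF \<psi>(1)[of "Suc k"] \<psi>(1)[of k], of 1 "-1"] by (simp add: d_def[abs_def])
  have d2: "(LINT x|M. d k x * d k x) \<le> 4 * (1/16)^k" for k
  proof -
    define p q where "p = \<psi> (Suc k)" and "q = \<psi> k"
    have V: "p \<in> V" "q \<in> V" using \<psi> by (auto simp: p_def q_def)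
    have "(LINT x|M. d k x * d k x) = (LINT x|M. p x * p x + (- 2) * (p x * q x) + q x * q x)"
      by (simp add: d_def p_def q_def algebra_simps)
    also have "\<dots> = (LINT x|M. p x * p x) - 2 * (LINT x|M. p x * q x) + (LINT x|M. q x * q x)"
      using V_mult_integrable V by simp
    \<comment> \<open>Parallelogram identity: the linear part \<open>T\<close> cancels, and the
      midpoint costs at least the infimum \<open>j\<close>.\<close>
    also have "\<dots> = 2 * J p + 2 * J q - 4 * J (\<lambda>x. (1/2) * p x + (1/2) * q x)"
      unfolding J_combination[OF V] J_def by (simp add: power2_eq_square)
    also have "\<dots> \<le> 2 * (j + (1/16)^Suc k) + 2 * (j + (1/16)^k) - 4 * j"
    proof -
      have "J p < j + (1/16)^Suc k" "J q < j + (1/16)^k" unfolding p_def q_def by (rule \<psi>)+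
      moreover have "j \<le> J (\<lambda>x. (1/2) * p x + (1/2) * q x)" using V by (intro j_le V_lin)
      moreover have "2 * a + 2 * b - 4 * m \<le> 2 * (j + s) + 2 * (j + t) - 4 * j"
        if "a < j + s" "b < j + t" "j \<le> m" for a b m s t :: real using that by simp
      ultimately show ?thesis by blast
    qed
    also have "\<dots> \<le> 4 * (1/16)^k" by simp
    finally show ?thesis .
  qed
  have d1: "(LINT x|M. \<bar>d k x\<bar>) \<le> (measure M (space M) + 4) * (1/4)^k" for k
  proof -
    define s :: real where "s = (1/4)^k"
    have s: "0 < s" "(1/16)^k = s * s" by (auto simp: s_def power_mult_distrib[symmetric])
    \<comment> \<open>Weighted arithmetic-geometric mean in place of the Cauchy-Schwarz inequality
      for integrals; the weight \<open>s\<close> balances the two terms.\<close>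
    have "(LINT x|M. \<bar>d k x\<bar>) \<le> (LINT x|M. s + (1 / s) * (d k x * d k x))"
    proof (rule integral_mono)
      show "integrable M (\<lambda>x. \<bar>d k x\<bar>)" using V_integrable[OF dV] by auto
      show "integrable M (\<lambda>x. s + (1 / s) * (d k x * d k x))" using V_mult_integrable[OF dV dV] by auto
      fix x
      have "0 \<le> (\<bar>d k x\<bar> - s)\<^sup>2 + \<bar>d k x\<bar> * s" using s by simp
      then have "\<bar>d k x\<bar> * s \<le> s * s + d k x * d k x" by (simp add: power2_eq_square algebra_simps)
      then show "\<bar>d k x\<bar> \<le> s + (1 / s) * (d k x * d k x)" using s by (simp add: field_simps)
    qed
    also have "\<dots> = s * measure M (space M) + (1 / s) * (LINT x|M. d k x * d k x)"
      using V_mult_integrable[OF dV dV] by simp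
    also have "\<dots> \<le> s * measure M (space M) + (1 / s) * (4 * (s * s))"
      using d2[of k] s by (intro add_left_mono mult_left_mono) auto
    also have "\<dots> = (measure M (space M) + 4) * s" using s by (simp add: algebra_simps)
    finally show ?thesis by (simp add: s_def)
  qed
  have geo: "summable (\<lambda>k. c * (1/4)^k)" for c :: real by (intro summable_mult summable_geometric) simp
  have sd: "summable (\<lambda>k. LINT x|M. \<bar>d k x\<bar>)"
    by (rule summable_comparison_test'[OF geo, of 0]) (use d1 in auto)
  have AEd: "AE x in M. summable (\<lambda>k. norm (d k x))"
    by (rule summable_integral_AE_summable[OF V_integrable[OF dV] sd])
  define g where "g x = (\<Sum>k. d k x) + \<psi> 0 x" for x
  have gd: "integrable M (\<lambda>x. \<Sum>k. d k x)"
    by (rule integrable_suminf[OF V_integrable[OF dV] AEd]) (use sd in simp)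
  have "T \<omega> = (LINT x|M. g x * \<omega> x)" if \<omega>: "\<omega> \<in> V" for \<omega>
  proof -
    obtain B where B: "\<And>x. \<bar>\<omega> x\<bar> \<le> B" using V_bdd[OF \<omega>] by blast
    have AEd\<omega>: "AE x in M. summable (\<lambda>k. norm (d k x * \<omega> x))"
      using AEd by eventually_elim (auto simp: abs_mult intro: summable_mult2)
    have sd\<omega>: "summable (\<lambda>k. LINT x|M. norm (d k x * \<omega> x))"
    proof (rule summable_comparison_test'[OF summable_mult2[OF sd], of 0 _ B])
      fix k
      have "(LINT x|M. norm (d k x * \<omega> x)) \<le> (LINT x|M. \<bar>d k x\<bar> * B)"
      proof (rule integral_mono)
        show "norm (d k x * \<omega> x) \<le> \<bar>d k x\<bar> * B" for x
          using B[of x] by (simp add: abs_mult mult_left_mono)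
      qed (use V_mult_integrable[OF dV \<omega>] V_integrable[OF dV] in auto)
      then show "norm (LINT x|M. norm (d k x * \<omega> x)) \<le> (LINT x|M. \<bar>d k x\<bar>) * B" by simp
    qed
    have sums: "(\<lambda>k. LINT x|M. d k x * \<omega> x) sums (LINT x|M. (\<Sum>k. d k x * \<omega> x))"
      by (rule sums_integral[OF V_mult_integrable[OF dV \<omega>] AEd\<omega> sd\<omega>])
    have "(LINT x|M. (\<Sum>k. d k x * \<omega> x)) = (LINT x|M. (\<Sum>k. d k x) * \<omega> x)"
    proof (rule integral_cong_AE)
      show "(\<lambda>x. \<Sum>k. d k x * \<omega> x) \<in> borel_measurable M" "(\<lambda>x. (\<Sum>k. d k x) * \<omega> x) \<in> borel_measurable M"
        using V_meas[OF dV] V_meas[OF \<omega>] by measurable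
      show "AE x in M. (\<Sum>k. d k x * \<omega> x) = (\<Sum>k. d k x) * \<omega> x"
        using AEd by eventually_elim (rule suminf_mult2[symmetric, OF summable_norm_cancel])
    qed
    moreover have "(\<Sum>k<n. LINT x|M. d k x * \<omega> x) = (LINT x|M. \<psi> n x * \<omega> x) - (LINT x|M. \<psi> 0 x * \<omega> x)" for n
    proof -
      have "(LINT x|M. d k x * \<omega> x) = (LINT x|M. \<psi> (Suc k) x * \<omega> x) - (LINT x|M. \<psi> k x * \<omega> x)" for k
        using V_mult_integrable[OF \<psi>(1) \<omega>] by (simp add: d_def left_diff_distrib)
      then show ?thesis using sum_lessThan_telescope[of "\<lambda>k. LINT x|M. \<psi> k x * \<omega> x" n] by simp
    qed
    ultimately have "(\<lambda>n. (LINT x|M. \<psi> n x * \<omega> x) - (LINT x|M. \<psi> 0 x * \<omega> x)) \<longlonglongrightarrow> (LINT x|M. (\<Sum>k. d k x) * \<omega> x)"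
      using sums by (simp add: sums_def)
    then have "(\<lambda>n. (LINT x|M. \<psi> n x * \<omega> x) - (LINT x|M. \<psi> 0 x * \<omega> x) + (LINT x|M. \<psi> 0 x * \<omega> x))
        \<longlonglongrightarrow> (LINT x|M. (\<Sum>k. d k x) * \<omega> x) + (LINT x|M. \<psi> 0 x * \<omega> x)"
      by (intro tendsto_intros)
    moreover have "(LINT x|M. (\<Sum>k. d k x) * \<omega> x) + (LINT x|M. \<psi> 0 x * \<omega> x) = (LINT x|M. g x * \<omega> x)"
    proof -
      have "integrable M (\<lambda>x. (\<Sum>k. d k x) * \<omega> x)"
        by (rule Bochner_Integration.integrable_bound[OF integrable_mult_left[of B, OF gd[THEN integrable_abs]]])
           (use B V_meas[OF dV] V_meas[OF \<omega>] in \<open>auto simp: abs_mult intro!: mult_left_mono order_trans[OF B abs_ge_self]\<close>)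
      then show ?thesis using V_mult_integrable[OF \<psi>(1) \<omega>] by (simp add: g_def distrib_right)
    qed
    ultimately have lim1: "(\<lambda>n. LINT x|M. \<psi> n x * \<omega> x) \<longlonglongrightarrow> (LINT x|M. g x * \<omega> x)" by simp
    define b where "b = (LINT x|M. \<omega> x * \<omega> x)"
    \<comment> \<open>An approximate Euler-Lagrange equation: a near-minimiser perturbed by
      \<open>s\<close> and \<open>- s\<close> times \<open>\<omega>\<close> cannot fall below the
      infimum, which bounds the first variation by a multiple of \<open>s\<close>.\<close>
    have EL: "\<bar>(LINT x|M. \<psi> n x * \<omega> x) - T \<omega>\<bar> \<le> (1 + b) * (1/4)^n" for n
    proof -
      define s :: real where "s = (1/4)^n"
      define e where "e = (LINT x|M. \<psi> n x * \<omega> x) - T \<omega>"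
      have s: "0 < s" "(1/16)^n = s * s" by (auto simp: s_def power_mult_distrib[symmetric])
      have *: "0 \<le> s * s + 2 * t * e + t * t * b" for t
      proof -
        have "j \<le> J (\<lambda>x. 1 * \<psi> n x + t * \<omega> x)" using \<psi> \<omega> by (intro j_le V_lin)
        also have "\<dots> = J (\<psi> n) + 2 * t * e + t * t * b"
          unfolding J_combination[OF \<psi>(1) \<omega>] by (simp add: J_def e_def b_def power2_eq_square algebra_simps)
        finally show ?thesis using \<psi>(2)[of n] s by simp
      qed
      have b0: "0 \<le> b" unfolding b_def by (intro Bochner_Integration.integral_nonneg) auto
      have "0 \<le> s * (s + 2 * e + s * b)" "0 \<le> s * (s - 2 * e + s * b)"
        using *[of s] *[of "- s"] by (auto simp: algebra_simps)
      then have "0 \<le> s + 2 * e + s * b" "0 \<le> s - 2 * e + s * b" using s by (auto simp: zero_le_mult_iff)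
      then have "2 * \<bar>e\<bar> \<le> s + s * b" by linarith
      moreover have "0 \<le> s * b" using s b0 by simp
      ultimately show ?thesis using s by (simp add: e_def s_def[symmetric] algebra_simps)
    qed
    have "(\<lambda>n. (LINT x|M. \<psi> n x * \<omega> x) - T \<omega>) \<longlonglongrightarrow> 0"
    proof (rule Lim_null_comparison[OF always_eventually])
      show "\<forall>n. norm ((LINT x|M. \<psi> n x * \<omega> x) - T \<omega>) \<le> (1 + b) * (1/4)^n" using EL by simp
      have "(\<lambda>n. (1 + b) * (1/4)^n) \<longlonglongrightarrow> (1 + b) * 0"
        by (intro tendsto_intros LIMSEQ_realpow_zero) auto
      then show "(\<lambda>n. (1 + b) * (1/4)^n) \<longlonglongrightarrow> 0" by simp
    qed
    then have "(\<lambda>n. LINT x|M. \<psi> n x * \<omega> x) \<longlonglongrightarrow> T \<omega>" by (simp add: LIM_zero_iff)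
    then show ?thesis using lim1 LIMSEQ_unique by blast
  qed
  moreover have "integrable M g" unfolding g_def using gd V_integrable[OF \<psi>(1)] by auto
  ultimately show ?thesis using that by blast
qed

end

subsection \<open>Weak gradients of Lipschitz functions\<close>

lemma integrable_continuous_compact_support:
  fixes f :: "'a::euclidean_space \<Rightarrow> real"
  assumes "continuous_on UNIV f" "compact K" "\<And>x. x \<notin> K \<Longrightarrow> f x = 0"
  shows "integrable lborel f"
proof -
  have "integrable lborel (\<lambda>x. indicator K x *\<^sub>R f x)"
    by (intro borel_integrable_compact assms(2) continuous_on_subset[OF assms(1)]) auto
  also have "(\<lambda>x. indicator K x *\<^sub>R f x) = f"
    using assms(3) by (intro ext) (auto simp: indicator_def of_bool_def)
  finally show ?thesis .
qed

lemma lebesgue_integral_continuous: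
  fixes f :: "'a::euclidean_space \<Rightarrow> real"
  assumes "continuous_on UNIV f"
  shows "(LINT x|lebesgue. f x) = (LINT x|lborel. f x)"
  by (intro integral_completion) (simp add: assms borel_measurable_continuous_onI)

lemma test_function_continuous: "test_function U \<psi> \<Longrightarrow> continuous_on UNIV \<psi>"
  by (intro smooth_continuous test_function_smooth)

lemma test_function_integrable:
  assumes "test_function U \<psi>" "continuous_on UNIV w"
  shows "integrable lborel (\<lambda>x. w x * \<psi> x)"
proof -
  obtain K where K: "compact K" "K \<subseteq> U" "\<And>x. x \<notin> K \<Longrightarrow> \<psi> x = 0" using test_functionE[OF assms(1)] by blast
  show ?thesis
    by (rule integrable_continuous_compact_support[OF _ K(1)])
       (use K(3) assms in \<open>auto intro: continuous_intros test_function_continuous\<close>)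
qed

lemma test_function_bounded:
  assumes "test_function U \<psi>" obtains B where "0 \<le> B" "\<And>x. \<bar>\<psi> x\<bar> \<le> B"
proof -
  obtain K where K: "compact K" "K \<subseteq> U" "\<And>x. x \<notin> K \<Longrightarrow> \<psi> x = 0" using test_functionE[OF assms(1)] by blast
  have "compact (\<psi> ` K)"
    by (intro compact_continuous_image K(1) continuous_on_subset[OF test_function_continuous[OF assms]]) auto
  from compact_imp_bounded[OF this, unfolded bounded_pos]
  obtain B where B: "0 < B" "\<And>x. x \<in> K \<Longrightarrow> \<bar>\<psi> x\<bar> \<le> B" by auto
  have "\<bar>\<psi> x\<bar> \<le> B" for x using B K(3)[of x] by (cases "x \<in> K") auto
  then show ?thesis using that[of B] B(1) by simp
qed

section \<open>Directional derivatives and difference quotients\<close>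

definition dir_deriv :: "(real^'n \<Rightarrow> real) \<Rightarrow> real^'n \<Rightarrow> real^'n \<Rightarrow> real" where
  "dir_deriv f q x = (\<Sum>i\<in>UNIV. q $ i * partial_deriv i f x)"

lemma dir_deriv_uminus: "dir_deriv f (- q) x = - dir_deriv f q x"
  by (simp add: dir_deriv_def sum_negf)

lemma dir_deriv_axis: "dir_deriv f (axis i 1) x = partial_deriv i f x"
proof -
  have "axis i 1 $ j * partial_deriv j f x = (if j = i then partial_deriv i f x else 0)" for j
    by (simp add: axis_def)
  then show ?thesis by (simp add: dir_deriv_def)
qed

lemma has_derivative_dir_deriv:
  assumes "smooth_on f UNIV"
  shows "((\<lambda>t. f (x + t *\<^sub>R q)) has_real_derivative dir_deriv f q (x + t *\<^sub>R q)) (at t)"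
proof -
  have fd: "f differentiable (at y)" for y by (rule smooth_differentiable[OF assms])
  have "((\<lambda>t. x + t *\<^sub>R q) has_derivative (\<lambda>h. h *\<^sub>R q)) (at t)"
    by (auto intro!: derivative_eq_intros)
  from has_derivative_compose[OF this fd[of "x + t *\<^sub>R q", unfolded frechet_derivative_works]]
  have "((\<lambda>t. f (x + t *\<^sub>R q)) has_derivative (\<lambda>h. frechet_derivative f (at (x + t *\<^sub>R q)) (h *\<^sub>R q))) (at t)" .
  moreover have "frechet_derivative f (at y) (h *\<^sub>R q) = dir_deriv f q y * h" for y h
    using linear_frechet_derivative[OF fd[of y]]
    by (simp add: linear_cmul frechet_derivative_partial[OF fd] dir_deriv_def sum_distrib_left mult_ac)
  ultimately show ?thesis by (simp add: has_field_derivative_def)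
qed

lemma test_function_zero: "test_function U (\<lambda>_. 0)"
  by (rule test_functionI[of _ "{}"]) (auto intro: smooth_const)

lemma test_function_dir_deriv: assumes "test_function U \<psi>" shows "test_function U (dir_deriv \<psi> q)"
proof -
  have "test_function U (\<lambda>x. \<Sum>i\<in>I. q $ i * partial_deriv i \<psi> x)" if "finite I" for I
    using that
  proof (induction I rule: finite_induct)
    case empty
    show ?case using test_function_zero by simp
  next
    case (insert i I)
    then show ?case
      using test_function_add[OF test_function_mult_left[OF smooth_const test_function_partial[OF assms]] insert.IH] by simp
  qed
  from this[of UNIV] show ?thesis by (simp add: dir_deriv_def[abs_def])
qed

lemma diff_quotient_limit:
  assumes w: "continuous_on UNIV w" and \<psi>: "test_function U \<psi>"
  shows "(\<lambda>n. LINT x|lborel. w x * ((\<psi> (x + (1 / real (Suc n)) *\<^sub>R q) - \<psi> x) * real (Suc n)))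
    \<longlonglongrightarrow> (LINT x|lborel. w x * dir_deriv \<psi> q x)"
proof -
  have sm: "smooth_on \<psi> UNIV" by (rule test_function_smooth[OF \<psi>])
  obtain K where K: "compact K" "K \<subseteq> U" "\<And>x. x \<notin> K \<Longrightarrow> \<psi> x = 0" using test_functionE[OF \<psi>] by blast
  have D: "test_function U (dir_deriv \<psi> q)" by (rule test_function_dir_deriv[OF \<psi>])
  obtain B where B: "0 \<le> B" "\<And>x. \<bar>dir_deriv \<psi> q x\<bar> \<le> B" using test_function_bounded[OF D] by blast
  \<comment> \<open>The shifts have length at most \<open>norm q\<close>, so this one compact set
    contains the support of every difference quotient.\<close>
  define K' where "K' = {x + y | x y. x \<in> K \<and> y \<in> cball 0 (norm q)}"
  have K': "compact K'" unfolding K'_def by (rule compact_sums[OF K(1) compact_cball])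
  define \<Delta> where "\<Delta> n x = (\<psi> (x + (1 / real (Suc n)) *\<^sub>R q) - \<psi> x) * real (Suc n)" for n x
  have \<Delta>_bound: "\<bar>\<Delta> n x\<bar> \<le> B" for n x
  proof -
    define h where "h = 1 / real (Suc n)"
    have h: "0 < h" "h * real (Suc n) = 1" by (auto simp: h_def)
    have "\<exists>z>0. z < h \<and> \<psi> (x + h *\<^sub>R q) - \<psi> (x + 0 *\<^sub>R q) = (h - 0) * dir_deriv \<psi> q (x + z *\<^sub>R q)"
      by (rule MVT2[OF h(1)]) (rule has_derivative_dir_deriv[OF sm])
    then obtain t where "\<psi> (x + h *\<^sub>R q) - \<psi> (x + 0 *\<^sub>R q) = (h - 0) * dir_deriv \<psi> q (x + t *\<^sub>R q)"
      by blast
    then have "\<Delta> n x = dir_deriv \<psi> q (x + t *\<^sub>R q) * (h * real (Suc n))" by (simp add: \<Delta>_def h_def)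
    then show ?thesis using B(2) h by simp
  qed
  have \<Delta>_zero: "\<Delta> n x = 0" if "x \<notin> K'" for n x
  proof -
    have "x \<notin> K"
    proof
      assume "x \<in> K"
      then have "x + 0 \<in> K'" unfolding K'_def by (intro CollectI exI conjI) auto
      then show False using that by simp
    qed
    moreover have "x + (1 / real (Suc n)) *\<^sub>R q \<notin> K"
    proof
      assume *: "x + (1 / real (Suc n)) *\<^sub>R q \<in> K"
      define v where "v = (1 / real (Suc n)) *\<^sub>R q"
      have "norm v \<le> norm q" by (simp add: v_def divide_le_eq mult_le_cancel_left1)
      moreover have "x = (x + v) + (- v)" by simp
      ultimately have "x \<in> K'"
        unfolding K'_def using *[folded v_def] by (metis (mono_tags, lifting) mem_Collect_eq mem_cball_0 norm_minus_cancel)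
      then show False using that by simp
    qed
    ultimately show ?thesis using K(3) by (simp add: \<Delta>_def)
  qed
  have \<Delta>_lim: "(\<lambda>n. \<Delta> n x) \<longlonglongrightarrow> dir_deriv \<psi> q x" for x
  proof -
    have "((\<lambda>h. (\<psi> (x + (0 + h) *\<^sub>R q) - \<psi> (x + 0 *\<^sub>R q)) / h) \<longlongrightarrow> dir_deriv \<psi> q (x + 0 *\<^sub>R q)) (at 0)"
      using has_derivative_dir_deriv[OF sm, of x q 0] unfolding DERIV_def .
    moreover have "filterlim (\<lambda>n. 1 / real (Suc n)) (at 0) sequentially"
      by (rule filterlim_atI) (use LIMSEQ_inverse_real_of_nat in \<open>auto simp: inverse_eq_divide\<close>)
    ultimately have "((\<lambda>n. (\<psi> (x + (0 + 1 / real (Suc n)) *\<^sub>R q) - \<psi> (x + 0 *\<^sub>R q)) / (1 / real (Suc n))) \<longlongrightarrow> dir_deriv \<psi> q (x + 0 *\<^sub>R q)) sequentially"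
      by (rule filterlim_compose)
    then show ?thesis by (simp add: \<Delta>_def[abs_def])
  qed
  have \<psi>c: "continuous_on UNIV \<psi>" by (rule test_function_continuous[OF \<psi>])
  have "(\<lambda>n. LINT x|lborel. w x * \<Delta> n x) \<longlonglongrightarrow> (LINT x|lborel. w x * dir_deriv \<psi> q x)"
  proof (rule integral_dominated_convergence[where w="\<lambda>x. indicator K' x *\<^sub>R (\<bar>w x\<bar> * B)"])
    show "(\<lambda>x. w x * dir_deriv \<psi> q x) \<in> borel_measurable lborel"
      using test_function_integrable[OF D w] by auto
    show "(\<lambda>x. w x * \<Delta> n x) \<in> borel_measurable lborel" for n
      unfolding \<Delta>_def
      by (simp, intro borel_measurable_continuous_onI continuous_intros w continuous_on_compose2[OF \<psi>c]) auto
    show "integrable lborel (\<lambda>x. indicator K' x *\<^sub>R (\<bar>w x\<bar> * B))"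
      by (intro borel_integrable_compact K' continuous_intros continuous_on_subset[OF w]) auto
    show "AE x in lborel. (\<lambda>n. w x * \<Delta> n x) \<longlonglongrightarrow> w x * dir_deriv \<psi> q x"
      by (intro AE_I2 tendsto_mult tendsto_const \<Delta>_lim)
    show "AE x in lborel. norm (w x * \<Delta> n x) \<le> indicator K' x *\<^sub>R (\<bar>w x\<bar> * B)" for n
    proof (rule AE_I2)
      fix x
      show "norm (w x * \<Delta> n x) \<le> indicator K' x *\<^sub>R (\<bar>w x\<bar> * B)"
        using \<Delta>_zero[of x n] mult_left_mono[OF \<Delta>_bound[of n x], of "\<bar>w x\<bar>"]
        by (cases "x \<in> K'") (auto simp: abs_mult)
    qed
  qed
  then show ?thesis by (simp add: \<Delta>_def)
qed

lemma diff_quotient_shift: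
  assumes w: "continuous_on UNIV w" and \<psi>: "test_function U \<psi>"
  shows "(LINT x|lborel. w x * ((\<psi> (x + h) - \<psi> x) * r)) = (LINT x|lborel. (w (x - h) - w x) * \<psi> x * r)"
proof -
  have \<psi>c: "continuous_on UNIV \<psi>" by (rule test_function_continuous[OF \<psi>])
  have wh: "continuous_on UNIV (\<lambda>x. w (x - h))" by (intro continuous_on_compose2[OF w] continuous_intros) auto
  have meas: "(\<lambda>x. w x * \<psi> (x + h)) \<in> borel_measurable borel"
    by (intro borel_measurable_continuous_onI continuous_intros w continuous_on_compose2[OF \<psi>c]) auto
  have shift: "(LINT x|lborel. w x * \<psi> (x + h)) = (LINT x|lborel. w (x - h) * \<psi> x)"
    using lborel_integral_affine[OF _ meas, of 1 "- h"] by simp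
  have i1: "integrable lborel (\<lambda>x. w (x - h) * \<psi> x)" by (rule test_function_integrable[OF \<psi> wh])
  have i2: "integrable lborel (\<lambda>x. w x * \<psi> (x + h))"
    using lborel_integrable_affine[OF _ i1, of 1 h] by (simp add: add.commute)
  have i3: "integrable lborel (\<lambda>x. w x * \<psi> x)" by (rule test_function_integrable[OF \<psi> w])
  have "(LINT x|lborel. w x * ((\<psi> (x + h) - \<psi> x) * r)) = (LINT x|lborel. (w x * \<psi> (x + h) - w x * \<psi> x) * r)"
    by (simp add: algebra_simps)
  also have "\<dots> = ((LINT x|lborel. w x * \<psi> (x + h)) - (LINT x|lborel. w x * \<psi> x)) * r"
    using i2 i3 by simp
  also have "\<dots> = (LINT x|lborel. (w (x - h) * \<psi> x - w x * \<psi> x) * r)"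
    using i1 i3 by (simp add: shift)
  finally show ?thesis by (simp add: left_diff_distrib)
qed

text \<open>Discrete integration by parts: shifting the variable moves the forward quotient of
  \<open>\<psi>\<close> to a backward quotient of \<open>w\<close>, to which the pointwise bound
  applies before the limit is taken.\<close>

lemma integral_dir_deriv_le:
  assumes w: "continuous_on UNIV w" and \<psi>: "test_function U \<psi>"
    and le: "\<And>x t. 0 < t \<Longrightarrow> (w (x - t *\<^sub>R q) - w x) * \<psi> x \<le> t * c * \<bar>\<psi> x\<bar>"
  shows "(LINT x|lborel. w x * dir_deriv \<psi> q x) \<le> c * (LINT x|lborel. \<bar>\<psi> x\<bar>)"
proof (rule LIMSEQ_le_const2[OF diff_quotient_limit[OF w \<psi>]], intro exI allI impI)
  fix n
  define h where "h = 1 / real (Suc n)"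
  have h: "0 < h" "h * real (Suc n) = 1" by (auto simp: h_def)
  have \<psi>i: "integrable lborel \<psi>" using test_function_integrable[OF \<psi>, of "\<lambda>_. 1"] by simp
  have "(LINT x|lborel. w x * ((\<psi> (x + h *\<^sub>R q) - \<psi> x) * real (Suc n))) =
      (LINT x|lborel. (w (x - h *\<^sub>R q) - w x) * \<psi> x * real (Suc n))"
    by (rule diff_quotient_shift[OF w \<psi>])
  also have "\<dots> \<le> (LINT x|lborel. c * \<bar>\<psi> x\<bar>)"
  proof (rule integral_mono)
    have "continuous_on UNIV (\<lambda>x. w (x - h *\<^sub>R q) - w x)"
      by (intro continuous_intros w continuous_on_compose2[OF w]) auto
    then show "integrable lborel (\<lambda>x. (w (x - h *\<^sub>R q) - w x) * \<psi> x * real (Suc n))"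
      using test_function_integrable[OF \<psi>] by auto
    show "integrable lborel (\<lambda>x. c * \<bar>\<psi> x\<bar>)" using \<psi>i by auto
    fix x
    have "(w (x - h *\<^sub>R q) - w x) * \<psi> x * real (Suc n) \<le> h * c * \<bar>\<psi> x\<bar> * real (Suc n)"
      using le[OF h(1), of x] by (intro mult_right_mono) auto
    also have "\<dots> = (h * real (Suc n)) * (c * \<bar>\<psi> x\<bar>)" by simp
    finally show "(w (x - h *\<^sub>R q) - w x) * \<psi> x * real (Suc n) \<le> c * \<bar>\<psi> x\<bar>"
      by (simp only: h(2) mult_1)
  qed
  also have "\<dots> = c * (LINT x|lborel. \<bar>\<psi> x\<bar>)" by simp
  finally show "(LINT x|lborel. w x * ((\<psi> (x + (1 / real (Suc n)) *\<^sub>R q) - \<psi> x) * real (Suc n)))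
      \<le> c * (LINT x|lborel. \<bar>\<psi> x\<bar>)" by (simp add: h_def)
qed

lemma integral_on_test:
  assumes "open U" "test_function U \<psi>" "continuous_on UNIV w"
  shows "(LINT x|lebesgue_on U. w x * \<psi> x) = (LINT x|lborel. w x * \<psi> x)"
proof -
  have "(LINT x|lebesgue_on U. w x * \<psi> x) = (LINT x|lebesgue. w x * \<psi> x)"
    using assms test_function_vanishes[OF assms(2)] by (intro integral_lebesgue_on_supported) auto
  also have "\<dots> = (LINT x|lborel. w x * \<psi> x)"
    by (intro lebesgue_integral_continuous continuous_intros assms test_function_continuous[OF assms(2)])
  finally show ?thesis .
qed

text \<open>The distributional derivative of a Lipschitz function is bounded by \<open>L\<close>
  times the L1 norm of the test function, so the abstract representation produces it as a function;
  differentiability almost everywhere is not involved.\<close>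

lemma lipschitz_weak_derivative:
  fixes U :: "(real^'n) set"
  assumes U: "open U" "bounded U" and w: "continuous_on UNIV w"
    and lip: "\<And>x y. \<bar>w x - w y\<bar> \<le> L * norm (x - y)"
  obtains g where "integrable (lebesgue_on U) g"
    "\<And>\<psi>. test_function U \<psi> \<Longrightarrow>
      (LINT x|lebesgue_on U. w x * partial_deriv i \<psi> x) = - (LINT x|lebesgue_on U. g x * \<psi> x)"
proof -
  have Ul: "U \<in> sets lebesgue" using U by simp
  define T where "T \<psi> = - (LINT x|lebesgue_on U. w x * partial_deriv i \<psi> x)" for \<psi>
  have T: "T \<psi> = - (LINT x|lborel. w x * partial_deriv i \<psi> x)" if "test_function U \<psi>" for \<psi>
    unfolding T_def by (subst integral_on_test[OF U(1) test_function_partial[OF that] w]) simp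
  have fin: "finite_measure (lebesgue_on U)"
    using U by (intro finite_measure_lebesgue_on bounded_set_imp_lmeasurable) auto
  interpret L1_functional "lebesgue_on U" "{\<psi>. test_function U \<psi>}" T L
  proof (rule L1_functional.intro[OF fin], unfold_locales)
    show "(\<lambda>_. 0) \<in> {\<psi>. test_function U \<psi>}" by (simp add: test_function_zero)
  next
    fix \<psi> \<omega> and a b :: real
    assume "\<psi> \<in> {\<psi>. test_function U \<psi>}" "\<omega> \<in> {\<psi>. test_function U \<psi>}"
    then show "(\<lambda>x. a * \<psi> x + b * \<omega> x) \<in> {\<psi>. test_function U \<psi>}"
      by (simp add: test_function_add test_function_mult_left smooth_const)
  next
    fix \<psi> assume "\<psi> \<in> {\<psi>. test_function U \<psi>}"
    then have \<psi>: "test_function U \<psi>" by simp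
    have "\<psi> \<in> borel_measurable lebesgue"
      by (intro continuous_measurable_lebesgue test_function_continuous[OF \<psi>])
    then show "\<psi> \<in> borel_measurable (lebesgue_on U)" by (rule measurable_restrict_space1)
    obtain B where "\<And>x. \<bar>\<psi> x\<bar> \<le> B" using test_function_bounded[OF \<psi>] by blast
    then show "\<exists>B. \<forall>x. \<bar>\<psi> x\<bar> \<le> B" by blast
  next
    fix \<psi> \<omega> and a b :: real
    assume "\<psi> \<in> {\<psi>. test_function U \<psi>}" "\<omega> \<in> {\<psi>. test_function U \<psi>}"
    then have V: "test_function U \<psi>" "test_function U \<omega>" by auto
    have c: "test_function U (\<lambda>x. a * \<psi> x)" "test_function U (\<lambda>x. b * \<omega> x)"
      by (intro test_function_mult_left smooth_const V)+
    have s: "partial_deriv i (\<lambda>x. a * \<psi> x + b * \<omega> x) = (\<lambda>x. a * partial_deriv i \<psi> x + b * partial_deriv i \<omega> x)"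
    proof
      fix x
      have "\<psi> differentiable (at x)" "\<omega> differentiable (at x)"
        by (rule smooth_differentiable[OF test_function_smooth[OF V(1)]], rule smooth_differentiable[OF test_function_smooth[OF V(2)]])
      then have "(\<psi> has_derivative frechet_derivative \<psi> (at x)) (at x)"
         "(\<omega> has_derivative frechet_derivative \<omega> (at x)) (at x)"
        by (simp_all only: frechet_derivative_works[symmetric])
      then have "((\<lambda>x. a * \<psi> x + b * \<omega> x) has_derivative
          (\<lambda>h. a * frechet_derivative \<psi> (at x) h + b * frechet_derivative \<omega> (at x) h)) (at x)"
        by (auto intro!: derivative_eq_intros)
      from partial_deriv_eq[OF this]
      show "partial_deriv i (\<lambda>x. a * \<psi> x + b * \<omega> x) x = a * partial_deriv i \<psi> x + b * partial_deriv i \<omega> x"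
        by (simp add: partial_deriv_def)
    qed
    have ii: "integrable lborel (\<lambda>x. w x * partial_deriv i \<psi> x)" "integrable lborel (\<lambda>x. w x * partial_deriv i \<omega> x)"
      by (rule test_function_integrable[OF test_function_partial[OF V(1)] w],
          rule test_function_integrable[OF test_function_partial[OF V(2)] w])
    have "(\<lambda>x. w x * (a * partial_deriv i \<psi> x + b * partial_deriv i \<omega> x)) =
        (\<lambda>x. a * (w x * partial_deriv i \<psi> x) + b * (w x * partial_deriv i \<omega> x))"
      by (simp add: algebra_simps)
    then show "T (\<lambda>x. a * \<psi> x + b * \<omega> x) = a * T \<psi> + b * T \<omega>"
      unfolding T[OF V(1)] T[OF V(2)] T[OF test_function_add[OF c]] s using ii by simp
  next
    fix \<psi> assume "\<psi> \<in> {\<psi>. test_function U \<psi>}"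
    then have \<psi>: "test_function U \<psi>" by simp
    have bd: "(w (x - t *\<^sub>R q) - w x) * \<psi> x \<le> t * L * \<bar>\<psi> x\<bar>" if "0 < t" "norm q = 1" for x t q
    proof -
      have "(w (x - t *\<^sub>R q) - w x) * \<psi> x \<le> \<bar>w (x - t *\<^sub>R q) - w x\<bar> * \<bar>\<psi> x\<bar>"
        using abs_ge_self[of "(w (x - t *\<^sub>R q) - w x) * \<psi> x"] by (simp only: abs_mult)
      also have "\<dots> \<le> (L * norm (x - t *\<^sub>R q - x)) * \<bar>\<psi> x\<bar>" by (intro mult_right_mono lip) auto
      finally show ?thesis using that by (simp add: mult.commute mult.left_commute)
    qed
    have "(LINT x|lborel. w x * dir_deriv \<psi> (axis i 1) x) \<le> L * (LINT x|lborel. \<bar>\<psi> x\<bar>)"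
      by (rule integral_dir_deriv_le[OF w \<psi>]) (rule bd, auto)
    moreover have "(LINT x|lborel. w x * dir_deriv \<psi> (- axis i 1) x) \<le> L * (LINT x|lborel. \<bar>\<psi> x\<bar>)"
      by (rule integral_dir_deriv_le[OF w \<psi>]) (rule bd, auto)
    moreover have "(LINT x|lebesgue_on U. \<bar>\<psi> x\<bar>) = (LINT x|lborel. \<bar>\<psi> x\<bar>)"
      using integral_lebesgue_on_supported[OF Ul, of "\<lambda>x. \<bar>\<psi> x\<bar>"] test_function_vanishes[OF \<psi>]
        lebesgue_integral_continuous[OF continuous_on_rabs[OF test_function_continuous[OF \<psi>]]] by simp
    ultimately show "\<bar>T \<psi>\<bar> \<le> L * (LINT x|lebesgue_on U. \<bar>\<psi> x\<bar>)"
      unfolding T[OF \<psi>] by (simp add: dir_deriv_uminus dir_deriv_axis abs_le_iff)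
  qed
  show ?thesis
  proof (rule representation)
    fix g assume g: "integrable (lebesgue_on U) g"
      "\<And>\<psi>. \<psi> \<in> {\<psi>. test_function U \<psi>} \<Longrightarrow> T \<psi> = (LINT x|lebesgue_on U. g x * \<psi> x)"
    show ?thesis
    proof
      show "integrable (lebesgue_on U) g" by (rule g)
      show "(LINT x|lebesgue_on U. w x * partial_deriv i \<psi> x) = - (LINT x|lebesgue_on U. g x * \<psi> x)"
        if "test_function U \<psi>" for \<psi> using g(2)[of \<psi>] that by (simp add: T_def)
    qed
  qed
qed

section \<open>Integrability, measurability and uniqueness of weak gradients\<close>

lemma is_weak_gradient_locally_integrable:
  assumes "is_weak_gradient U v g"
  shows "locally_integrable U v" "locally_integrable U g"
  using assms by (auto simp: is_weak_gradient_def locally_integrable_def)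

lemma weak_gradient_test:
  assumes "is_weak_gradient U v g" "test_function U \<psi>"
  shows "(LINT x|lebesgue_on U. v x * partial_deriv i \<psi> x) = - (LINT x|lebesgue_on U. g x $ i * \<psi> x)"
  using assms by (simp add: is_weak_gradient_def)

lemma locally_integrable_inner:
  fixes g :: "real^'n \<Rightarrow> real^'n"
  assumes "locally_integrable U g" shows "locally_integrable U (\<lambda>x. g x \<bullet> q)"
  unfolding locally_integrable_def set_integrable_def
proof (intro allI impI)
  fix K assume "compact K \<and> K \<subseteq> U"
  then have "integrable lebesgue (\<lambda>x. indicator K x *\<^sub>R g x)"
    using assms by (auto simp: locally_integrable_def set_integrable_def)
  then have "integrable lebesgue (\<lambda>x. (indicator K x *\<^sub>R g x) \<bullet> q)"
    by (rule integrable_inner_left)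
  then show "integrable lebesgue (\<lambda>x. indicator K x *\<^sub>R (g x \<bullet> q))" by simp
qed

lemma locally_integrable_diff:
  fixes f :: "real^'n \<Rightarrow> real"
  assumes "locally_integrable U f" "locally_integrable U h"
  shows "locally_integrable U (\<lambda>x. f x - h x)"
  using assms set_integral_diff(1) unfolding locally_integrable_def by blast

lemma locally_integrable_const: "locally_integrable (U :: (real^'n) set) (\<lambda>_. c::real)"
  unfolding locally_integrable_def
proof (intro allI impI)
  fix K :: "(real^'n) set" assume K: "compact K \<and> K \<subseteq> U"
  then have "K \<in> lmeasurable" by (simp add: lmeasurable_compact)
  then show "set_integrable lebesgue K (\<lambda>_. c)"
    by (auto simp: set_integrable_def fmeasurable_def intro!: integrable_scaleR_left)
qed

lemma locally_integrable_test:
  fixes f :: "real^'n \<Rightarrow> real"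
  assumes U: "open U" and f: "locally_integrable U f" and \<psi>: "test_function U \<psi>"
  shows "integrable (lebesgue_on U) (\<lambda>x. f x * \<psi> x)"
proof -
  obtain K where K: "compact K" "K \<subseteq> U" "\<And>x. x \<notin> K \<Longrightarrow> \<psi> x = 0" using test_functionE[OF \<psi>] by blast
  obtain B where B: "0 \<le> B" "\<And>x. \<bar>\<psi> x\<bar> \<le> B" using test_function_bounded[OF \<psi>] by blast
  have F: "integrable lebesgue (\<lambda>x. indicator K x *\<^sub>R f x)"
    using f K by (auto simp: locally_integrable_def set_integrable_def)
  have "integrable lebesgue (\<lambda>x. (indicator K x *\<^sub>R f x) * \<psi> x)"
  proof (rule Bochner_Integration.integrable_bound)
    show "integrable lebesgue (\<lambda>x. B * (indicator K x *\<^sub>R f x))" using F by auto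
    show "(\<lambda>x. (indicator K x *\<^sub>R f x) * \<psi> x) \<in> borel_measurable lebesgue"
      by (intro borel_measurable_times borel_measurable_integrable[OF F]
          continuous_measurable_lebesgue test_function_continuous[OF \<psi>])
    show "AE x in lebesgue. norm ((indicator K x *\<^sub>R f x) * \<psi> x) \<le> norm (B * (indicator K x *\<^sub>R f x))"
    proof (rule AE_I2)
      fix x
      have "\<bar>a * \<psi> x\<bar> \<le> \<bar>B * a\<bar>" for a :: real
        using mult_right_mono[OF B(2)[of x], of "\<bar>a\<bar>"] B(1) by (simp add: abs_mult mult.commute)
      then show "norm ((indicator K x *\<^sub>R f x) * \<psi> x) \<le> norm (B * (indicator K x *\<^sub>R f x))"
        by (simp only: real_norm_def)
    qed
  qed
  also have "(\<lambda>x. (indicator K x *\<^sub>R f x) * \<psi> x) = (\<lambda>x. indicator U x *\<^sub>R (f x * \<psi> x))"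
  proof
    show "(indicator K x *\<^sub>R f x) * \<psi> x = indicator U x *\<^sub>R (f x * \<psi> x)" for x
      using K(2) K(3)[of x] by (cases "x \<in> K") auto
  qed
  finally show ?thesis using U by (simp add: integrable_restrict_space)
qed

lemma weak_gradient_dir_deriv:
  assumes U: "open U" and g: "is_weak_gradient U v g" and \<psi>: "test_function U \<psi>"
  shows "(LINT x|lebesgue_on U. v x * dir_deriv \<psi> q x) = - (LINT x|lebesgue_on U. (g x \<bullet> q) * \<psi> x)"
proof -
  note li = is_weak_gradient_locally_integrable[OF g]
  have gi: "integrable (lebesgue_on U) (\<lambda>x. g x $ i * \<psi> x)" for i
    using locally_integrable_test[OF U locally_integrable_inner[OF li(2), of "axis i 1"] \<psi>]
    by (simp add: inner_axis)
  have vi: "integrable (lebesgue_on U) (\<lambda>x. v x * partial_deriv i \<psi> x)" for i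
    by (rule locally_integrable_test[OF U li(1) test_function_partial[OF \<psi>]])
  have "(LINT x|lebesgue_on U. v x * dir_deriv \<psi> q x) =
      (LINT x|lebesgue_on U. (\<Sum>i\<in>UNIV. q $ i * (v x * partial_deriv i \<psi> x)))"
    by (simp add: dir_deriv_def sum_distrib_left mult_ac)
  also have "\<dots> = (\<Sum>i\<in>UNIV. q $ i * (LINT x|lebesgue_on U. v x * partial_deriv i \<psi> x))"
    using vi by (subst Bochner_Integration.integral_sum) auto
  also have "\<dots> = - (\<Sum>i\<in>UNIV. q $ i * (LINT x|lebesgue_on U. g x $ i * \<psi> x))"
    by (simp add: weak_gradient_test[OF g \<psi>] sum_negf)
  also have "(\<Sum>i\<in>UNIV. q $ i * (LINT x|lebesgue_on U. g x $ i * \<psi> x)) =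
      (LINT x|lebesgue_on U. (\<Sum>i\<in>UNIV. q $ i * (g x $ i * \<psi> x)))"
    using gi by (subst Bochner_Integration.integral_sum) auto
  also have "\<dots> = (LINT x|lebesgue_on U. (g x \<bullet> q) * \<psi> x)"
    by (simp add: inner_vec_def sum_distrib_left sum_distrib_right mult_ac)
  finally show ?thesis .
qed

text \<open>Integrability is given only on compact subsets; an increasing compact exhaustion of
  \<open>U\<close> yields measurability as a pointwise limit.\<close>

lemma locally_integrable_measurable:
  fixes g :: "real^'n \<Rightarrow> 'b::euclidean_space"
  assumes U: "open U" and g: "locally_integrable U g"
  shows "g \<in> borel_measurable (lebesgue_on U)"
proof -
  obtain C :: "nat \<Rightarrow> (real^'n) set"
    where C: "\<And>n. compact (C n)" "\<And>n. C n \<subseteq> U" "\<And>n. C n \<subseteq> C (Suc n)" "\<Union> (range C) = U"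
  proof (rule open_Union_compact_subsets[OF U])
    fix C :: "nat \<Rightarrow> (real^'n) set"
    assume a: "\<And>n. compact (C n)" "\<And>n. C n \<subseteq> U" "\<And>n. C n \<subseteq> interior (C (Suc n))" "\<Union> (range C) = U"
    have "C n \<subseteq> C (Suc n)" for n using a(3)[of n] interior_subset by blast
    then show ?thesis using that[of C, OF a(1,2) _ a(4)] by blast
  qed
  have inc: "C m \<subseteq> C n" if "m \<le> n" for m n using lift_Suc_mono_le[of C, OF C(3) that] .
  have "(\<lambda>x. indicator U x *\<^sub>R g x) \<in> borel_measurable lebesgue"
  proof (rule borel_measurable_LIMSEQ_metric)
    have "integrable lebesgue (\<lambda>x. indicator (C n) x *\<^sub>R g x)" for n
      using g C(1)[of n] C(2)[of n] unfolding locally_integrable_def set_integrable_def by blast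
    then show "(\<lambda>x. indicator (C n) x *\<^sub>R g x) \<in> borel_measurable lebesgue" for n
      by (rule borel_measurable_integrable)
    fix x :: "real^'n"
    show "(\<lambda>n. indicator (C n) x *\<^sub>R g x) \<longlonglongrightarrow> indicator U x *\<^sub>R g x"
    proof (cases "x \<in> U")
      case True
      then obtain m where m: "x \<in> C m" using C(4) by blast
      have "\<forall>\<^sub>F n in sequentially. g x = indicator (C n) x *\<^sub>R g x"
        using eventually_ge_at_top[of m] by eventually_elim (use m inc in \<open>auto simp: indicator_def\<close>)
      then have "(\<lambda>n. indicator (C n) x *\<^sub>R g x) \<longlonglongrightarrow> g x"
        by (rule Lim_transform_eventually[OF tendsto_const])
      then show ?thesis using True by simp
    next
      case False
      then have "x \<notin> C n" for n using C(2) by blast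
      then show ?thesis using False by simp
    qed
  qed
  then show ?thesis using U by (simp add: borel_measurable_restrict_space_iff)
qed

text \<open>The fundamental lemma is applied to each component in both orders. This makes the energy
  independent of the representative chosen by \<open>weak_gradient\<close>.\<close>

lemma weak_gradient_unique:
  assumes U: "open U" and g: "is_weak_gradient U v g" and g': "is_weak_gradient U v g'"
  shows "AE x in lebesgue_on U. g x = g' x"
proof -
  note li = is_weak_gradient_locally_integrable(2)[OF g] is_weak_gradient_locally_integrable(2)[OF g']
  have le: "AE x in lebesgue_on U. 0 \<le> h x \<bullet> axis i 1 - h' x \<bullet> axis i 1"
    if h: "is_weak_gradient U v h" "is_weak_gradient U v h'" for h h' i
  proof (rule fundamental_lemma_nonneg[OF U])
    note lh = is_weak_gradient_locally_integrable(2)[OF h(1)] is_weak_gradient_locally_integrable(2)[OF h(2)]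
    show "locally_integrable U (\<lambda>x. h x \<bullet> axis i 1 - h' x \<bullet> axis i 1)"
      by (intro locally_integrable_diff locally_integrable_inner lh)
    fix \<psi> assume \<psi>: "test_function U \<psi>"
    have "(LINT x|lebesgue_on U. (h x \<bullet> axis i 1 - h' x \<bullet> axis i 1) * \<psi> x) =
      (LINT x|lebesgue_on U. (h x \<bullet> axis i 1) * \<psi> x) - (LINT x|lebesgue_on U. (h' x \<bullet> axis i 1) * \<psi> x)"
      unfolding left_diff_distrib
      by (intro Bochner_Integration.integral_diff locally_integrable_test[OF U _ \<psi>] locally_integrable_inner lh)
    also have "\<dots> = 0"
      using weak_gradient_dir_deriv[OF U h(1) \<psi>, of "axis i 1"] weak_gradient_dir_deriv[OF U h(2) \<psi>, of "axis i 1"] by simp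
    finally show "0 \<le> (LINT x|lebesgue_on U. (h x \<bullet> axis i 1 - h' x \<bullet> axis i 1) * \<psi> x)" by simp
  qed
  have "AE x in lebesgue_on U. g x \<bullet> axis i 1 = g' x \<bullet> axis i 1" for i :: 'a
    using le[OF g g', of i] le[OF g' g, of i] by eventually_elim simp
  then have "AE x in lebesgue_on U. \<forall>i\<in>UNIV. g x \<bullet> axis i 1 = g' x \<bullet> axis i 1"
    by (intro AE_finite_allI) auto
  then show ?thesis by eventually_elim (simp add: vec_eq_iff inner_axis)
qed

lemma lipschitz_weak_gradient:
  fixes U :: "(real^'n) set"
  assumes U: "open U" "bounded U" and w: "continuous_on UNIV w"
    and lip: "\<And>x y. \<bar>w x - w y\<bar> \<le> L * norm (x - y)"
  obtains g where "is_weak_gradient U w g"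
proof -
  have "\<exists>g. integrable (lebesgue_on U) g \<and> (\<forall>\<psi>. test_function U \<psi> \<longrightarrow>
      (LINT x|lebesgue_on U. w x * partial_deriv i \<psi> x) = - (LINT x|lebesgue_on U. g x * \<psi> x))" for i
    by (rule lipschitz_weak_derivative[OF U w lip, of i]) blast
  then obtain g where g: "\<And>i. integrable (lebesgue_on U) (g i)" "\<And>i \<psi>. test_function U \<psi> \<Longrightarrow>
      (LINT x|lebesgue_on U. w x * partial_deriv i \<psi> x) = - (LINT x|lebesgue_on U. g i x * \<psi> x)" by metis
  define G where "G x = (\<chi> i. g i x)" for x
  have "is_weak_gradient U w G"
    unfolding is_weak_gradient_def
  proof (intro conjI allI impI)
    fix K assume K: "compact K \<and> K \<subseteq> U"
    have Kl: "K \<in> sets lebesgue" using K by (simp add: compact_imp_closed borel_closed)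
    have "integrable lborel (\<lambda>x. indicator K x *\<^sub>R w x)"
      using K by (intro borel_integrable_compact continuous_on_subset[OF w]) auto
    then show "set_integrable lebesgue K w"
      unfolding set_integrable_def by (subst integrable_completion) auto
    have gU: "set_integrable lebesgue U (g i)" for i
      using g(1)[of i] U by (simp add: integrable_restrict_space set_integrable_def)
    have "integrable lebesgue (\<lambda>x. indicator K x *\<^sub>R g i x)" for i
      using set_integrable_subset[OF gU Kl] K by (simp add: set_integrable_def)
    then have "integrable lebesgue (\<lambda>x. \<Sum>i\<in>UNIV. (indicator K x *\<^sub>R g i x) *\<^sub>R (axis i 1 :: real^'n))"
      by (intro Bochner_Integration.integrable_sum integrable_scaleR_left)
    also have "(\<lambda>x. \<Sum>i\<in>UNIV. (indicator K x *\<^sub>R g i x) *\<^sub>R (axis i 1 :: real^'n)) = (\<lambda>x. indicator K x *\<^sub>R G x)"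
    proof
      fix x
      have "G x = (\<Sum>i\<in>UNIV. g i x *\<^sub>R axis i 1)"
        using basis_expansion[of "G x"] by (simp add: G_def scalar_mult_eq_scaleR)
      then show "(\<Sum>i\<in>UNIV. (indicator K x *\<^sub>R g i x) *\<^sub>R (axis i 1 :: real^'n)) = indicator K x *\<^sub>R G x"
        by (simp add: scaleR_sum_right)
    qed
    finally show "set_integrable lebesgue K G" by (simp add: set_integrable_def)
  next
    fix \<psi> i assume "test_function U \<psi>"
    then show "(LINT x|lebesgue_on U. w x * partial_deriv i \<psi> x) = - (LINT x|lebesgue_on U. G x $ i * \<psi> x)"
      using g(2) by (simp add: G_def)
  qed
  then show ?thesis by (rule that)
qed

context finsler
begin

text \<open>For each fixed direction \<open>q\<close> the difference quotient bound gives
  \<open>g x \<bullet> q \<le> K * \<phi> q\<close> almost everywhere, and the dual norm is the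
  least constant valid for all directions.\<close>

lemma weak_gradient_dual_bound:
  assumes U: "open U" and w: "continuous_on UNIV w" and K: "0 \<le> K"
    and lip: "\<And>x y. w x \<le> w y + K * \<phi> (x - y)" and g: "is_weak_gradient U w g"
  shows "AE x in lebesgue_on U. dual_norm \<phi> (g x) \<le> K"
proof -
  note li = is_weak_gradient_locally_integrable(2)[OF g]
  have one: "AE x in lebesgue_on U. 0 \<le> K * \<phi> q - g x \<bullet> q" for q
  proof (rule fundamental_lemma_nonneg[OF U])
    show "locally_integrable U (\<lambda>x. K * \<phi> q - g x \<bullet> q)"
      by (intro locally_integrable_diff locally_integrable_inner locally_integrable_const li)
    fix \<psi> assume \<psi>: "test_function U \<psi>" "\<And>x. 0 \<le> \<psi> x"
    have "(LINT x|lborel. w x * dir_deriv \<psi> (- q) x) \<le> (K * \<phi> q) * (LINT x|lborel. \<bar>\<psi> x\<bar>)"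
    proof (rule integral_dir_deriv_le[OF w \<psi>(1)])
      fix x and t :: real assume t: "0 < t"
      have "w (x - t *\<^sub>R (- q)) - w x \<le> K * \<phi> (t *\<^sub>R q)" using lip[of "x + t *\<^sub>R q" x] by simp
      also have "\<dots> = t * (K * \<phi> q)" using t by (simp add: phi_scale)
      finally show "(w (x - t *\<^sub>R (- q)) - w x) * \<psi> x \<le> t * (K * \<phi> q) * \<bar>\<psi> x\<bar>"
        using \<psi>(2)[of x] by (simp add: mult_right_mono)
    qed
    moreover have "(LINT x|lborel. w x * dir_deriv \<psi> (- q) x) = (LINT x|lebesgue_on U. (g x \<bullet> q) * \<psi> x)"
      using integral_on_test[OF U test_function_dir_deriv[OF \<psi>(1), of "- q"] w]
        weak_gradient_dir_deriv[OF U g \<psi>(1), of "- q"] by simp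
    moreover have "(LINT x|lborel. \<bar>\<psi> x\<bar>) = (LINT x|lebesgue_on U. \<psi> x)"
      using integral_on_test[OF U \<psi>(1), of "\<lambda>_. 1"] \<psi>(2) by simp
    ultimately have le: "(LINT x|lebesgue_on U. (g x \<bullet> q) * \<psi> x) \<le> (K * \<phi> q) * (LINT x|lebesgue_on U. \<psi> x)" by simp
    have "integrable (lebesgue_on U) (\<lambda>x. (K * \<phi> q) * \<psi> x)" "integrable (lebesgue_on U) (\<lambda>x. (g x \<bullet> q) * \<psi> x)"
      by (intro locally_integrable_test[OF U _ \<psi>(1)] locally_integrable_const locally_integrable_inner li)+
    then have "(LINT x|lebesgue_on U. (K * \<phi> q - g x \<bullet> q) * \<psi> x) =
        (LINT x|lebesgue_on U. (K * \<phi> q) * \<psi> x) - (LINT x|lebesgue_on U. (g x \<bullet> q) * \<psi> x)"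
      unfolding left_diff_distrib by (rule Bochner_Integration.integral_diff)
    then show "0 \<le> (LINT x|lebesgue_on U. (K * \<phi> q - g x \<bullet> q) * \<psi> x)" using le by simp
  qed
  \<comment> \<open>The exceptional null set depends on the direction. A countable dense set of
    directions gives a common one, and continuity in \<open>q\<close> covers the rest.\<close>
  obtain D :: "(real^'n) set" where D: "countable D" "\<And>X. open X \<Longrightarrow> X \<noteq> {} \<Longrightarrow> \<exists>d\<in>D. d \<in> X"
    using countable_dense_setE by blast
  have "AE x in lebesgue_on U. \<forall>q\<in>D. 0 \<le> K * \<phi> q - g x \<bullet> q"
    using one by (simp add: AE_ball_countable[OF D(1)])
  then show ?thesis
  proof eventually_elim
    fix x assume *: "\<forall>q\<in>D. 0 \<le> K * \<phi> q - g x \<bullet> q"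
    have "0 \<le> K * \<phi> q - g x \<bullet> q" for q
    proof (rule ccontr)
      assume q: "\<not> 0 \<le> K * \<phi> q - g x \<bullet> q"
      have "open {q. K * \<phi> q - g x \<bullet> q < 0}"
        by (intro open_Collect_less continuous_intros phi_continuous_on)
      moreover have "q \<in> {q. K * \<phi> q - g x \<bullet> q < 0}" using q by simp
      ultimately obtain d where "d \<in> D" "K * \<phi> d - g x \<bullet> d < 0" using D(2) by blast
      then show False using * by force
    qed
    then show "dual_norm \<phi> (g x) \<le> K" using K by (intro dual_leI) (simp add: diff_ge_0_iff_ge)
  qed
qed

end

subsection \<open>Pointwise bounds for competitors\<close>

lemma continuous_zero_extension:
  fixes v :: "'a::metric_space \<Rightarrow> real"
  assumes "open U" "continuous_on (closure U) v" "\<And>x. x \<in> frontier U \<Longrightarrow> v x = 0"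
  shows "continuous_on UNIV (\<lambda>x. if x \<in> U then v x else 0)"
proof -
  have "continuous_on (closure U \<union> - U) (\<lambda>x. if x \<in> U then v x else 0)"
  proof (rule continuous_on_closed_Un)
    have "v x = (if x \<in> U then v x else 0)" if "x \<in> closure U" for x
      using assms(1,3) that by (auto simp: frontier_def interior_open)
    then show "continuous_on (closure U) (\<lambda>x. if x \<in> U then v x else 0)"
      by (rule continuous_on_eq[OF assms(2)])
    have "(0::real) = (if x \<in> U then v x else 0)" if "x \<in> - U" for x using that by simp
    then show "continuous_on (- U) (\<lambda>x. if x \<in> U then v x else 0)"
      by (rule continuous_on_eq[OF continuous_on_const])
  qed (use assms(1) in auto)
  moreover have "closure U \<union> - U = UNIV" using closure_subset[of U] by blast
  ultimately show ?thesis by simp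
qed

lemma is_weak_gradient_cong:
  assumes g: "is_weak_gradient U v g" and eq: "\<And>x. x \<in> U \<Longrightarrow> v x = v' x"
  shows "is_weak_gradient U v' g"
  unfolding is_weak_gradient_def
proof (intro conjI allI impI)
  fix K assume K: "compact K \<and> K \<subseteq> U"
  have "(\<lambda>x. indicator K x *\<^sub>R v' x) = (\<lambda>x. indicator K x *\<^sub>R v x)"
  proof
    show "indicator K x *\<^sub>R v' x = indicator K x *\<^sub>R v x" for x
      using K eq[of x] by (cases "x \<in> K") auto
  qed
  moreover have "set_integrable lebesgue K v" using g K by (simp add: is_weak_gradient_def)
  ultimately show "set_integrable lebesgue K v'" by (simp add: set_integrable_def)
  show "set_integrable lebesgue K g" using g K by (simp add: is_weak_gradient_def)
next
  fix \<psi> i assume \<psi>: "test_function U \<psi>"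
  have "(LINT x|lebesgue_on U. v' x * partial_deriv i \<psi> x) = (LINT x|lebesgue_on U. v x * partial_deriv i \<psi> x)"
    by (rule Bochner_Integration.integral_cong) (use eq in auto)
  then show "(LINT x|lebesgue_on U. v' x * partial_deriv i \<psi> x) = - (LINT x|lebesgue_on U. g x $ i * \<psi> x)"
    using weak_gradient_test[OF g \<psi>] by simp
qed

lemma bump_shift: "bump w r z = bump 0 r (z - w)"
  by (simp add: bump_def)

lemma dir_deriv_bump_shift: "dir_deriv (bump w r) q z = dir_deriv (bump 0 r) q (z - w)"
proof -
  have "((\<lambda>t. bump w r (z + t *\<^sub>R q)) has_real_derivative dir_deriv (bump w r) q (z + 0 *\<^sub>R q)) (at 0)"
    by (rule has_derivative_dir_deriv[OF smooth_bump])
  moreover have "((\<lambda>t. bump 0 r ((z - w) + t *\<^sub>R q)) has_real_derivative dir_deriv (bump 0 r) q ((z - w) + 0 *\<^sub>R q)) (at 0)"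
    by (rule has_derivative_dir_deriv[OF smooth_bump])
  moreover have "bump w r (z + t *\<^sub>R q) = bump 0 r ((z - w) + t *\<^sub>R q)" for t
    by (subst bump_shift) (simp add: algebra_simps)
  ultimately show ?thesis using DERIV_unique by fastforce
qed

lemma bump_continuous: "continuous_on UNIV (bump w r)"
  by (intro smooth_continuous smooth_bump)

lemma bump_integral_shift:
  fixes w :: "real^'n"
  shows "(LINT z|lborel. bump w r z) = (LINT z|lborel. bump (0::real^'n) r z)"
proof -
  have "bump w r \<in> borel_measurable borel" by (intro borel_measurable_continuous_onI bump_continuous)
  from lborel_integral_affine[OF _ this, of 1 w] show ?thesis by (simp add: bump_shift[of w])
qed

lemma bump_integral_pos: assumes "0 < r" shows "0 < (LINT z|lborel. bump (0::real^'n) r z)"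
proof -
  have t: "test_function UNIV (bump (0::real^'n) r)" by (rule test_function_bump[OF assms]) simp
  have i: "integrable lborel (bump (0::real^'n) r)" using test_function_integrable[OF t, of "\<lambda>_. 1"] by simp
  have nn: "0 \<le> (LINT z|lborel. bump (0::real^'n) r z)"
    by (intro Bochner_Integration.integral_nonneg) (simp add: bump_nonneg)
  have "(LINT z|lborel. bump (0::real^'n) r z) \<noteq> 0"
  proof
    assume "(LINT z|lborel. bump (0::real^'n) r z) = 0"
    then have "AE z in lborel. bump (0::real^'n) r z = 0"
      using i by (subst (asm) integral_nonneg_eq_0_iff_AE) (auto simp: bump_nonneg)
    then have ae: "AE z in lborel. z \<notin> ball (0::real^'n) r"
      by eventually_elim (use bump_nonzero_iff[OF assms, of "0::real^'n"] in blast)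
    have "ball (0::real^'n) r \<in> null_sets lborel"
      using ae by (subst AE_iff_null_sets) auto
    then have "measure lborel (ball (0::real^'n) r) = 0" by (auto simp: null_sets_def measure_def)
    then show False using content_ball_pos[OF assms, of "0::real^'n"] by simp
  qed
  then show ?thesis using nn by simp
qed

lemma integral_cbox_lborel:
  fixes f :: "'a::euclidean_space \<Rightarrow> real"
  assumes "continuous_on UNIV f" "\<And>x. x \<notin> cbox a b \<Longrightarrow> f x = 0"
  shows "integral (cbox a b) f = (LINT x|lborel. f x)"
proof -
  have "integrable lborel f"
    by (rule integrable_continuous_compact_support[OF assms(1) compact_cbox[of a b] assms(2)])
  then have "(f has_integral (LINT x|lborel. f x)) UNIV" by (rule has_integral_integral_lborel)
  moreover have "(\<lambda>x. if x \<in> cbox a b then f x else 0) = f" using assms(2) by auto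
  ultimately have "((\<lambda>x. if x \<in> cbox a b then f x else 0) has_integral (LINT x|lborel. f x)) UNIV"
    by (simp only:)
  then show ?thesis by (simp only: has_integral_restrict_UNIV integral_unique)
qed

context finsler
begin

text \<open>The bound on the gradient holds only almost everywhere and says nothing on a single
  segment. Averaging \<open>v\<close> over a bump that slides along the segment produces a
  differentiable function whose derivative is an average of \<open>g z \<bullet> e\<close>; the
  averages at the two ends are close to \<open>v x\<close> and \<open>v y\<close>.\<close>

lemma segment_estimate:
  assumes U: "open U" "bounded U" and v: "continuous_on UNIV v" "\<And>x. x \<notin> U \<Longrightarrow> v x = 0"
    and g: "is_weak_gradient U v g" and E: "0 \<le> E" "AE x in lebesgue_on U. dual_norm \<phi> (g x) \<le> E"
    and seg: "closed_segment y x \<subseteq> U"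
  shows "v x - v y \<le> E * \<phi> (x - y)"
proof (rule field_le_epsilon)
  fix \<epsilon> :: real assume \<epsilon>: "0 < \<epsilon>"
  define e where "e = x - y"
  define \<gamma> where "\<gamma> t = y + t *\<^sub>R e" for t
  have \<gamma>_seg: "\<gamma> t \<in> closed_segment y x" if "0 \<le> t" "t \<le> 1" for t
    using that by (auto simp: closed_segment_def \<gamma>_def e_def algebra_simps intro!: exI[of _ t])
  obtain r0 where r0: "0 < r0" "(\<Union>w\<in>closed_segment y x. cball w r0) \<subseteq> U"
    using compact_subset_open_imp_cball_epsilon_subset[OF compact_segment U(1) seg] by blast
  have "isCont v x" "isCont v y" using v(1) by (auto simp: continuous_on_eq_continuous_at)
  then obtain r1 r2 where r12: "0 < r1" "\<And>z. dist z x < r1 \<Longrightarrow> dist (v z) (v x) < \<epsilon> / 2"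
      "0 < r2" "\<And>z. dist z y < r2 \<Longrightarrow> dist (v z) (v y) < \<epsilon> / 2"
    using \<epsilon> half_gt_zero unfolding continuous_at_eps_delta by metis
  define r where "r = min r0 (min r1 r2)"
  have r: "0 < r" "r \<le> r0" "r \<le> r1" "r \<le> r2" using r0 r12 by (auto simp: r_def)
  have sub: "cball (\<gamma> t) r \<subseteq> U" if "0 \<le> t" "t \<le> 1" for t
    using \<gamma>_seg[OF that] r0(2) subset_cball[OF r(2), of "\<gamma> t"] by blast
  \<comment> \<open>The bump is not normalised; its mass \<open>I\<close> is carried along and
    cancelled at the end.\<close>
  define I where "I = (LINT z|lborel. bump (0::real^'n) r z)"
  have I: "0 < I" unfolding I_def by (rule bump_integral_pos[OF r(1)])
  obtain a where a: "U \<subseteq> cbox (- a) a" using bounded_subset_cbox_symmetric[OF U(2)] by blast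
  \<comment> \<open>The motion of the bump is written as a shift of its argument, so that the
    derivative in \<open>t\<close> is a directional derivative of one fixed function.\<close>
  define f where "f t z = v z * bump 0 r ((z - y) + t *\<^sub>R (- e))" for t z
  define f' where "f' t z = v z * dir_deriv (bump 0 r) (- e) ((z - y) + t *\<^sub>R (- e))" for t z
  have fb: "f t z = v z * bump (\<gamma> t) r z" for t z
    unfolding f_def bump_shift[of "\<gamma> t" r z] by (simp add: \<gamma>_def algebra_simps)
  have f'b: "f' t z = - (v z * dir_deriv (bump (\<gamma> t) r) e z)" for t z
    unfolding f'_def dir_deriv_bump_shift[of "\<gamma> t" r e z] dir_deriv_uminus by (simp add: \<gamma>_def algebra_simps)
  define F where "F t = integral (cbox (- a) a) (f t)" for t
  have tb: "test_function UNIV (bump (0::real^'n) r)" by (rule test_function_bump[OF r(1)]) simp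
  have fc: "continuous_on UNIV (f t)" for t
    unfolding fb[abs_def] by (intro continuous_intros v bump_continuous)
  have F_eq: "F t = (LINT z|lborel. v z * bump (\<gamma> t) r z)" for t
  proof -
    have "F t = (LINT z|lborel. f t z)"
      unfolding F_def by (rule integral_cbox_lborel[OF fc]) (use a v(2) in \<open>auto simp: f_def\<close>)
    then show ?thesis by (simp add: fb)
  qed
  have dF: "(F has_real_derivative integral (cbox (- a) a) (f' t)) (at t)" for t
  proof -
    have "(F has_field_derivative integral (cbox (- a) a) (f' t)) (at t within UNIV)"
      unfolding F_def
    proof (rule leibniz_rule_field_derivative[where fx=f'])
      show "((\<lambda>t. f t z) has_field_derivative f' t z) (at t within UNIV)" for t z
        unfolding f_def f'_def
        by (intro DERIV_cmult) (rule has_derivative_dir_deriv[OF smooth_bump])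
      show "f t integrable_on cbox (- a) a" for t
        by (intro integrable_continuous continuous_on_subset[OF fc]) auto
      have dc: "continuous_on UNIV (dir_deriv (bump 0 r) (- e))"
        by (rule test_function_continuous[OF test_function_dir_deriv[OF tb]])
      have "continuous_on (UNIV \<times> cbox (- a) a) (\<lambda>p. v (snd p))"
        by (rule continuous_on_compose2[OF v(1)]) (auto intro: continuous_intros)
      moreover have "continuous_on (UNIV \<times> cbox (- a) a) (\<lambda>p. dir_deriv (bump 0 r) (- e) ((snd p - y) + fst p *\<^sub>R (- e)))"
        by (rule continuous_on_compose2[OF dc]) (auto intro!: continuous_intros)
      ultimately show "continuous_on (UNIV \<times> cbox (- a) a) (\<lambda>(t, z). f' t z)"
        unfolding f'_def split_beta by (rule continuous_on_mult)
    qed auto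
    then show ?thesis by simp
  qed
  have F'_le: "integral (cbox (- a) a) (f' t) \<le> E * \<phi> e * I" if t: "0 \<le> t" "t \<le> 1" for t
  proof -
    define \<psi> where "\<psi> = bump (\<gamma> t) r"
    have \<psi>: "test_function U \<psi>" unfolding \<psi>_def by (rule test_function_bump[OF r(1) sub[OF t]])
    have \<psi>0: "0 \<le> \<psi> z" for z by (simp add: \<psi>_def bump_nonneg)
    have f'c: "continuous_on UNIV (f' t)"
      unfolding f'b[abs_def] \<psi>_def[symmetric]
      by (intro continuous_intros v test_function_continuous[OF test_function_dir_deriv[OF \<psi>]])
    have "integral (cbox (- a) a) (f' t) = (LINT z|lborel. f' t z)"
      by (rule integral_cbox_lborel[OF f'c]) (use a v(2) in \<open>auto simp: f'_def\<close>)
    also have "\<dots> = - (LINT z|lborel. v z * dir_deriv \<psi> e z)" by (simp add: f'b \<psi>_def)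
    also have "\<dots> = (LINT z|lebesgue_on U. (g z \<bullet> e) * \<psi> z)"
      using integral_on_test[OF U(1) test_function_dir_deriv[OF \<psi>, of e] v(1)]
        weak_gradient_dir_deriv[OF U(1) g \<psi>, of e] by simp
    also have "\<dots> \<le> (LINT z|lebesgue_on U. (E * \<phi> e) * \<psi> z)"
    proof (rule integral_mono_AE)
      show "integrable (lebesgue_on U) (\<lambda>z. (g z \<bullet> e) * \<psi> z)" "integrable (lebesgue_on U) (\<lambda>z. (E * \<phi> e) * \<psi> z)"
        by (intro locally_integrable_test[OF U(1) _ \<psi>] locally_integrable_const locally_integrable_inner
            is_weak_gradient_locally_integrable(2)[OF g])+
      show "AE z in lebesgue_on U. (g z \<bullet> e) * \<psi> z \<le> (E * \<phi> e) * \<psi> z"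
        using E(2)
      proof eventually_elim
        fix z assume z: "dual_norm \<phi> (g z) \<le> E"
        have "g z \<bullet> e \<le> dual_norm \<phi> (g z) * \<phi> e" by (rule inner_le_dual)
        also have "\<dots> \<le> E * \<phi> e" using z by (intro mult_right_mono) auto
        finally show "(g z \<bullet> e) * \<psi> z \<le> (E * \<phi> e) * \<psi> z" using \<psi>0 by (intro mult_right_mono)
      qed
    qed
    also have "\<dots> = (LINT z|lborel. (E * \<phi> e) * \<psi> z)"
      by (rule integral_on_test[OF U(1) \<psi> continuous_on_const])
    also have "\<dots> = E * \<phi> e * I" unfolding \<psi>_def I_def bump_integral_shift[of "\<gamma> t" r, symmetric] by simp
    finally show ?thesis .
  qed
  have "\<exists>z>0. z < 1 \<and> F 1 - F 0 = (1 - 0) * integral (cbox (- a) a) (f' z)"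
    by (rule MVT2[of 0 1 F "\<lambda>t. integral (cbox (- a) a) (f' t)"]) (simp_all add: dF)
  then have main: "F 1 - F 0 \<le> E * \<phi> e * I" using F'_le by auto
  have approx: "\<bar>(LINT z|lborel. v z * bump w r z) - v w * I\<bar> \<le> (\<epsilon> / 2) * I"
    if w: "\<And>z. dist z w < r \<Longrightarrow> dist (v z) (v w) < \<epsilon> / 2" for w
  proof -
    have tw: "test_function UNIV (bump w r)" by (rule test_function_bump[OF r(1)]) simp
    have iw: "integrable lborel (bump w r)" using test_function_integrable[OF tw, of "\<lambda>_. 1"] by simp
    have ivw: "integrable lborel (\<lambda>z. v z * bump w r z)" by (rule test_function_integrable[OF tw v(1)])
    have Iw: "(LINT z|lborel. c * bump w r z) = c * I" for c
      unfolding I_def bump_integral_shift[of w r, symmetric] by simp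
    have b: "(v w - \<epsilon> / 2) * bump w r z \<le> v z * bump w r z" "v z * bump w r z \<le> (v w + \<epsilon> / 2) * bump w r z" for z
    proof -
      have *: "bump w r z = 0 \<or> v w - \<epsilon> / 2 \<le> v z \<and> v z \<le> v w + \<epsilon> / 2"
      proof (cases "z \<in> ball w r")
        case True
        then have "dist z w < r" by (simp add: dist_commute)
        from w[OF this] show ?thesis unfolding dist_real_def by linarith
      qed (use bump_nonzero_iff[OF r(1), of w z] in blast)
      then show "(v w - \<epsilon> / 2) * bump w r z \<le> v z * bump w r z"
        using bump_nonneg[of w r z] mult_right_mono[of "v w - \<epsilon> / 2" "v z" "bump w r z"] by auto
      show "v z * bump w r z \<le> (v w + \<epsilon> / 2) * bump w r z"
        using * bump_nonneg[of w r z] mult_right_mono[of "v z" "v w + \<epsilon> / 2" "bump w r z"] by auto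
    qed
    have "(v w - \<epsilon> / 2) * I \<le> (LINT z|lborel. v z * bump w r z)"
      unfolding Iw[symmetric] using iw ivw b by (intro integral_mono) auto
    moreover have "(LINT z|lborel. v z * bump w r z) \<le> (v w + \<epsilon> / 2) * I"
      unfolding Iw[symmetric] using iw ivw b by (intro integral_mono) auto
    ultimately show ?thesis unfolding left_diff_distrib distrib_right abs_le_iff by linarith
  qed
  have "\<bar>F 1 - v x * I\<bar> \<le> (\<epsilon> / 2) * I"
    unfolding F_eq using approx[of x] r12(2) r(3) by (simp add: \<gamma>_def e_def)
  moreover have "\<bar>F 0 - v y * I\<bar> \<le> (\<epsilon> / 2) * I"
    unfolding F_eq using approx[of y] r12(4) r(4) by (simp add: \<gamma>_def)
  moreover have "(\<epsilon> / 2) * I + (\<epsilon> / 2) * I = \<epsilon> * I" by (simp add: field_simps)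
  ultimately have "v x * I - v y * I \<le> E * \<phi> e * I + \<epsilon> * I"
    using main unfolding abs_le_iff by linarith
  then have "(v x - v y) * I \<le> (E * \<phi> e + \<epsilon>) * I" by (simp add: algebra_simps)
  then show "v x - v y \<le> E * \<phi> (x - y) + \<epsilon>" using I by (simp add: e_def)
qed

text \<open>The segment from \<open>x\<close> to \<open>y\<close> may leave \<open>U\<close> and
  return, so it is followed only up to its first exit, where \<open>v\<close> vanishes. Shortening
  the segment only decreases its length in the sense of \<open>\<phi>\<close>, so the bound with the
  endpoint \<open>y\<close> persists.\<close>

lemma boundary_estimate:
  assumes U: "open U" "bounded U" and v: "continuous_on UNIV v" "\<And>x. x \<notin> U \<Longrightarrow> v x = 0"
    and g: "is_weak_gradient U v g" and E: "0 \<le> E" "AE x in lebesgue_on U. dual_norm \<phi> (g x) \<le> E"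
    and x: "x \<in> U" and y: "y \<notin> U"
  shows "v x \<le> E * \<phi> (x - y)" "- v x \<le> E * \<phi> (y - x)"
proof -
  define \<gamma> where "\<gamma> t = x + t *\<^sub>R (y - x)" for t
  have \<gamma>c: "continuous_on A \<gamma>" for A unfolding \<gamma>_def by (intro continuous_intros)
  \<comment> \<open>The parameters at which the segment is outside \<open>U\<close>; this set is
    compact, and its minimum is the first exit time.\<close>
  define S where "S = {0..1} \<inter> \<gamma> -` (- U)"
  have "closed S" unfolding S_def
    using U(1) by (intro continuous_closed_preimage \<gamma>c) auto
  moreover have "bounded S" unfolding S_def by (rule bounded_subset[of "{0..1}"]) auto
  ultimately have "compact S" by (simp add: compact_eq_bounded_closed)
  moreover have "1 \<in> S" using y by (simp add: S_def \<gamma>_def)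
  ultimately obtain t0 where t0: "t0 \<in> S" "\<And>t. t \<in> S \<Longrightarrow> t0 \<le> t" using compact_attains_inf[of S] by blast
  have t0': "0 < t0" "t0 \<le> 1" "\<gamma> t0 \<notin> U"
  proof -
    show "t0 \<le> 1" "\<gamma> t0 \<notin> U" using t0(1) by (auto simp: S_def)
    have "0 \<notin> S" using x by (simp add: S_def \<gamma>_def)
    then show "0 < t0" using t0(1) by (cases "t0 = 0") (auto simp: S_def)
  qed
  have inU: "\<gamma> t \<in> U" if "0 \<le> t" "t < t0" for t
  proof (rule ccontr)
    assume "\<gamma> t \<notin> U"
    then have "t \<in> S" using that t0' by (simp add: S_def)
    then show False using t0(2)[of t] that by simp
  qed
  have seg: "closed_segment x (\<gamma> t) \<subseteq> U" if t: "0 \<le> t" "t < t0" for t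
  proof
    fix z assume "z \<in> closed_segment x (\<gamma> t)"
    then obtain s where s: "0 \<le> s" "s \<le> 1" "z = (1 - s) *\<^sub>R x + s *\<^sub>R \<gamma> t" by (auto simp: closed_segment_def)
    then have "z = \<gamma> (s * t)" by (simp add: \<gamma>_def algebra_simps)
    moreover have "s * t \<le> 1 * t" using s t by (intro mult_right_mono) auto
    ultimately show "z \<in> U" using s t by (simp add: inU)
  qed
  have est: "v x - v (\<gamma> t) \<le> E * \<phi> (x - y)" "v (\<gamma> t) - v x \<le> E * \<phi> (y - x)" if t: "0 \<le> t" "t < t0" for t
  proof -
    have e: "x - \<gamma> t = t *\<^sub>R (x - y)" "\<gamma> t - x = t *\<^sub>R (y - x)" by (auto simp: \<gamma>_def algebra_simps)
    have t1: "t \<le> 1" using t t0' by simp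
    have "v x - v (\<gamma> t) \<le> E * \<phi> (x - \<gamma> t)"
      using seg[OF t] by (intro segment_estimate[OF U v g E]) (auto simp: closed_segment_commute)
    also have "\<dots> = E * (t * \<phi> (x - y))" unfolding e using t by (simp add: phi_scale)
    also have "\<dots> \<le> E * \<phi> (x - y)" using E(1) t t1 by (intro mult_left_mono) (auto simp: mult_left_le_one_le)
    finally show "v x - v (\<gamma> t) \<le> E * \<phi> (x - y)" .
    have "v (\<gamma> t) - v x \<le> E * \<phi> (\<gamma> t - x)" using seg[OF t] by (intro segment_estimate[OF U v g E])
    also have "\<dots> = E * (t * \<phi> (y - x))" unfolding e using t by (simp add: phi_scale)
    also have "\<dots> \<le> E * \<phi> (y - x)" using E(1) t t1 by (intro mult_left_mono) (auto simp: mult_left_le_one_le)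
    finally show "v (\<gamma> t) - v x \<le> E * \<phi> (y - x)" .
  qed
  have "continuous_on UNIV (\<lambda>t. v (\<gamma> t))" by (intro continuous_on_compose2[OF v(1) \<gamma>c]) auto
  then have "((\<lambda>t. v (\<gamma> t)) \<longlongrightarrow> v (\<gamma> t0)) (at t0)" by (simp add: continuous_on_def)
  then have lim: "((\<lambda>t. v (\<gamma> t)) \<longlongrightarrow> 0) (at_left t0)"
    using v(2)[OF t0'(3)] tendsto_within_subset[of _ _ t0 UNIV "{..<t0}"] by simp
  have ev: "\<forall>\<^sub>F t in at_left t0. 0 \<le> t \<and> t < t0"
    unfolding eventually_at_left_field using t0'(1) by (intro exI[of _ 0]) auto
  have "v x - E * \<phi> (x - y) \<le> 0"
  proof (rule tendsto_lowerbound[OF lim])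
    show "\<forall>\<^sub>F t in at_left t0. v x - E * \<phi> (x - y) \<le> v (\<gamma> t)"
      using ev by eventually_elim (use est(1) in \<open>auto simp: algebra_simps\<close>)
  qed simp
  then show "v x \<le> E * \<phi> (x - y)" by simp
  have "0 \<le> v x + E * \<phi> (y - x)"
  proof (rule tendsto_upperbound[OF lim])
    show "\<forall>\<^sub>F t in at_left t0. v (\<gamma> t) \<le> v x + E * \<phi> (y - x)"
      using ev by eventually_elim (use est(2) in \<open>auto simp: algebra_simps\<close>)
  qed simp
  then show "- v x \<le> E * \<phi> (y - x)" by simp
qed

end

subsection \<open>The variational characterisation\<close>

lemma AE_lebesgue_on_continuous_le:
  fixes f :: "'a::euclidean_space \<Rightarrow> real"
  assumes U: "open U" and f: "continuous_on U f" and ae: "AE x in lebesgue_on U. f x \<le> c" and x: "x \<in> U"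
  shows "f x \<le> c"
proof -
  define S where "S = {x \<in> U. c < f x}"
  have S: "open S"
    using continuous_open_preimage[OF f U, of "{c<..}"] by (simp add: S_def vimage_def Int_def)
  have "AE x in lebesgue. x \<in> U \<longrightarrow> f x \<le> c" using ae U by (simp add: AE_restrict_space_iff)
  then have "AE x in lebesgue. x \<notin> S" by eventually_elim (auto simp: S_def)
  then have "S \<in> null_sets lebesgue" using S by (subst AE_iff_null_sets) (auto simp: borel_open)
  then have "S = {}" using open_not_negligible[OF S] by (auto simp: negligible_iff_null_sets)
  then show ?thesis using x by (auto simp: S_def not_less)
qed

text \<open>A nonempty open set has positive measure. On a null set the essential supremum would be
  -\<infinity>, and its conversion to a real number would be misleading.\<close>

lemma esssup_norm_nonneg:
  fixes f :: "real^'n \<Rightarrow> 'b::euclidean_space"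
  assumes U: "open U" "U \<noteq> {}"
  shows "0 \<le> esssup (lebesgue_on U) (\<lambda>x. ereal (norm (f x)))"
proof (rule ccontr)
  assume neg: "\<not> 0 \<le> esssup (lebesgue_on U) (\<lambda>x. ereal (norm (f x)))"
  have "AE x in lebesgue_on U. ereal (norm (f x)) \<le> esssup (lebesgue_on U) (\<lambda>x. ereal (norm (f x)))"
    by (rule esssup_AE)
  then have "AE x in lebesgue_on U. (1::real) \<le> 0"
  proof eventually_elim
    fix x assume "ereal (norm (f x)) \<le> esssup (lebesgue_on U) (\<lambda>x. ereal (norm (f x)))"
    also have "\<dots> < 0" using neg by simp
    finally show "(1::real) \<le> 0" by simp
  qed
  moreover obtain x where "x \<in> U" using U by blast
  ultimately show False using AE_lebesgue_on_continuous_le[OF U(1) continuous_on_const, of 1 0] by simp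
qed

lemma Linf_normI:
  fixes f :: "real^'n \<Rightarrow> 'b::euclidean_space"
  assumes U: "open U" "U \<noteq> {}" and f: "f \<in> borel_measurable (lebesgue_on U)"
    and c: "AE x in lebesgue_on U. norm (f x) \<le> c"
  shows "f \<in> Linf U" "Linf_norm U f \<le> c"
proof -
  have le: "esssup (lebesgue_on U) (\<lambda>x. ereal (norm (f x))) \<le> ereal c"
    using f c by (intro esssup_I) auto
  then show "f \<in> Linf U" using f by (auto simp: Linf_def intro: le_less_trans)
  show "Linf_norm U f \<le> c"
    using le esssup_norm_nonneg[OF U, of f] unfolding Linf_norm_def
    by (cases "esssup (lebesgue_on U) (\<lambda>x. ereal (norm (f x)))") auto
qed

lemma Linf_norm_nonneg:
  fixes f :: "real^'n \<Rightarrow> 'b::euclidean_space"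
  assumes U: "open U" "U \<noteq> {}" shows "0 \<le> Linf_norm U f"
  using esssup_norm_nonneg[OF U, of f] unfolding Linf_norm_def by (rule real_of_ereal_pos)

lemma Linf_AE:
  fixes f :: "real^'n \<Rightarrow> 'b::euclidean_space"
  assumes U: "open U" "U \<noteq> {}" and f: "f \<in> Linf U"
  shows "AE x in lebesgue_on U. norm (f x) \<le> Linf_norm U f"
proof -
  define e where "e = esssup (lebesgue_on U) (\<lambda>x. ereal (norm (f x)))"
  have "e < \<infinity>" using f by (simp add: Linf_def e_def)
  moreover have "0 \<le> e" unfolding e_def by (rule esssup_norm_nonneg[OF U])
  ultimately have e: "e = ereal (Linf_norm U f)"
    unfolding Linf_norm_def e_def[symmetric] by (cases e) auto
  have "AE x in lebesgue_on U. ereal (norm (f x)) \<le> e" unfolding e_def by (rule esssup_AE)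
  then show ?thesis by eventually_elim (simp add: e)
qed

lemma Linf_norm_scale:
  fixes f :: "real^'n \<Rightarrow> real"
  assumes "0 < k" shows "Linf_norm U (\<lambda>x. k * f x) = k * Linf_norm U f"
proof -
  have "(\<lambda>x. ereal (norm (k * f x))) = (\<lambda>x. ereal k * ereal (norm (f x)))"
    using assms by (simp add: abs_mult)
  then show ?thesis
    unfolding Linf_norm_def using esssup_cmult[OF assms, of "lebesgue_on U" "\<lambda>x. ereal (norm (f x))"] by simp
qed

context finsler_eigenfunction
begin

abbreviation "N \<equiv> Linf_norm U u"

lemma closure_sub: "x \<in> U \<Longrightarrow> x \<in> closure U"
  using closure_subset by blast

lemma u_cont_U: "continuous_on U u"
  by (rule continuous_on_subset[OF u_cont closure_subset])

lemma u_Linf: "u \<in> Linf U"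
proof -
  obtain xm where xm: "xm \<in> closure U" "\<And>x. x \<in> closure U \<Longrightarrow> u x \<le> u xm"
    using continuous_attains_sup[OF closure_compact closure_ne u_cont] by blast
  have "\<forall>x\<in>space (lebesgue_on U). norm (u x) \<le> u xm"
    using xm(2) closure_sub u_nonneg by auto
  then have "AE x in lebesgue_on U. norm (u x) \<le> u xm" by (intro AE_I2) blast
  then show ?thesis
    using open_U U_ne by (intro Linf_normI continuous_imp_measurable_on_sets_lebesgue u_cont_U) auto
qed

lemma u_le_N: assumes "x \<in> U" shows "u x \<le> N"
proof -
  have "AE x in lebesgue_on U. u x \<le> N"
    using Linf_AE[OF open_U U_ne u_Linf] by eventually_elim simp
  then show ?thesis by (rule AE_lebesgue_on_continuous_le[OF open_U u_cont_U _ assms])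
qed

lemma N_pos: "0 < N"
proof -
  obtain x where "x \<in> U" using U_ne by blast
  then show ?thesis using u_pos[of x] u_le_N[of x] by simp
qed

lemma u0_cont: "continuous_on UNIV u0"
  unfolding u0_def[abs_def] by (rule continuous_zero_extension[OF open_U u_cont u_frontier])

text \<open>The factor \<open>k\<close> covers both \<open>u\<close> itself and its normalisation.
  The gradient bound is proved for every weak gradient, because the energy refers to the one
  selected by choice.\<close>

lemma scaled_W1inf0:
  assumes k: "0 \<le> k"
  shows "(\<lambda>x. k * u x) \<in> W1inf0 U" "finsler_energy \<phi> U (\<lambda>x. k * u x) \<le> k * (\<Lambda> * N)"
proof -
  define K where "K = k * (\<Lambda> * N)"
  have K: "0 \<le> K" using k Lambda_pos N_pos by (simp add: K_def)
  define w where "w x = k * u0 x" for x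
  have wc: "continuous_on UNIV w" unfolding w_def by (intro continuous_intros u0_cont)
  have wU: "w x = k * u x" if "x \<in> U" for x using that by (simp add: w_def u0_def)
  have lip: "w x \<le> w y + K * \<phi> (x - y)" for x y
    using mult_left_mono[OF u_lipschitz[OF u_le_N] k, of x y] by (simp add: w_def K_def distrib_left mult_ac)
  obtain d where d: "0 < d" "\<And>x. \<phi> x \<le> d * norm x" using phi_bounds by metis
  have lip': "\<bar>w x - w y\<bar> \<le> (K * d) * norm (x - y)" for x y
  proof -
    have "K * \<phi> z \<le> (K * d) * norm z" for z using mult_left_mono[OF d(2) K, of z] by simp
    from this[of "x - y"] this[of "y - x"] show ?thesis
      using lip[of x y] lip[of y x] by (simp add: abs_le_iff norm_minus_commute)
  qed
  have bound: "AE x in lebesgue_on U. dual_norm \<phi> (g x) \<le> K" if "is_weak_gradient U (\<lambda>x. k * u x) g" for g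
  proof -
    have "is_weak_gradient U w g" by (rule is_weak_gradient_cong[OF that]) (simp add: wU)
    then show ?thesis by (rule weak_gradient_dual_bound[OF open_U wc K lip])
  qed
  obtain g where "is_weak_gradient U w g"
    using lipschitz_weak_gradient[OF open_U bounded_U wc lip'] by blast
  then have g: "is_weak_gradient U (\<lambda>x. k * u x) g"
    by (rule is_weak_gradient_cong) (simp add: wU)
  have meas: "g \<in> borel_measurable (lebesgue_on U)" if "is_weak_gradient U v g" for v g
    by (rule locally_integrable_measurable[OF open_U is_weak_gradient_locally_integrable(2)[OF that]])
  obtain c where c: "0 < c" "\<And>p. norm p \<le> c * dual_norm \<phi> p" using dual_lower by blast
  have "AE x in lebesgue_on U. norm (g x) \<le> c * K"
    using bound[OF g]
  proof eventually_elim
    fix x assume "dual_norm \<phi> (g x) \<le> K"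
    then have "c * dual_norm \<phi> (g x) \<le> c * K" using c(1) by simp
    then show "norm (g x) \<le> c * K" using c(2)[of "g x"] by linarith
  qed
  then have gL: "g \<in> Linf U" by (rule Linf_normI(1)[OF open_U U_ne meas[OF g]])
  have "AE x in lebesgue_on U. norm (k * u x) \<le> k * N"
    using Linf_AE[OF open_U U_ne u_Linf]
  proof eventually_elim
    fix x assume "norm (u x) \<le> N"
    then show "norm (k * u x) \<le> k * N" using mult_left_mono[of "\<bar>u x\<bar>" N k] k by (simp add: abs_mult)
  qed
  then have "(\<lambda>x. k * u x) \<in> Linf U"
    using open_U by (intro Linf_normI(1)[OF open_U U_ne] continuous_imp_measurable_on_sets_lebesgue continuous_intros u_cont_U) auto
  then have "(\<lambda>x. k * u x) \<in> W1inf U" using g gL by (auto simp: W1inf_def)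
  moreover have "continuous_on (closure U) (\<lambda>x. k * u x)" by (intro continuous_intros u_cont)
  ultimately show "(\<lambda>x. k * u x) \<in> W1inf0 U" using u_frontier by (simp add: W1inf0_def)
  define G where "G = weak_gradient U (\<lambda>x. k * u x)"
  have G: "is_weak_gradient U (\<lambda>x. k * u x) G" unfolding G_def weak_gradient_def by (rule someI[of _ g]) (rule g)
  have "AE x in lebesgue_on U. norm (dual_norm \<phi> (G x)) \<le> K"
    using bound[OF G] by eventually_elim simp
  moreover have "(\<lambda>x. dual_norm \<phi> (G x)) \<in> borel_measurable (lebesgue_on U)"
    by (rule borel_measurable_continuous_on[OF dual_continuous_on meas[OF G]])
  ultimately show "finsler_energy \<phi> U (\<lambda>x. k * u x) \<le> k * (\<Lambda> * N)"
    unfolding finsler_energy_def G_def[symmetric] K_def[symmetric] by (intro Linf_normI(2)[OF open_U U_ne])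
qed

text \<open>The sign condition is what bounds the absolute value of \<open>v\<close> by distances
  \<open>\<phi> (x - y)\<close>: positive values always obey this bound, negative ones only the
  bound with \<open>\<phi> (y - x)\<close>, which is the same when \<open>\<phi>\<close> is
  even.\<close>

lemma Lambda_le_energy:
  assumes v: "v \<in> admissible U" and sgn: "(\<forall>x\<in>U. 0 \<le> v x) \<or> (\<forall>x. \<phi> (- x) = \<phi> x)"
  shows "\<Lambda> \<le> finsler_energy \<phi> U v"
proof -
  define E where "E = finsler_energy \<phi> U v"
  define g where "g = weak_gradient U v"
  have vW: "v \<in> W1inf U" "continuous_on (closure U) v" "\<And>x. x \<in> frontier U \<Longrightarrow> v x = 0" "Linf_norm U v = 1"
    using v by (auto simp: admissible_def W1inf0_def)
  then obtain h where h: "is_weak_gradient U v h" "h \<in> Linf U" by (auto simp: W1inf_def)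
  have g: "is_weak_gradient U v g" unfolding g_def weak_gradient_def by (rule someI[of _ h]) (rule h)
  obtain c where c: "0 < c" "\<And>p. dual_norm \<phi> p \<le> c * norm p" using dual_upper by blast
  \<comment> \<open>The energy is meaningful only if it is finite. The competitor provides some
    bounded weak gradient \<open>h\<close>, and uniqueness transfers its bound to the selected
    one.\<close>
  have "AE x in lebesgue_on U. norm (dual_norm \<phi> (g x)) \<le> c * Linf_norm U h"
    using Linf_AE[OF open_U U_ne h(2)] weak_gradient_unique[OF open_U g h(1)]
  proof eventually_elim
    fix x assume "norm (h x) \<le> Linf_norm U h" "g x = h x"
    then have "c * norm (g x) \<le> c * Linf_norm U h" using c(1) by simp
    then show "norm (dual_norm \<phi> (g x)) \<le> c * Linf_norm U h" using c(2)[of "g x"] by simp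
  qed
  moreover have "g \<in> borel_measurable (lebesgue_on U)"
    by (rule locally_integrable_measurable[OF open_U is_weak_gradient_locally_integrable(2)[OF g]])
  then have "(\<lambda>x. dual_norm \<phi> (g x)) \<in> borel_measurable (lebesgue_on U)"
    by (rule borel_measurable_continuous_on[OF dual_continuous_on])
  ultimately have "(\<lambda>x. dual_norm \<phi> (g x)) \<in> Linf U" by (intro Linf_normI(1)[OF open_U U_ne])
  from Linf_AE[OF open_U U_ne this]
  have gE: "AE x in lebesgue_on U. dual_norm \<phi> (g x) \<le> E"
    unfolding E_def finsler_energy_def g_def by eventually_elim simp
  have E0: "0 \<le> E" unfolding E_def finsler_energy_def by (rule Linf_norm_nonneg[OF open_U U_ne])
  define w where "w x = (if x \<in> U then v x else 0)" for x
  have wc: "continuous_on UNIV w" unfolding w_def[abs_def]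
    by (rule continuous_zero_extension[OF open_U vW(2,3)])
  have w0: "w x = 0" if "x \<notin> U" for x using that by (simp add: w_def)
  have gw: "is_weak_gradient U w g" by (rule is_weak_gradient_cong[OF g]) (simp add: w_def)
  have est: "\<bar>v x\<bar> \<le> E * \<phi> (x - y)" if x: "x \<in> U" and y: "y \<notin> U" for x y
  proof -
    have 1: "v x \<le> E * \<phi> (x - y)" "- v x \<le> E * \<phi> (y - x)"
      using boundary_estimate[OF open_U bounded_U wc w0 gw E0 gE x y] x by (auto simp: w_def)
    show ?thesis using sgn
    proof
      assume "\<forall>x\<in>U. 0 \<le> v x"
      then show ?thesis using 1(1) x by simp
    next
      assume even: "\<forall>x. \<phi> (- x) = \<phi> x"
      have "\<phi> (y - x) = \<phi> (x - y)" using even[rule_format, of "x - y"] by simp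
      then show ?thesis using 1 by (simp add: abs_le_iff)
    qed
  qed
  have le: "\<bar>v x\<bar> \<le> E / \<Lambda>" if x: "x \<in> U" for x
  proof -
    obtain z where z: "z \<notin> U" using outer_point by blast
    have "\<Lambda> * \<bar>v x\<bar> \<le> E"
    \<comment> \<open>The degenerate cases are split off so that the radius of the backward ball is
      well defined and positive.\<close>
    proof (cases "E = 0 \<or> v x = 0")
      case True
      then show ?thesis using est[OF x z] E0 by auto
    next
      case False
      then have E: "0 < E" "0 < \<bar>v x\<bar> / E" using E0 by auto
      have "{y. \<phi> (x - y) < \<bar>v x\<bar> / E} \<subseteq> U"
      proof (rule subsetI, rule ccontr)
        fix y assume y: "y \<in> {y. \<phi> (x - y) < \<bar>v x\<bar> / E}" "y \<notin> U"
        then have "E * \<phi> (x - y) < \<bar>v x\<bar>" using E(1) by (simp add: field_simps)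
        then show False using est[OF x y(2)] by simp
      qed
      from inradius_bound[OF E(2) this] show ?thesis using E(1) by (simp add: field_simps)
    qed
    then show ?thesis using Lambda_pos by (simp add: field_simps)
  qed
  have "Linf_norm U v \<le> E / \<Lambda>"
  proof (rule Linf_normI(2)[OF open_U U_ne])
    show "v \<in> borel_measurable (lebesgue_on U)" using vW(1) by (simp add: W1inf_def Linf_def)
    show "AE x in lebesgue_on U. norm (v x) \<le> E / \<Lambda>" using le by (intro AE_I2) simp
  qed
  then show ?thesis using vW(4) Lambda_pos by (simp add: E_def field_simps)
qed

lemma ground_state:
  defines "w \<equiv> (\<lambda>x. inverse N * u x)"
  shows "w \<in> admissible_nonneg U" "w \<in> admissible U" "finsler_energy \<phi> U w = \<Lambda>"
proof -
  have i: "0 < inverse N" using N_pos by simp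
  have "Linf_norm U w = 1" unfolding w_def using Linf_norm_scale[OF i, of U u] N_pos by simp
  then show adm: "w \<in> admissible U" using scaled_W1inf0(1)[of "inverse N"] i by (simp add: admissible_def w_def)
  have pos: "\<forall>x\<in>U. 0 \<le> w x" using less_imp_le[OF u_pos] i by (simp add: w_def)
  then show "w \<in> admissible_nonneg U" using adm by (simp add: admissible_nonneg_def)
  have "finsler_energy \<phi> U w \<le> inverse N * (\<Lambda> * N)" unfolding w_def using i by (intro scaled_W1inf0) simp
  also have "\<dots> = \<Lambda>" using N_pos by simp
  finally show "finsler_energy \<phi> U w = \<Lambda>" using Lambda_le_energy[OF adm] pos by (intro antisym) blast+
qed

end

theorem theorem3:
  fixes \<phi> :: "real^'n \<Rightarrow> real" and U :: "(real^'n) set"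
    and \<Lambda> :: real and u :: "real^'n \<Rightarrow> real"
  assumes "finsler_norm \<phi>"
    and "open U" and "bounded U" and "U \<noteq> {}"
    and "continuous_on (closure U) u"
    and "viscosity_le (\<lambda>x r p X. min (dual_norm \<phi> p - \<Lambda> * r) (- G_upper \<phi> p X)) u U"
    and "viscosity_ge (\<lambda>x r p X. min (dual_norm \<phi> p - \<Lambda> * r) (- G_lower \<phi> p X)) u U"
    and "\<forall>x\<in>frontier U. u x = 0"
    and nontrivial: "\<forall>C\<in>components U. \<exists>x\<in>C. u x \<noteq> 0"
  shows "u \<in> W1inf0 U \<and>
         \<Lambda> = Lambda_inf_nonneg \<phi> U \<and>
         is_arg_min (finsler_energy \<phi> U) (\<lambda>v. v \<in> admissible_nonneg U)
           (\<lambda>x. inverse (Linf_norm U u) * u x) \<and>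
         ((\<forall>x. \<phi> (- x) = \<phi> x) \<longrightarrow>
            \<Lambda> = Lambda_inf \<phi> U \<and>
            is_arg_min (finsler_energy \<phi> U) (\<lambda>v. v \<in> admissible U)
              (\<lambda>x. inverse (Linf_norm U u) * u x))"
proof -
  interpret finsler_eigenfunction \<phi> U \<Lambda> u
    by unfold_locales (use assms in auto)
  let ?w = "\<lambda>x. inverse (Linf_norm U u) * u x"
  have "u \<in> W1inf0 U" using scaled_W1inf0(1)[of 1] by simp
  moreover have le: "\<Lambda> \<le> finsler_energy \<phi> U v" if "v \<in> admissible_nonneg U" for v
    using that by (intro Lambda_le_energy) (auto simp: admissible_nonneg_def)
  then have "Lambda_inf_nonneg \<phi> U = \<Lambda>"
    unfolding Lambda_inf_nonneg_def using ground_state(1,3)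
    by (intro cInf_eq_minimum) (auto intro!: image_eqI[of _ _ ?w])
  moreover have "is_arg_min (finsler_energy \<phi> U) (\<lambda>v. v \<in> admissible_nonneg U) ?w"
    unfolding is_arg_min_def using ground_state(1,3) le by (auto simp: not_less)
  moreover have "\<Lambda> = Lambda_inf \<phi> U \<and> is_arg_min (finsler_energy \<phi> U) (\<lambda>v. v \<in> admissible U) ?w"
    if even: "\<forall>x. \<phi> (- x) = \<phi> x"
  proof
    have le': "\<Lambda> \<le> finsler_energy \<phi> U v" if "v \<in> admissible U" for v
      using that even by (intro Lambda_le_energy) auto
    then have "Lambda_inf \<phi> U = \<Lambda>"
      unfolding Lambda_inf_def using ground_state(2,3)
      by (intro cInf_eq_minimum) (auto intro!: image_eqI[of _ _ ?w])
    then show "\<Lambda> = Lambda_inf \<phi> U" by simp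
    show "is_arg_min (finsler_energy \<phi> U) (\<lambda>v. v \<in> admissible U) ?w"
      unfolding is_arg_min_def using ground_state(2,3) le' by (auto simp: not_less)
  qed
  ultimately show ?thesis by simp
qed

end
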